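(* Let $(\Omega,\mathcal A,P)$ be a probability space, let $\mathcal M$ be a sub-$\sigma$-algebra of $\mathcal A$, and let $\mathbb S$ be a completely regular Radon topological space whose compact subsets are metrizable. Let $c:\mathbb S\times\mathbb S\to[0,+\infty]$ be a mapping satisfying $$c(x,y)=\sup_{u\in \mathrm{Lip}^{(c)}_{\mathbb S}}|u(x)-u(y)|\qquad\text{for all }x,y\in\mathbb S,$$ where $\mathrm{Lip}^{(c)}_{\mathbb S}$ is the set of bounded continuous functions $u:\mathbb S\to\mathbb R$ such that $|u(x)-u(y)|\le c(x,y)$ for all $x,y\in\mathbb S$. Fix $x_0\in\mathbb S$. Let $X$ be a random variable on $(\Omega,\mathcal A,P)$ with values in $\mathbb S$, with distribution $P_X$ such that $\int c(x,x_0)\,P_X(dx)<+\infty$, and let $P_{X|\mathcal M}$ be a regular conditional distribution of $X$ given $\mathcal M$. Assume that there exists a random variable $U$ from $(\Omega,\mathcal A)$ to $([0,1],\mathcal B([0,1]))$, independent of $\sigma(X)\vee\mathcal M$ and uniformly distributed over $[0,1]$. Let $Q$ be any element of $\mathcal Y^{c,1}(\Omega,\mathcal M,P;\mathbb S)$, with disintegration $\omega\mapsto Q_\omega$. Then there exists a $\sigma(U)\vee\sigma(X)\vee\mathcal M$-measurable random variable $Y$ with values in $\mathbb S$ such that $\omega\mapsto Q_\omega$ is a regular conditional probability of $Y$ given $\mathcal M$, and $$E\big(c(X,Y)\,\big|\,\mathcal M\big)(\omega)=\sup_{f\in\mathrm{Lip}^{(c)}_{\mathbb S}}\Big|\int f(x)\,P_{X|\mathcal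 M}(dx,\omega)-\int f(x)\,Q_\omega(dx)\Big|\qquad\text{for }P\text{-almost every }\omega.$$
   Context: For a topological space $T$, $\mathcal B_T$ is its Borel $\sigma$-algebra and $\mathcal P(T)$ is the space of probability measures on $(T,\mathcal B_T)$ with the narrow topology, i.e. the coarsest topology for which $\mu\mapsto\int\varphi\,d\mu$ is lower semicontinuous for every lower semicontinuous $\varphi:T\to[0,1]$; measurability of maps into $\mathcal P(T)$ is with respect to $\mathcal B_{\mathcal P(T)}$. A topological space $\mathbb S$ is completely regular if for every $x\in\mathbb S$ and every closed $F\subset\mathbb S$ with $x\notin F$ there is a continuous $f:\mathbb S\to[0,1]$ with $f(x)=0$ and $f=1$ on $F$. It is Radon if every finite Borel measure on $\mathbb S$ is inner regular with respect to the compact subsets of $\mathbb S$. Regular conditional distributions of $\mathbb S$-valued random variables exist when $\mathbb S$ is Radon with metrizable compact subsets. $\mathcal Y(\Omega,\mathcal M,P;\mathbb S)$ is the set of probability measures $\mu$ on $(\Omega\times\mathbb S,\mathcal M\otimes\mathcal B_{\mathbb S})$ such that $\mu(A\times\mathbb S)=P(A)$ for all $A\in\mathcal M$, and $\mathcal Y^{c,1}(\Omega,\mathcal M,P;\mathbb S)$ is the set of those $\mu\in\mathcal Y(\Omega,\mathcal M,P;\mathbb S)$ with $\int_{\Omega\times\mathbb S}c(x,x_0)\,d\mu(\omega,x)<+\infty$, $x_0$ being the fixed element of $\mathbb S$. A disintegration of $\mu\in\mathcal Y(\Omega,\mathcal M,P;\mathbb S)$ is an $\mathcal M$-measurable map $\omega\mapsto\mu_\omega$,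 $\Omega\to\mathcal P(\mathbb S)$, such that $\mu(f)=\int_\Omega\int_{\mathbb S}f(\omega,x)\,d\mu_\omega(x)\,dP(\omega)$ for every measurable $f:\Omega\times\mathbb S\to[0,+\infty]$; under the assumptions on $\mathbb S$ it exists and is unique up to $P$-a.e. equality. *)

theory Defs
  imports "HOL-Probability.Probability"
begin

definition radon_space :: "'s::topological_space itself \<Rightarrow> bool" where
  "radon_space _ \<longleftrightarrow>
    (\<forall>\<mu> :: 's measure. finite_measure \<mu> \<longrightarrow> sets \<mu> = sets borel \<longrightarrow>
      (\<forall>B\<in>sets borel. emeasure \<mu> B = (SUP K\<in>{K. K \<subseteq> B \<and> compact K}. emeasure \<mu> K)))"

definition lower_semicontinuous :: "('s::topological_space \<Rightarrow> real) \<Rightarrow> bool" where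
  "lower_semicontinuous \<phi> \<longleftrightarrow> (\<forall>t. open {x. t < \<phi> x})"

text \<open>
  The narrow topology is the coarsest topology making \<open>\<mu> \<mapsto> \<integral>\<phi> d\<mu>\<close> lower semicontinuous for
  all the \<open>\<phi>\<close> below, hence the topology with these superlevel sets as a subbase.  Negative \<open>t\<close>
  give the whole set of probability measures, which therefore is the carrier of the topology.
\<close>
definition narrow_topology :: "'s::topological_space measure topology" where
  "narrow_topology = topology_generated_by
    {{\<mu>. prob_space \<mu> \<and> sets \<mu> = sets borel \<and> t < (\<integral>x. \<phi> x \<partial>\<mu>)} | \<phi> t.
      lower_semicontinuous \<phi> \<and> range \<phi> \<subseteq> {0..1}}"

definition narrow_borel :: "'s::topological_space measure measure" where
  "narrow_borel = sigma (topspace narrow_topology) {U. openin narrow_topology U}"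

text \<open>Below, a sub-\<open>\<sigma>\<close>-algebra of \<open>P\<close> is represented by a measure \<open>M\<close> with \<open>subalgebra P M\<close>;
  only \<open>sets M\<close> is relevant.\<close>

definition young_measures :: "'w measure \<Rightarrow> 'w measure \<Rightarrow> ('w \<times> 's::topological_space) measure set" where
  "young_measures P M = {\<mu>. prob_space \<mu> \<and> sets \<mu> = sets (M \<Otimes>\<^sub>M borel) \<and>
    (\<forall>A\<in>sets M. emeasure \<mu> (A \<times> UNIV) = emeasure P A)}"

definition young_measures_c1 ::
  "'w measure \<Rightarrow> 'w measure \<Rightarrow> ('s::topological_space \<Rightarrow> 's \<Rightarrow> ennreal) \<Rightarrow> 's \<Rightarrow> ('w \<times> 's) measure set" where
  "young_measures_c1 P M c x0 =
    {\<mu> \<in> young_measures P M. (\<integral>\<^sup>+ z. c (snd z) x0 \<partial>\<mu>) < \<infinity>}"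

definition is_disintegration ::
  "'w measure \<Rightarrow> 'w measure \<Rightarrow> ('w \<times> 's::topological_space) measure \<Rightarrow> ('w \<Rightarrow> 's measure) \<Rightarrow> bool" where
  "is_disintegration P M \<mu> \<kappa> \<longleftrightarrow> \<kappa> \<in> M \<rightarrow>\<^sub>M narrow_borel \<and>
    (\<forall>f :: 'w \<times> 's \<Rightarrow> ennreal. f \<in> borel_measurable (M \<Otimes>\<^sub>M borel) \<longrightarrow>
      (\<integral>\<^sup>+ z. f z \<partial>\<mu>) = (\<integral>\<^sup>+ \<omega>. (\<integral>\<^sup>+ x. f (\<omega>, x) \<partial>\<kappa> \<omega>) \<partial>P))"

text \<open>Measurability into \<open>prob_algebra borel\<close> says that each \<open>\<omega> \<mapsto> \<kappa> \<omega> B\<close> is \<open>M\<close>-measurable, so that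
  \<open>\<kappa> \<omega> B\<close> is a version of the conditional probability of \<open>X \<in> B\<close>.  Measurability into
  \<open>narrow_borel\<close> implies it.\<close>
definition regular_cond_distr ::
  "'w measure \<Rightarrow> 'w measure \<Rightarrow> ('w \<Rightarrow> 's::topological_space) \<Rightarrow> ('w \<Rightarrow> 's measure) \<Rightarrow> bool" where
  "regular_cond_distr P M X \<kappa> \<longleftrightarrow> \<kappa> \<in> M \<rightarrow>\<^sub>M prob_algebra borel \<and>
    (\<forall>B\<in>sets borel. AE \<omega> in P. emeasure (\<kappa> \<omega>) B = nn_cond_exp P M (indicator (X -` B)) \<omega>)"

definition Lip :: "('s::topological_space \<Rightarrow> 's \<Rightarrow> ennreal) \<Rightarrow> ('s \<Rightarrow> real) set" where
  "Lip c = {u. continuous_on UNIV u \<and> bounded (range u) \<and> (\<forall>x y. ennreal \<bar>u x - u y\<bar> \<le> c x y)}"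

definition generated_algebra :: "'w measure \<Rightarrow> ('w \<Rightarrow> 'a::topological_space) \<Rightarrow> 'w measure" where
  "generated_algebra P X = vimage_algebra (space P) X borel"

definition join_algebra :: "'w measure \<Rightarrow> 'w measure \<Rightarrow> 'w measure" where
  "join_algebra F G = sigma (space F) (sets F \<union> sets G)"

end

theory Submission
  imports Defs
begin

text \<open>
  The lower bound for the conditional cost is the triangle inequality, so one coupling of the right
  total cost is enough.  Both marginals are Radon and live on a \<open>\<sigma>\<close>-compact set \<open>S0\<close>, on which
  countably many \<open>g i \<in> Lip c\<close> suffice to compute \<open>c\<close> and the supremum over \<open>Lip c\<close>.  The cost is
  therefore the increasing limit of the bounded continuous pseudometrics
  \<open>max_dist g n x y = Max {\<bar>g i x - g i y\<bar> | i \<le> n}\<close>.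

  Consider the constraints \<open>L (a (\<omega>, x) + b (\<omega>, y) + l * max_dist g n x y) \<le> \<integral>a + \<integral>b + l * V\<close> on a linear
  functional \<open>L\<close> of bounded functions of \<open>(\<omega>, x, y)\<close>, where \<open>V\<close> is the integral of the supremum over
  \<open>Lip c\<close>.  They are consistent by weak duality for each \<open>\<omega>\<close>, so Hahn--Banach gives a positive \<open>L\<close> with
  the two prescribed marginals and \<open>L (max_dist g n) \<le> V\<close>.  No countable additivity of \<open>L\<close> on product
  sets is needed: \<open>(D, E) \<mapsto> L (1\<^sub>D(\<omega>, x) 1\<^sub>E(y))\<close> is dominated by a measure in each argument, hence
  countably additive in each argument, and after a Borel coding of \<open>S0\<close> by real numbers its
  Radon--Nikodym densities form a conditional distribution function, which the uniform variable \<open>U\<close>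
  realizes as a random variable \<open>Y\<close>.  No optimal plan is selected measurably.
\<close>

section \<open>Linear functionals dominated on a cone\<close>

text \<open>The constraints for all \<open>n\<close> are put into a single cone. Since
  \<open>max_dist g n\<close> increases with \<open>n\<close>, two of them combine at the larger
  index, and one functional, hence one \<open>Y\<close>, serves every \<open>n\<close>; monotone
  convergence then reaches \<open>c\<close>, and no limit of couplings is taken. Finite maxima are
  used because weak duality produces a test function that is Lipschitz for the cost at hand: for
  \<open>max_dist g n\<close> such a function is continuous and belongs to \<open>Lip c\<close>,
  while a function that is merely \<open>c\<close>-Lipschitz can be discontinuous. The cost survives
  although only the values of \<open>L\<close> on rectangles are realized: rounding the values of
  \<open>g 0\<close>, ..., \<open>g n\<close> approximates \<open>max_dist g n\<close> uniformly by
  finite combinations of indicators of rectangles, and \<open>L\<close> is continuous for uniform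
  convergence. The point \<open>x0\<close> supplies the domination: a function in
  \<open>Lip c\<close> differs from its value at \<open>x0\<close> by at most \<open>c x x0\<close>,
  which makes \<open>V\<close> finite and lets a countable family replace \<open>Lip c\<close>
  inside the integrals.\<close>

lemma bounded_range_add:
  fixes f g :: "'z \<Rightarrow> real"
  assumes "bounded (range f)" "bounded (range g)"
  shows "bounded (range (\<lambda>z. f z + g z))"
  using assms by (rule bounded_plus_comp)

lemma bounded_range_cmult:
  fixes f :: "'z \<Rightarrow> real"
  assumes "bounded (range f)"
  shows "bounded (range (\<lambda>z. t * f z))"
proof -
  from assms obtain B where "\<And>z. \<bar>f z\<bar> \<le> B"
    unfolding bounded_iff by auto
  then have "\<bar>t * f z\<bar> \<le> \<bar>t\<bar> * B" for z
    by (simp add: abs_mult mult_left_mono)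
  then show ?thesis
    unfolding bounded_iff by auto
qed

lemma bounded_range_indicator: "bounded (range (indicator A :: 'z \<Rightarrow> real))"
  unfolding bounded_iff by (intro exI[of _ 1]) (auto simp: indicator_def)

text \<open>A pair \<open>(g, r)\<close> in the cone stands for the constraint \<open>L g \<le> r\<close>.\<close>
definition constraint_cone :: "'z set \<Rightarrow> (('z \<Rightarrow> real) \<times> real) set \<Rightarrow> bool" where
  "constraint_cone Z C \<longleftrightarrow>
    (\<forall>g r h s. (g, r) \<in> C \<longrightarrow> (h, s) \<in> C \<longrightarrow> (\<lambda>z. g z + h z, r + s) \<in> C) \<and>
    (\<forall>g r t. (g, r) \<in> C \<longrightarrow> 0 < t \<longrightarrow> (\<lambda>z. t * g z, t * r) \<in> C) \<and>
    (\<forall>g h r. (g, r) \<in> C \<longrightarrow> (\<forall>z\<in>Z. h z \<le> g z) \<longrightarrow> (h, r) \<in> C) \<and>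
    (\<forall>g r. (g, r) \<in> C \<longrightarrow> (\<forall>z\<in>Z. 0 \<le> g z) \<longrightarrow> 0 \<le> r)"

context
  fixes Z :: "'z set" and C :: "(('z \<Rightarrow> real) \<times> real) set"
  assumes C: "constraint_cone Z C"
begin

lemma constraint_cone_add: "(g, r) \<in> C \<Longrightarrow> (h, s) \<in> C \<Longrightarrow> (\<lambda>z. g z + h z, r + s) \<in> C"
  using C unfolding constraint_cone_def by blast

lemma constraint_cone_scale: "(g, r) \<in> C \<Longrightarrow> 0 < t \<Longrightarrow> (\<lambda>z. t * g z, t * r) \<in> C"
  using C unfolding constraint_cone_def by blast

lemma constraint_cone_mono: "(g, r) \<in> C \<Longrightarrow> (\<And>z. z \<in> Z \<Longrightarrow> h z \<le> g z) \<Longrightarrow> (h, r) \<in> C"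
  using C unfolding constraint_cone_def by blast

lemma constraint_cone_pos: "(g, r) \<in> C \<Longrightarrow> (\<And>z. z \<in> Z \<Longrightarrow> 0 \<le> g z) \<Longrightarrow> 0 \<le> r"
  using C unfolding constraint_cone_def by blast

text \<open>This adjoins the constraint \<open>L f \<le> r\<close>. The only clause at risk is the
  last one of \<open>constraint_cone\<close>, and \<open>compatible\<close> is that clause for
  multiples \<open>t > 0\<close>; \<open>t = 0\<close> falls back on \<open>C\<close>. Building the
  inequality \<open>h z \<le> g z + t * f z\<close> into the set makes it downward closed at
  once.\<close>

lemma constraint_cone_insert:
  assumes compatible: "\<And>g s t. (g, s) \<in> C \<Longrightarrow> 0 < t \<Longrightarrow> (\<And>z. z \<in> Z \<Longrightarrow> 0 \<le> g z + t * f z) \<Longrightarrow> 0 \<le> s + t * r"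
  shows "constraint_cone Z {(h, u). \<exists>g s t. (g, s) \<in> C \<and> 0 \<le> t \<and>
    (\<forall>z\<in>Z. h z \<le> g z + t * f z) \<and> u = s + t * r}" (is "constraint_cone Z ?D")
  unfolding constraint_cone_def
proof (intro conjI allI impI)
  fix g r' h s assume "(g, r') \<in> ?D" "(h, s) \<in> ?D"
  then obtain g1 s1 t1 g2 s2 t2 where
    *: "(g1, s1) \<in> C" "0 \<le> t1" "\<And>z. z \<in> Z \<Longrightarrow> g z \<le> g1 z + t1 * f z" "r' = s1 + t1 * r"
       "(g2, s2) \<in> C" "0 \<le> t2" "\<And>z. z \<in> Z \<Longrightarrow> h z \<le> g2 z + t2 * f z" "s = s2 + t2 * r"
    by auto
  have "(\<lambda>z. g1 z + g2 z, s1 + s2) \<in> C"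
    using * constraint_cone_add by blast
  moreover have "g z + h z \<le> (g1 z + g2 z) + (t1 + t2) * f z" if "z \<in> Z" for z
    using *(3,7)[OF that] by (simp add: algebra_simps)
  moreover have "r' + s = (s1 + s2) + (t1 + t2) * r"
    using * by (simp add: algebra_simps)
  ultimately show "(\<lambda>z. g z + h z, r' + s) \<in> ?D"
    using *(2,6) unfolding mem_Collect_eq case_prod_conv
    by (rule_tac exI[where x = "\<lambda>z. g1 z + g2 z"], rule_tac exI[where x = "s1 + s2"],
        rule_tac exI[where x = "t1 + t2"]) auto
next
  fix g r' and t :: real assume "(g, r') \<in> ?D" "0 < t"
  then obtain g1 s1 t1 where
    *: "(g1, s1) \<in> C" "0 \<le> t1" "\<And>z. z \<in> Z \<Longrightarrow> g z \<le> g1 z + t1 * f z" "r' = s1 + t1 * r"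
    by auto
  have "(\<lambda>z. t * g1 z, t * s1) \<in> C"
    using * \<open>0 < t\<close> constraint_cone_scale by blast
  moreover have "t * g z \<le> t * g1 z + (t * t1) * f z" if "z \<in> Z" for z
    using mult_left_mono[OF *(3)[OF that], of t] \<open>0 < t\<close> by (simp add: algebra_simps)
  moreover have "t * r' = t * s1 + (t * t1) * r"
    using * by (simp add: algebra_simps)
  ultimately show "(\<lambda>z. t * g z, t * r') \<in> ?D"
    using *(2) \<open>0 < t\<close> unfolding mem_Collect_eq case_prod_conv
    by (rule_tac exI[where x = "\<lambda>z. t * g1 z"], rule_tac exI[where x = "t * s1"],
        rule_tac exI[where x = "t * t1"]) auto
next
  fix g h :: "'z \<Rightarrow> real" and r' assume "(g, r') \<in> ?D" "\<forall>z\<in>Z. h z \<le> g z"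
  then obtain g1 s1 t1 where
    *: "(g1, s1) \<in> C" "0 \<le> t1" "\<forall>z\<in>Z. g z \<le> g1 z + t1 * f z" "r' = s1 + t1 * r"
    by auto
  moreover have "\<forall>z\<in>Z. h z \<le> g1 z + t1 * f z"
    using *(3) \<open>\<forall>z\<in>Z. h z \<le> g z\<close> by (meson order_trans)
  ultimately show "(h, r') \<in> ?D"
    by blast
next
  fix g :: "'z \<Rightarrow> real" and r' assume "(g, r') \<in> ?D" and g: "\<forall>z\<in>Z. 0 \<le> g z"
  then obtain g1 s1 t1 where
    *: "(g1, s1) \<in> C" "0 \<le> t1" "\<And>z. z \<in> Z \<Longrightarrow> g z \<le> g1 z + t1 * f z" "r' = s1 + t1 * r"
    by auto
  have nn: "0 \<le> g1 z + t1 * f z" if "z \<in> Z" for z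
    using g *(3) that by (meson order_trans)
  show "0 \<le> r'"
  proof (cases "t1 = 0")
    case True then show ?thesis using nn * constraint_cone_pos[OF *(1)] by auto
  next
    case False
    with * nn compatible[OF *(1), of t1] show ?thesis by auto
  qed
qed

end

text \<open>A maximal cone extending \<open>C\<close> is the region above the graph of the functional.\<close>
lemma cone_functional:
  fixes C :: "(('z \<Rightarrow> real) \<times> real) set"
  assumes C: "constraint_cone Z C"
    and const: "\<And>k. \<exists>s. (\<lambda>_. k, s) \<in> C"
  obtains L :: "('z \<Rightarrow> real) \<Rightarrow> real" where
    "\<And>f g. bounded (range f) \<Longrightarrow> bounded (range g) \<Longrightarrow> L (\<lambda>z. f z + g z) = L f + L g"
    "\<And>f t. bounded (range f) \<Longrightarrow> L (\<lambda>z. t * f z) = t * L f"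
    "\<And>f r. bounded (range f) \<Longrightarrow> (f, r) \<in> C \<Longrightarrow> L f \<le> r"
proof -
  define \<A> where "\<A> = {D. C \<subseteq> D \<and> constraint_cone Z D}"
  have "\<exists>M\<in>\<A>. \<forall>X\<in>\<A>. M \<subseteq> X \<longrightarrow> X = M"
  proof (rule subset_Zorn_nonempty)
    show "\<A> \<noteq> {}" using C by (auto simp: \<A>_def)
  next
    fix \<C> assume "\<C> \<noteq> {}" and ch: "subset.chain \<A> \<C>"
    have sub: "\<C> \<subseteq> \<A>" and lin: "\<And>A B. A \<in> \<C> \<Longrightarrow> B \<in> \<C> \<Longrightarrow> A \<subseteq> B \<or> B \<subseteq> A"
      using ch by (auto simp: subset_chain_def)
    have cones: "constraint_cone Z D" if "D \<in> \<C>" for D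
      using sub that by (auto simp: \<A>_def)
    have "constraint_cone Z (\<Union>\<C>)"
      unfolding constraint_cone_def
    proof (intro conjI allI impI)
      fix g h :: "'z \<Rightarrow> real" and r s assume "(g, r) \<in> \<Union>\<C>" "(h, s) \<in> \<Union>\<C>"
      then obtain D where "D \<in> \<C>" "(g, r) \<in> D" "(h, s) \<in> D"
        using lin by blast
      then show "(\<lambda>z. g z + h z, r + s) \<in> \<Union>\<C>"
        using constraint_cone_add[OF cones] by blast
    next
      fix g :: "'z \<Rightarrow> real" and r t :: real assume "(g, r) \<in> \<Union>\<C>" "0 < t"
      then show "(\<lambda>z. t * g z, t * r) \<in> \<Union>\<C>"
        using constraint_cone_scale[OF cones] by blast
    next
      fix g h :: "'z \<Rightarrow> real" and r assume "(g, r) \<in> \<Union>\<C>" "\<forall>z\<in>Z. h z \<le> g z"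
      then obtain D where D: "D \<in> \<C>" "(g, r) \<in> D" by blast
      have "(h, r) \<in> D"
        by (rule constraint_cone_mono[OF cones[OF D(1)] D(2)]) (use \<open>\<forall>z\<in>Z. h z \<le> g z\<close> in auto)
      then show "(h, r) \<in> \<Union>\<C>" using D by blast
    next
      fix g :: "'z \<Rightarrow> real" and r assume "(g, r) \<in> \<Union>\<C>" "\<forall>z\<in>Z. 0 \<le> g z"
      then obtain D where D: "D \<in> \<C>" "(g, r) \<in> D" by blast
      show "0 \<le> r"
        by (rule constraint_cone_pos[OF cones[OF D(1)] D(2)]) (use \<open>\<forall>z\<in>Z. 0 \<le> g z\<close> in auto)
    qed
    then show "\<Union>\<C> \<in> \<A>"
      using \<open>\<C> \<noteq> {}\<close> sub by (auto simp: \<A>_def)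
  qed
  then obtain M where "M \<in> \<A>" and max: "\<And>X. X \<in> \<A> \<Longrightarrow> M \<subseteq> X \<Longrightarrow> X = M"
    by blast
  then have M: "constraint_cone Z M" and CM: "C \<subseteq> M"
    by (auto simp: \<A>_def)
  note add = constraint_cone_add[OF M] and scale = constraint_cone_scale[OF M]
    and mono = constraint_cone_mono[OF M] and pos = constraint_cone_pos[OF M]
  have constM: "\<exists>s. (\<lambda>_. k, s) \<in> M" for k
    using const CM by blast

  define L where "L f = Inf {r. (f, r) \<in> M}" for f
  \<comment> \<open>A constant \<open>K\<close> dominating \<open>\<bar>f z\<bar>\<close> lies in
    the cone with some \<open>s\<close>. Adding it to \<open>(f, r)\<close> gives a nonnegative
    function, so \<open>- s\<close> bounds all \<open>r\<close> from below, and
    \<open>(f, s)\<close> itself is in the cone; thus the infimum is finite.\<close>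
  have bdd: "bdd_below {r. (f, r) \<in> M}" and ne: "{r. (f, r) \<in> M} \<noteq> {}"
    if "bounded (range f)" for f
  proof -
    from that obtain K where K: "\<And>z. \<bar>f z\<bar> \<le> K"
      unfolding bounded_iff by auto
    obtain s where s: "(\<lambda>_. K, s) \<in> M" using constM by blast
    have "- s \<le> r" if "(f, r) \<in> M" for r
    proof -
      have "0 \<le> r + s"
        by (rule pos[OF add[OF that s]]) (use K abs_le_D2 in \<open>smt (verit, best)\<close>)
      then show ?thesis by simp
    qed
    then show "bdd_below {r. (f, r) \<in> M}"
      by (auto intro!: bdd_belowI)
    have "(f, s) \<in> M"
      by (rule mono[OF s]) (use K in \<open>smt (verit, best)\<close>)
    then show "{r. (f, r) \<in> M} \<noteq> {}" by blast
  qed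
  have L_le: "L f \<le> r" if "bounded (range f)" "(f, r) \<in> M" for f r
    unfolding L_def by (rule cInf_lower) (use that bdd in auto)
  have L_ge: "r \<le> L f" if "bounded (range f)" "\<And>s. (f, s) \<in> M \<Longrightarrow> r \<le> s" for f r
    unfolding L_def by (rule cInf_greatest) (use that ne in auto)
  have sub: "L (\<lambda>z. f z + g z) \<le> L f + L g" if "bounded (range f)" "bounded (range g)" for f g
  proof -
    have "L (\<lambda>z. f z + g z) - r \<le> L g" if r: "(f, r) \<in> M" for r
      by (rule L_ge) (use L_le[OF bounded_range_add add[OF r]] \<open>bounded (range f)\<close>
          \<open>bounded (range g)\<close> in fastforce)+
    then have "L (\<lambda>z. f z + g z) - L g \<le> L f"
      by (intro L_ge) (use that in fastforce)+
    then show ?thesis by simp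
  qed
  have hom_le: "L (\<lambda>z. t * f z) \<le> t * L f" if "bounded (range f)" "0 < t" for f t
  proof -
    have "L (\<lambda>z. t * f z) / t \<le> L f"
      by (rule L_ge) (use L_le[OF bounded_range_cmult scale] that in \<open>auto simp: divide_simps mult.commute\<close>)
    then show ?thesis using that by (simp add: divide_simps mult.commute)
  qed
  have hom: "L (\<lambda>z. t * f z) = t * L f" if "bounded (range f)" "0 < t" for f t
  proof (rule antisym[OF hom_le[OF that]])
    have "L (\<lambda>z. (1/t) * (t * f z)) \<le> (1/t) * L (\<lambda>z. t * f z)"
      using that by (intro hom_le bounded_range_cmult) auto
    then show "t * L f \<le> L (\<lambda>z. t * f z)"
      using that by (simp add: field_simps)
  qed
  have zero: "L (\<lambda>_. 0) = 0"
    using hom[of "\<lambda>_. 0" 2] by simp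
  \<comment> \<open>Maximality enters only here, to make the sublinear \<open>L\<close> odd. If
    \<open>r < L f\<close>, the pair \<open>(f, r)\<close> is outside \<open>M\<close>, so adjoining
    it must break positivity; the witnesses satisfy \<open>0 \<le> g z + t * f z\<close> and
    \<open>s + t * r < 0\<close>, and dividing by \<open>t\<close> bounds \<open>L\<close> at
    \<open>- f\<close> by \<open>s / t < - r\<close>.\<close>
  have odd_le: "L (\<lambda>z. - f z) \<le> - L f" if bf: "bounded (range f)" for f
  proof -
    have bf': "bounded (range (\<lambda>z. - f z))"
      using bounded_range_cmult[OF bf, of "-1"] by simp
    have "L (\<lambda>z. - f z) \<le> - r" if r: "r < L f" for r
    proof -
      have "(f, r) \<notin> M" using L_le[OF bf, of r] r by auto
      have "\<exists>g s t. (g, s) \<in> M \<and> 0 < t \<and> (\<forall>z\<in>Z. 0 \<le> g z + t * f z) \<and> s + t * r < 0"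
      proof (rule ccontr)
        assume neg: "\<not> ?thesis"
        define D where "D = {(h, u). \<exists>g s t. (g, s) \<in> M \<and> 0 \<le> t \<and>
          (\<forall>z\<in>Z. h z \<le> g z + t * f z) \<and> u = s + t * r}"
        have D: "constraint_cone Z D"
          unfolding D_def by (rule constraint_cone_insert[OF M]) (use neg in \<open>meson not_le\<close>)
        have MD: "M \<subseteq> D"
        proof
          fix p assume "p \<in> M"
          then show "p \<in> D"
            unfolding D_def
            by (cases p) (clarsimp, metis add.right_neutral mult_zero_left order_refl)
        qed
        have "D = M"
          by (rule max) (use D MD CM in \<open>auto simp: \<A>_def\<close>)
        obtain s where s: "(\<lambda>_. 0, s) \<in> M" using constM by blast
        define e where "e = L f - r"
        have "0 < e" using r by (simp add: e_def)
        \<comment> \<open>The zero function has some bound \<open>s\<close>, which must be scaled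
          below the gap \<open>e\<close> between \<open>r\<close> and \<open>L f\<close>; the
          \<open>1\<close> guards against \<open>s = 0\<close>.\<close>
        define t where "t = e / (2 * (\<bar>s\<bar> + 1))"
        have t: "0 < t" "t * s \<le> e / 2"
        proof -
          show "0 < t" using \<open>0 < e\<close> by (simp add: t_def)
          have "t * s \<le> t * (\<bar>s\<bar> + 1)" using \<open>0 < t\<close> by (intro mult_left_mono) auto
          also have "\<dots> = e / 2" by (simp add: t_def field_simps add_pos_nonneg)
          finally show "t * s \<le> e / 2" .
        qed
        have "(\<lambda>_. 0, t * s) \<in> M" using scale[OF s t(1)] by simp
        then have "(f, t * s + 1 * r) \<in> D"
          unfolding D_def mem_Collect_eq case_prod_conv
          by (rule_tac exI[where x = "\<lambda>_. 0"], rule_tac exI[where x = "t * s"],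
              rule_tac exI[where x = 1]) auto
        then have "L f \<le> t * s + r" using L_le[OF bf] \<open>D = M\<close> by simp
        then show False using t \<open>0 < e\<close> by (simp add: e_def)
      qed
      then obtain g s t where *: "(g, s) \<in> M" "0 < t" "\<And>z. z \<in> Z \<Longrightarrow> 0 \<le> g z + t * f z" "s + t * r < 0"
        by blast
      have "(\<lambda>z. (1/t) * g z, (1/t) * s) \<in> M"
        using * by (intro scale) auto
      then have "(\<lambda>z. - f z, (1/t) * s) \<in> M"
      proof (rule mono)
        fix z assume "z \<in> Z"
        then show "- f z \<le> (1/t) * g z"
          using *(2) *(3)[of z] by (simp add: field_simps)
      qed
      then have "L (\<lambda>z. - f z) \<le> (1/t) * s"
        by (rule L_le[OF bf'])
      also have "\<dots> \<le> - r" using * by (simp add: field_simps)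
      finally show ?thesis .
    qed
    then have "r \<le> - L (\<lambda>z. - f z)" if "r < L f" for r
      using that by fastforce
    then have "L f \<le> - L (\<lambda>z. - f z)"
      by (rule dense_le)
    then show ?thesis by simp
  qed
  have odd: "L (\<lambda>z. - f z) = - L f" if "bounded (range f)" for f
  proof -
    have bf': "bounded (range (\<lambda>z. - f z))"
      using bounded_range_cmult[OF that, of "-1"] by simp
    show ?thesis
      using odd_le[OF that] odd_le[OF bf'] sub[OF that bf'] zero by simp
  qed
  show thesis
  proof (rule that)
    fix f g :: "'z \<Rightarrow> real" assume f: "bounded (range f)" and g: "bounded (range g)"
    have g': "bounded (range (\<lambda>z. - g z))"
      using bounded_range_cmult[OF g, of "-1"] by simp
    show "L (\<lambda>z. f z + g z) = L f + L g"
      using sub[OF f g] sub[OF bounded_range_add[OF f g] g'] odd[OF g] by simp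
  next
    fix f :: "'z \<Rightarrow> real" and t :: real assume f: "bounded (range f)"
    consider "0 < t" | "t = 0" | "t < 0" by linarith
    then show "L (\<lambda>z. t * f z) = t * L f"
    proof cases
      case 3
      have "L (\<lambda>z. - ((- t) * f z)) = - L (\<lambda>z. (- t) * f z)"
        by (rule odd[OF bounded_range_cmult[OF f]])
      then show ?thesis using hom[OF f, of "- t"] 3 by simp
    qed (use hom f zero in auto)
  next
    fix f :: "'z \<Rightarrow> real" and r assume "bounded (range f)" "(f, r) \<in> C"
    then show "L f \<le> r" using L_le CM by blast
  qed
qed

text \<open>Domination by a finite measure makes \<open>m\<close> continuous at the empty set, which
  upgrades finite to countable additivity. Applied in each argument of the bimeasure, it compensates
  for \<open>L\<close> being only finitely additive.\<close>

lemma dominated_additive_measure: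
  fixes m :: "'a set \<Rightarrow> real"
  assumes "finite_measure N"
    and add: "\<And>A B. A \<in> sets N \<Longrightarrow> B \<in> sets N \<Longrightarrow> A \<inter> B = {} \<Longrightarrow> m (A \<union> B) = m A + m B"
    and nn: "\<And>A. A \<in> sets N \<Longrightarrow> 0 \<le> m A"
    and le: "\<And>A. A \<in> sets N \<Longrightarrow> m A \<le> measure N A"
  obtains \<rho> where "sets \<rho> = sets N" "\<And>A. A \<in> sets N \<Longrightarrow> emeasure \<rho> A = ennreal (m A)"
proof -
  interpret finite_measure N by fact
  have pos: "positive (sets N) (\<lambda>A. ennreal (m A))"
    using le[of "{}"] nn[of "{}"] by (simp add: positive_def)
  have "countably_additive (sets N) (\<lambda>A. ennreal (m A))"
  proof (rule sets.empty_continuous_imp_countably_additive[OF pos])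
    show "additive (sets N) (\<lambda>A. ennreal (m A))"
      unfolding additive_def using add nn by (auto simp: ennreal_plus)
    fix A :: "nat \<Rightarrow> 'a set" assume A: "range A \<subseteq> sets N" "decseq A" "(\<Inter>i. A i) = {}"
    have "(\<lambda>i. measure N (A i)) \<longlonglongrightarrow> measure N (\<Inter>i. A i)"
      using A by (intro finite_Lim_measure_decseq) auto
    then have "(\<lambda>i. measure N (A i)) \<longlonglongrightarrow> 0" using A by simp
    then have "(\<lambda>i. m (A i)) \<longlonglongrightarrow> 0"
      by (rule tendsto_sandwich[OF _ _ tendsto_const, rotated 2]) (use A nn le in auto)
    then show "(\<lambda>i. ennreal (m (A i))) \<longlonglongrightarrow> 0"
      using tendsto_ennrealI by fastforce
  qed auto
  then show thesis
    using pos by (intro that[of "measure_of (space N) (sets N) (\<lambda>A. ennreal (m A))"])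
      (auto simp: emeasure_measure_of_sigma sets.sigma_algebra_axioms sets.space_closed)
qed

text \<open>It suffices to test on the set where \<open>g < f\<close>; finiteness of the integral of
  \<open>f\<close> is what permits the subtraction in \<open>ennreal\<close>.\<close>

lemma AE_le_if_set_integral_le:
  fixes f g :: "'a \<Rightarrow> ennreal"
  assumes [measurable]: "f \<in> borel_measurable N" "g \<in> borel_measurable N"
    and fin: "(\<integral>\<^sup>+x. f x \<partial>N) < \<infinity>"
    and le: "\<And>A. A \<in> sets N \<Longrightarrow> (\<integral>\<^sup>+x\<in>A. f x \<partial>N) \<le> (\<integral>\<^sup>+x\<in>A. g x \<partial>N)"
  shows "AE x in N. f x \<le> g x"
proof -
  define A where "A = {x \<in> space N. g x < f x}"
  have [measurable]: "A \<in> sets N" unfolding A_def by measurable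
  have "(\<integral>\<^sup>+x\<in>A. g x \<partial>N) \<le> (\<integral>\<^sup>+x\<in>A. f x \<partial>N)"
    by (intro nn_integral_mono) (auto simp: A_def indicator_def)
  moreover have fA: "(\<integral>\<^sup>+x\<in>A. f x \<partial>N) \<le> (\<integral>\<^sup>+x. f x \<partial>N)"
    by (intro nn_integral_mono) (auto simp: indicator_def)
  ultimately have fin': "(\<integral>\<^sup>+x\<in>A. g x \<partial>N) \<noteq> \<infinity>" using fin by auto
  have "(\<integral>\<^sup>+x. f x * indicator A x - g x * indicator A x \<partial>N) = (\<integral>\<^sup>+x\<in>A. f x \<partial>N) - (\<integral>\<^sup>+x\<in>A. g x \<partial>N)"
    using fin' by (intro nn_integral_diff) (auto simp: A_def indicator_def)
  also have "\<dots> = 0"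
    using le[of A] order_le_less_trans[OF fA fin] by (simp add: diff_eq_0_iff_ennreal)
  finally have "AE x in N. f x * indicator A x - g x * indicator A x = 0"
    by (subst (asm) nn_integral_0_iff_AE) auto
  then show ?thesis
  proof (rule AE_mp, intro AE_I2 impI)
    fix x assume x: "x \<in> space N" "f x * indicator A x - g x * indicator A x = 0"
    show "f x \<le> g x"
    proof (rule ccontr)
      assume "\<not> f x \<le> g x"
      then have "x \<in> A" using x by (auto simp: A_def)
      then have "f x - g x = 0" using x by simp
      then show False using \<open>\<not> f x \<le> g x\<close> by (simp add: diff_eq_0_iff_ennreal)
    qed
  qed
qed

text \<open>The assumption \<open>weak\<close> is exactly the positivity clause of the cone built
  below, so \<open>cone_functional\<close> applies. The third conclusion encodes both marginals and
  positivity; sign changes of \<open>h\<close>, \<open>a\<close> and \<open>b\<close> turn it into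
  equalities.\<close>

lemma coupling_functional:
  fixes Q1 Q2 :: "('w \<times> 's) measure" and d :: "nat \<Rightarrow> 's \<Rightarrow> 's \<Rightarrow> real"
  assumes Q1: "prob_space Q1" and Q2: "prob_space Q2" and \<Omega>: "space Q1 = \<Omega> \<times> UNIV" "space Q2 = \<Omega> \<times> UNIV"
    and d_bdd: "\<And>n. bounded (range (\<lambda>(x, y). d n x y))"
    and d_nn: "\<And>n x y. 0 \<le> d n x y" and d_mono: "\<And>m n x y. m \<le> n \<Longrightarrow> d m x y \<le> d n x y"
    and weak: "\<And>a b l n. a \<in> borel_measurable Q1 \<Longrightarrow> b \<in> borel_measurable Q2 \<Longrightarrow>
      bounded (range a) \<Longrightarrow> bounded (range b) \<Longrightarrow> 0 < l \<Longrightarrow>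
      (\<And>\<omega> x y. \<omega> \<in> \<Omega> \<Longrightarrow> 0 \<le> a (\<omega>, x) + b (\<omega>, y) + l * d n x y) \<Longrightarrow>
      0 \<le> (\<integral>p. a p \<partial>Q1) + (\<integral>p. b p \<partial>Q2) + l * V"
  obtains L :: "('w \<times> 's \<times> 's \<Rightarrow> real) \<Rightarrow> real" where
    "\<And>f g. bounded (range f) \<Longrightarrow> bounded (range g) \<Longrightarrow> L (\<lambda>z. f z + g z) = L f + L g"
    "\<And>f t. bounded (range f) \<Longrightarrow> L (\<lambda>z. t * f z) = t * L f"
    "\<And>h a b. bounded (range h) \<Longrightarrow> a \<in> borel_measurable Q1 \<Longrightarrow> b \<in> borel_measurable Q2 \<Longrightarrow>
      bounded (range a) \<Longrightarrow> bounded (range b) \<Longrightarrow>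
      (\<And>\<omega> x y. \<omega> \<in> \<Omega> \<Longrightarrow> h (\<omega>, x, y) \<le> a (\<omega>, x) + b (\<omega>, y)) \<Longrightarrow> L h \<le> (\<integral>p. a p \<partial>Q1) + (\<integral>p. b p \<partial>Q2)"
    "\<And>n. L (\<lambda>(\<omega>, x, y). d n x y) \<le> V"
proof -
  interpret Q1: prob_space Q1 by fact
  interpret Q2: prob_space Q2 by fact
  have int: "integrable Q1 a" "integrable Q2 b"
    if "a \<in> borel_measurable Q1" "b \<in> borel_measurable Q2" "bounded (range a)" "bounded (range b)"
    for a b :: "'w \<times> 's \<Rightarrow> real"
  proof -
    obtain A B where "\<And>p. \<bar>a p\<bar> \<le> A" "\<And>p. \<bar>b p\<bar> \<le> B"
      using \<open>bounded (range a)\<close> \<open>bounded (range b)\<close> unfolding bounded_iff by auto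
    then show "integrable Q1 a" "integrable Q2 b"
      using that by (auto intro!: Q1.integrable_const_bound[where B = A] Q2.integrable_const_bound[where B = B])
  qed
  let ?I = "\<lambda>a b. (\<integral>p. a p \<partial>Q1) + (\<integral>p. b p \<partial>Q2)"
  define adm where "adm a b l \<longleftrightarrow> a \<in> borel_measurable Q1 \<and> b \<in> borel_measurable Q2 \<and>
      bounded (range a) \<and> bounded (range b) \<and> 0 < l" for a b :: "'w \<times> 's \<Rightarrow> real" and l :: real
  \<comment> \<open>A constraint keeps its own index \<open>n\<close> and weight \<open>l\<close>,
    so that one cone covers all costs. The weight is strictly positive, matching
    \<open>weak\<close>; the pure marginal bounds are recovered at the end as \<open>l\<close> tends
    to 0.\<close>
  define C where "C = {(g, r). \<exists>a b l n. adm a b l \<and>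
      (\<forall>\<omega> x y. \<omega> \<in> \<Omega> \<longrightarrow> g (\<omega>, x, y) \<le> a (\<omega>, x) + b (\<omega>, y) + l * d n x y) \<and>
      r = ?I a b + l * V}"
  have CI: "(g, ?I a b + l * V) \<in> C"
    if "adm a b l" "\<And>\<omega> x y. \<omega> \<in> \<Omega> \<Longrightarrow> g (\<omega>, x, y) \<le> a (\<omega>, x) + b (\<omega>, y) + l * d n x y" for g a b l n
    unfolding C_def using that by blast
  have CE: "\<exists>a b l n. adm a b l \<and> (\<forall>\<omega> x y. \<omega> \<in> \<Omega> \<longrightarrow> g (\<omega>, x, y) \<le> a (\<omega>, x) + b (\<omega>, y) + l * d n x y) \<and>
      r = ?I a b + l * V" if "(g, r) \<in> C" for g r
    using that unfolding C_def by auto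
  have cone: "constraint_cone (\<Omega> \<times> UNIV) C"
    unfolding constraint_cone_def
  proof (intro conjI allI impI)
    fix g h :: "'w \<times> 's \<times> 's \<Rightarrow> real" and r s assume "(g, r) \<in> C" "(h, s) \<in> C"
    then obtain a b l n a' b' l' n' where *: "adm a b l" "adm a' b' l'"
      "\<And>\<omega> x y. \<omega> \<in> \<Omega> \<Longrightarrow> g (\<omega>, x, y) \<le> a (\<omega>, x) + b (\<omega>, y) + l * d n x y"
      "\<And>\<omega> x y. \<omega> \<in> \<Omega> \<Longrightarrow> h (\<omega>, x, y) \<le> a' (\<omega>, x) + b' (\<omega>, y) + l' * d n' x y"
      "r = ?I a b + l * V"
      "s = ?I a' b' + l' * V"
      using CE[of g r] CE[of h s] by blast
    have "(\<lambda>z. g z + h z, (\<integral>p. a p + a' p \<partial>Q1) + (\<integral>p. b p + b' p \<partial>Q2) + (l + l') * V) \<in> C"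
    proof (rule CI)
      show "adm (\<lambda>p. a p + a' p) (\<lambda>p. b p + b' p) (l + l')"
        using *(1,2) bounded_range_add unfolding adm_def by (auto intro!: borel_measurable_add)
      fix \<omega> x y assume \<omega>: "\<omega> \<in> \<Omega>"
      \<comment> \<open>Costs with different indices are both replaced by the one with the larger
        index.\<close>
      have "l * d n x y \<le> l * d (max n n') x y" "l' * d n' x y \<le> l' * d (max n n') x y"
        using *(1,2) by (auto intro!: mult_left_mono d_mono simp: adm_def)
      then show "g (\<omega>, x, y) + h (\<omega>, x, y) \<le>
          a (\<omega>, x) + a' (\<omega>, x) + (b (\<omega>, y) + b' (\<omega>, y)) + (l + l') * d (max n n') x y"
        using *(3,4)[OF \<omega>, of x y] by (simp add: distrib_right)
    qed
    moreover have "(\<integral>p. a p + a' p \<partial>Q1) + (\<integral>p. b p + b' p \<partial>Q2) + (l + l') * V = r + s"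
    proof -
      have "integrable Q1 a" "integrable Q1 a'" "integrable Q2 b" "integrable Q2 b'"
        using *(1,2) int[of a b] int[of a' b'] unfolding adm_def by blast+
      then show ?thesis by (simp add: *(5,6) distrib_right)
    qed
    ultimately show "(\<lambda>z. g z + h z, r + s) \<in> C" by simp
  next
    fix g :: "'w \<times> 's \<times> 's \<Rightarrow> real" and r t :: real assume "(g, r) \<in> C" "0 < t"
    then obtain a b l n where *: "adm a b l"
      "\<And>\<omega> x y. \<omega> \<in> \<Omega> \<Longrightarrow> g (\<omega>, x, y) \<le> a (\<omega>, x) + b (\<omega>, y) + l * d n x y"
      "r = ?I a b + l * V"
      using CE[of g r] by blast
    have "(\<lambda>z. t * g z, (\<integral>p. t * a p \<partial>Q1) + (\<integral>p. t * b p \<partial>Q2) + (t * l) * V) \<in> C"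
    proof (rule CI)
      show "adm (\<lambda>p. t * a p) (\<lambda>p. t * b p) (t * l)"
        using *(1) bounded_range_cmult \<open>0 < t\<close> unfolding adm_def by (auto intro!: borel_measurable_times)
      fix \<omega> x y assume \<omega>: "\<omega> \<in> \<Omega>"
      show "t * g (\<omega>, x, y) \<le> t * a (\<omega>, x) + t * b (\<omega>, y) + t * l * d n x y"
        using mult_left_mono[OF *(2)[OF \<omega>, of x y], of t] \<open>0 < t\<close> by (simp add: distrib_left mult.assoc)
    qed
    moreover have "(\<integral>p. t * a p \<partial>Q1) + (\<integral>p. t * b p \<partial>Q2) + (t * l) * V = t * r"
      by (simp add: *(3) distrib_left mult.assoc)
    ultimately show "(\<lambda>z. t * g z, t * r) \<in> C" by simp
  next
    fix g h :: "'w \<times> 's \<times> 's \<Rightarrow> real" and r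
    assume "(g, r) \<in> C" and le: "\<forall>z\<in>\<Omega> \<times> UNIV. h z \<le> g z"
    then obtain a b l n where *: "adm a b l"
      "\<And>\<omega> x y. \<omega> \<in> \<Omega> \<Longrightarrow> g (\<omega>, x, y) \<le> a (\<omega>, x) + b (\<omega>, y) + l * d n x y"
      "r = ?I a b + l * V"
      using CE[of g r] by blast
    show "(h, r) \<in> C"
      unfolding *(3)
    proof (rule CI[OF *(1)])
      fix \<omega> x y assume \<omega>: "\<omega> \<in> \<Omega>"
      then have "h (\<omega>, x, y) \<le> g (\<omega>, x, y)" using le by auto
      then show "h (\<omega>, x, y) \<le> a (\<omega>, x) + b (\<omega>, y) + l * d n x y"
        using *(2)[OF \<omega>, of x y] by linarith
    qed
  next
    fix g :: "'w \<times> 's \<times> 's \<Rightarrow> real" and r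
    assume "(g, r) \<in> C" and nn: "\<forall>z\<in>\<Omega> \<times> UNIV. 0 \<le> g z"
    then obtain a b l n where *: "adm a b l"
      "\<And>\<omega> x y. \<omega> \<in> \<Omega> \<Longrightarrow> g (\<omega>, x, y) \<le> a (\<omega>, x) + b (\<omega>, y) + l * d n x y"
      "r = ?I a b + l * V"
      using CE[of g r] by blast
    show "0 \<le> r"
      unfolding *(3)
    proof (rule weak)
      fix \<omega> x y assume \<omega>: "\<omega> \<in> \<Omega>"
      then have "0 \<le> g (\<omega>, x, y)" using nn by auto
      then show "0 \<le> a (\<omega>, x) + b (\<omega>, y) + l * d n x y"
        using *(2)[OF \<omega>, of x y] by linarith
    qed (use *(1) in \<open>auto simp: adm_def\<close>)
  qed
  have const: "\<exists>s. (\<lambda>_. k, s) \<in> C" for k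
  proof
    show "(\<lambda>_. k, (\<integral>p. k \<partial>Q1) + (\<integral>p. 0 \<partial>Q2) + 1 * V) \<in> C"
      by (rule CI[of _ _ _ _ 0]) (use d_nn in \<open>auto simp: adm_def\<close>)
  qed
  obtain L where L: "\<And>f g. bounded (range f) \<Longrightarrow> bounded (range g) \<Longrightarrow> L (\<lambda>z. f z + g z) = L f + L g"
    "\<And>f t. bounded (range f) \<Longrightarrow> L (\<lambda>z. t * f z) = t * L f"
    "\<And>f r. bounded (range f) \<Longrightarrow> (f, r) \<in> C \<Longrightarrow> L f \<le> r"
    using cone_functional[OF cone const] by blast
  show thesis
  proof (rule that[of L])
    show "L (\<lambda>(\<omega>, x, y). d n x y) \<le> V" for n
    proof (rule L(3))
      have "range (\<lambda>(\<omega>, x, y). d n x y) \<subseteq> range (\<lambda>(x, y). d n x y)" by auto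
      then show "bounded (range (\<lambda>(\<omega> :: 'w, x, y). d n x y))"
        by (rule bounded_subset[OF d_bdd])
      have "(\<lambda>(\<omega>, x, y). d n x y, (\<integral>p. 0 \<partial>Q1) + (\<integral>p. 0 \<partial>Q2) + 1 * V) \<in> C"
        by (rule CI[of _ _ _ _ n]) (auto simp: adm_def)
      then show "(\<lambda>(\<omega>, x, y). d n x y, V) \<in> C" by simp
    qed
  next
    fix h :: "'w \<times> 's \<times> 's \<Rightarrow> real" and a b :: "'w \<times> 's \<Rightarrow> real"
    assume h: "bounded (range h)" and ab: "a \<in> borel_measurable Q1" "b \<in> borel_measurable Q2"
      "bounded (range a)" "bounded (range b)" and le: "\<And>\<omega> x y. \<omega> \<in> \<Omega> \<Longrightarrow> h (\<omega>, x, y) \<le> a (\<omega>, x) + b (\<omega>, y)"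
    have "L h \<le> ?I a b + e" if "0 < e" for e
    proof -
      \<comment> \<open>With this weight the extra term \<open>l * V\<close> is at most
        \<open>e\<close>, whatever the sign of \<open>V\<close>.\<close>
      define l where "l = e / (\<bar>V\<bar> + 1)"
      have "0 < l" using that by (simp add: l_def)
      have "L h \<le> ?I a b + l * V"
      proof (intro L(3) h CI[of _ _ _ _ 0])
        fix \<omega> x y assume \<omega>: "\<omega> \<in> \<Omega>"
        have "0 \<le> l * d 0 x y" using \<open>0 < l\<close> d_nn by simp
        then show "h (\<omega>, x, y) \<le> a (\<omega>, x) + b (\<omega>, y) + l * d 0 x y"
          using le[OF \<omega>, of x y] by linarith
      qed (use ab \<open>0 < l\<close> in \<open>auto simp: adm_def\<close>)
      moreover have "l * V \<le> l * (\<bar>V\<bar> + 1)" using \<open>0 < l\<close> by (intro mult_left_mono) auto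
      moreover have "l * (\<bar>V\<bar> + 1) = e" by (simp add: l_def)
      ultimately show ?thesis by linarith
    qed
    then show "L h \<le> ?I a b"
      by (rule field_le_epsilon)
  qed (use L in auto)
qed

section \<open>Realization of a bimeasure\<close>

lemma emeasure_uniform01_lessThan:
  assumes "0 \<le> t" "t \<le> 1"
  shows "emeasure (uniform_measure lborel {0..1}) {u :: real. ennreal u < ennreal t} = ennreal t"
proof -
  have [measurable]: "{u :: real. ennreal u < ennreal t} \<in> sets borel"
    by measurable
  have "{0..1} \<inter> {u. ennreal u < ennreal t} = {0..<t}"
    using assms by (auto simp: ennreal_less_iff)
  then show ?thesis
    using assms by (simp add: divide_ennreal_def)
qed

text \<open>For each level \<open>r\<close>, \<open>\<beta> D {\<phi> > r}\<close> has a density \<open>F r\<close>; the generalized inverse of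
  \<open>r \<mapsto> F r p\<close> applied to a uniform variable has the conditional law prescribed by \<open>\<beta>\<close>.\<close>
lemma bimeasure_realization:
  fixes Q :: "'p measure" and \<nu> :: "'s::topological_space measure" and \<beta> :: "'p set \<Rightarrow> 's set \<Rightarrow> real"
    and \<phi> :: "'s \<Rightarrow> real" and \<psi> :: "real \<Rightarrow> 's"
  assumes "prob_space Q"
    and add1: "\<And>D D' E. D \<in> sets Q \<Longrightarrow> D' \<in> sets Q \<Longrightarrow> D \<inter> D' = {} \<Longrightarrow> E \<in> sets borel \<Longrightarrow>
      \<beta> (D \<union> D') E = \<beta> D E + \<beta> D' E"
    and add2: "\<And>D E E'. D \<in> sets Q \<Longrightarrow> E \<in> sets borel \<Longrightarrow> E' \<in> sets borel \<Longrightarrow> E \<inter> E' = {} \<Longrightarrow>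
      \<beta> D (E \<union> E') = \<beta> D E + \<beta> D E'"
    and nn: "\<And>D E. D \<in> sets Q \<Longrightarrow> E \<in> sets borel \<Longrightarrow> 0 \<le> \<beta> D E"
    and marg1: "\<And>D. D \<in> sets Q \<Longrightarrow> \<beta> D UNIV = measure Q D"
    and \<nu>: "finite_measure \<nu>" "sets \<nu> = sets borel"
    and marg2: "\<And>D E. D \<in> sets Q \<Longrightarrow> E \<in> sets borel \<Longrightarrow> \<beta> D E \<le> measure \<nu> E"
    and \<phi>[measurable]: "\<phi> \<in> borel_measurable borel" and \<phi>01: "\<And>x. 0 \<le> \<phi> x" "\<And>x. \<phi> x < 2"
    and \<psi>[measurable]: "\<psi> \<in> borel \<rightarrow>\<^sub>M borel"
    and S0[measurable]: "S0 \<in> sets borel" and null: "measure \<nu> (- S0) = 0"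
    and inv: "\<And>x. x \<in> S0 \<Longrightarrow> \<psi> (\<phi> x) = x"
  obtains Z :: "'p \<times> real \<Rightarrow> real" where "Z \<in> borel_measurable (Q \<Otimes>\<^sub>M borel)"
    "\<And>D E. D \<in> sets Q \<Longrightarrow> E \<in> sets borel \<Longrightarrow>
      emeasure (Q \<Otimes>\<^sub>M uniform_measure lborel {0..1}) {z \<in> space (Q \<Otimes>\<^sub>M borel). fst z \<in> D \<and> \<psi> (Z z) \<in> E} = \<beta> D E"
proof -
  interpret Q: prob_space Q by fact
  interpret \<nu>: finite_measure \<nu> by fact
  note \<nu>(2)[measurable_cong]
  define \<Lambda> :: "real measure" where "\<Lambda> = uniform_measure lborel {0..1}"
  interpret \<Lambda>: prob_space \<Lambda>
    unfolding \<Lambda>_def by (rule prob_space_uniform_measure) auto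
  have sets_\<Lambda>[measurable_cong]: "sets \<Lambda> = sets borel" by (simp add: \<Lambda>_def)
  have space_\<Lambda>[simp]: "space \<Lambda> = UNIV" by (simp add: \<Lambda>_def)
  have mono2: "\<beta> D E \<le> \<beta> D E'" if "D \<in> sets Q" "E \<in> sets borel" "E' \<in> sets borel" "E \<subseteq> E'" for D E E'
  proof -
    have "\<beta> D (E \<union> (E' - E)) = \<beta> D E + \<beta> D (E' - E)"
      using that by (intro add2) auto
    moreover have "E \<union> (E' - E) = E'" using that by auto
    moreover have "0 \<le> \<beta> D (E' - E)" using that by (intro nn) auto
    ultimately show ?thesis by simp
  qed
  have measure2: "\<exists>\<rho>. sets \<rho> = sets borel \<and> (\<forall>E\<in>sets borel. emeasure \<rho> E = ennreal (\<beta> D E))"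
    if D: "D \<in> sets Q" for D
  proof -
    obtain \<rho> where "sets \<rho> = sets \<nu>" "\<And>E. E \<in> sets \<nu> \<Longrightarrow> emeasure \<rho> E = ennreal (\<beta> D E)"
      by (rule dominated_additive_measure[of \<nu> "\<beta> D"]) (use \<nu> add2[OF D] nn[OF D] marg2[OF D] in auto)
    then show ?thesis using \<nu>(2) by auto
  qed

  define H where "H r = {x. r < \<phi> x}" for r
  have H[measurable]: "H r \<in> sets borel" for r unfolding H_def by measurable
  have "\<exists>F \<in> borel_measurable Q. \<forall>D\<in>sets Q. (\<integral>\<^sup>+p\<in>D. F p \<partial>Q) = ennreal (\<beta> D (H r))" for r
  proof -
    obtain \<rho> where \<rho>: "sets \<rho> = sets Q" "\<And>A. A \<in> sets Q \<Longrightarrow> emeasure \<rho> A = ennreal (\<beta> A (H r))"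
    proof (rule dominated_additive_measure[of Q "\<lambda>D. \<beta> D (H r)"])
      show "finite_measure Q" by unfold_locales
      show "\<beta> A (H r) \<le> measure Q A" if "A \<in> sets Q" for A
        using mono2[OF that H, of UNIV r] marg1[OF that] by simp
    qed (use add1 nn in auto)
    have "absolutely_continuous Q \<rho>"
      unfolding absolutely_continuous_def
    proof
      fix A assume "A \<in> null_sets Q"
      then have A: "A \<in> sets Q" "measure Q A = 0" by (auto simp: measure_def)
      then have "\<beta> A (H r) \<le> 0" using mono2[OF A(1) H, of UNIV r] marg1[OF A(1)] by simp
      then show "A \<in> null_sets \<rho>"
        using A \<rho> by (auto simp: ennreal_neg)
    qed
    from Q.Radon_Nikodym[OF this \<rho>(1)] obtain F where F: "F \<in> borel_measurable Q" "density Q F = \<rho>"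
      by blast
    then show ?thesis using \<rho>(2) by (intro bexI[of _ F]) (auto simp: emeasure_density[symmetric])
  qed
  then obtain F where F[measurable]: "\<And>r. F r \<in> borel_measurable Q"
    and F_int: "\<And>r D. D \<in> sets Q \<Longrightarrow> (\<integral>\<^sup>+p\<in>D. F r p \<partial>Q) = ennreal (\<beta> D (H r))"
    by metis
  have F_fin: "(\<integral>\<^sup>+p. F r p \<partial>Q) < \<infinity>" for r
    using F_int[of "space Q" r] by (simp cong: nn_integral_cong)
  have F_mono: "AE p in Q. F q p \<le> F r p" if "r \<le> q" for q r
  proof (rule AE_le_if_set_integral_le[OF F F F_fin])
    fix A assume A: "A \<in> sets Q"
    have "\<beta> A (H q) \<le> \<beta> A (H r)"
      using that by (intro mono2 A H) (auto simp: H_def)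
    then show "(\<integral>\<^sup>+p\<in>A. F q p \<partial>Q) \<le> (\<integral>\<^sup>+p\<in>A. F r p \<partial>Q)"
      by (simp add: F_int A ennreal_leI)
  qed
  have F_le1: "AE p in Q. F r p \<le> 1" for r
  proof (rule AE_le_if_set_integral_le[OF F _ F_fin])
    fix A assume A: "A \<in> sets Q"
    have "\<beta> A (H r) \<le> measure Q A"
      using mono2[OF A H, of UNIV r] marg1[OF A] by simp
    then show "(\<integral>\<^sup>+p\<in>A. F r p \<partial>Q) \<le> (\<integral>\<^sup>+p\<in>A. 1 \<partial>Q)"
      using A by (simp add: F_int ennreal_leI Q.emeasure_eq_measure)
  qed auto

  \<comment> \<open>Countably many levels let the exceptional null sets of \<open>F_mono\<close> be
    merged. The interval is \<open>{0..2}\<close> because \<open>\<phi>\<close> takes values in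
    \<open>[0, 2)\<close>.\<close>
  define I where "I = \<rat> \<inter> {0..2::real}"
  have cnt_I: "countable I" unfolding I_def by (simp add: countable_rat)
  \<comment> \<open>The element 0 keeps the supremum defined when no level qualifies; it is harmless
    because \<open>\<phi>\<close> is nonnegative.\<close>
  define Z where "Z z = Sup (insert 0 {q \<in> I. ennreal (snd z) < F q (fst z)})" for z :: "'p \<times> real"
  have Z_bdd: "bdd_above (insert 0 {q \<in> I. ennreal (snd z) < F q (fst z)})" for z
    by (rule bdd_aboveI[of _ 2]) (auto simp: I_def)
  have Z_gr: "r < Z z \<longleftrightarrow> r < 0 \<or> (\<exists>q\<in>I. r < q \<and> ennreal (snd z) < F q (fst z))" for r z
    unfolding Z_def by (subst less_cSup_iff[OF _ Z_bdd]) auto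
  have Z[measurable]: "Z \<in> borel_measurable (Q \<Otimes>\<^sub>M borel)"
  proof (rule borel_measurableI_greater)
    fix r
    have "{z \<in> space (Q \<Otimes>\<^sub>M borel). r < Z z} =
        {z \<in> space (Q \<Otimes>\<^sub>M borel). r < 0 \<or> (\<exists>q\<in>I. r < q \<and> ennreal (snd z) < F q (fst z))}"
      by (simp add: Z_gr)
    also have "\<dots> \<in> sets (Q \<Otimes>\<^sub>M borel)"
      using cnt_I by measurable
    finally show "{z \<in> space (Q \<Otimes>\<^sub>M borel). r < Z z} \<in> sets (Q \<Otimes>\<^sub>M borel)" .
  qed

  \<comment> \<open>For fixed \<open>p\<close> in \<open>D\<close> the section is an initial part of
    \<open>[0, 1]\<close> of length \<open>F r p\<close>, by \<open>F_le1\<close>; integrating over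
    \<open>D\<close> gives \<open>\<beta> D (H r)\<close>.\<close>
  have under_graph: "emeasure (Q \<Otimes>\<^sub>M \<Lambda>) {z \<in> space (Q \<Otimes>\<^sub>M \<Lambda>). fst z \<in> D \<and> ennreal (snd z) < F r (fst z)} = ennreal (\<beta> D (H r))"
    if [measurable]: "D \<in> sets Q" for D r
  proof -
    have "emeasure (Q \<Otimes>\<^sub>M \<Lambda>) {z \<in> space (Q \<Otimes>\<^sub>M \<Lambda>). fst z \<in> D \<and> ennreal (snd z) < F r (fst z)} =
        (\<integral>\<^sup>+p. emeasure \<Lambda> (Pair p -` {z \<in> space (Q \<Otimes>\<^sub>M \<Lambda>). fst z \<in> D \<and> ennreal (snd z) < F r (fst z)}) \<partial>Q)"
      by (rule \<Lambda>.emeasure_pair_measure_alt) measurable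
    also have "\<dots> = (\<integral>\<^sup>+p\<in>D. F r p \<partial>Q)"
    proof (rule nn_integral_cong_AE, use F_le1[of r] in eventually_elim)
      fix p assume le: "F r p \<le> 1"
      then obtain t where t: "0 \<le> t" "t \<le> 1" "F r p = ennreal t"
        using order.strict_trans1[OF le ennreal_one_less_top]
        by (cases "F r p") (auto simp: ennreal_le_1)
      show "emeasure \<Lambda> (Pair p -` {z \<in> space (Q \<Otimes>\<^sub>M \<Lambda>). fst z \<in> D \<and> ennreal (snd z) < F r (fst z)}) = F r p * indicator D p"
      proof (cases "p \<in> D")
        case True
        then have "p \<in> space Q" using sets.sets_into_space[OF that] by auto
        then have "Pair p -` {z \<in> space (Q \<Otimes>\<^sub>M \<Lambda>). fst z \<in> D \<and> ennreal (snd z) < F r (fst z)} = {u. ennreal u < ennreal t}"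
          using True t by (auto simp: space_pair_measure)
        then show ?thesis using True t emeasure_uniform01_lessThan[of t] by (simp add: \<Lambda>_def)
      qed (simp add: vimage_def)
    qed
    finally show ?thesis using F_int[OF that] by simp
  qed

  have level: "emeasure (Q \<Otimes>\<^sub>M \<Lambda>) {z \<in> space (Q \<Otimes>\<^sub>M \<Lambda>). fst z \<in> D \<and> r < Z z} = ennreal (\<beta> D (H r))"
    if [measurable]: "D \<in> sets Q" for D r
  proof (cases "r < 0")
    case True
    have "H r = UNIV" using True \<phi>01(1) by (auto simp: H_def intro: less_le_trans)
    moreover have "{z \<in> space (Q \<Otimes>\<^sub>M \<Lambda>). fst z \<in> D \<and> r < Z z} = D \<times> UNIV"
      using True sets.sets_into_space[OF that] by (auto simp: Z_gr space_pair_measure)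
    moreover have "emeasure (Q \<Otimes>\<^sub>M \<Lambda>) (D \<times> UNIV) = emeasure Q D"
      using \<Lambda>.emeasure_pair_measure_Times[OF that, of UNIV] \<Lambda>.emeasure_space_1 by simp
    ultimately show ?thesis using marg1[OF that] by (simp add: Q.emeasure_eq_measure)
  next
    case False
    let ?A = "{z \<in> space (Q \<Otimes>\<^sub>M \<Lambda>). fst z \<in> D \<and> r < Z z}"
    let ?G = "\<lambda>q. {z \<in> space (Q \<Otimes>\<^sub>M \<Lambda>). fst z \<in> D \<and> ennreal (snd z) < F q (fst z)}"
    have Zm[measurable]: "Z \<in> borel_measurable (Q \<Otimes>\<^sub>M \<Lambda>)"
      using Z by (simp cong: measurable_cong_sets sets_pair_measure_cong)
    have A_iff: "z \<in> ?A \<longleftrightarrow> z \<in> space (Q \<Otimes>\<^sub>M \<Lambda>) \<and> fst z \<in> D \<and> (\<exists>q\<in>I. r < q \<and> ennreal (snd z) < F q (fst z))" for z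
      using False by (auto simp: Z_gr)
    have A_meas: "?A \<in> sets (Q \<Otimes>\<^sub>M \<Lambda>)" by measurable
    show ?thesis
    proof (rule antisym)
      \<comment> \<open>Upper bound: \<open>r < Z z\<close> puts \<open>z\<close> below the graph of
        \<open>F q\<close> for some \<open>q > r\<close>, and outside one null set
        \<open>F q \<le> F r\<close>.\<close>
      have "AE p in Q. \<forall>q\<in>I. r < q \<longrightarrow> F q p \<le> F r p"
        using F_mono[of r] by (subst AE_ball_countable[OF cnt_I]) (auto intro: AE_I2)
      then have "AE p in distr (Q \<Otimes>\<^sub>M \<Lambda>) Q fst. \<forall>q\<in>I. r < q \<longrightarrow> F q p \<le> F r p"
        by (subst \<Lambda>.distr_pair_fst)
      then have "AE z in Q \<Otimes>\<^sub>M \<Lambda>. \<forall>q\<in>I. r < q \<longrightarrow> F q (fst z) \<le> F r (fst z)"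
        by (rule AE_distrD[OF measurable_fst])
      then have "AE z in Q \<Otimes>\<^sub>M \<Lambda>. z \<in> ?A \<longrightarrow> z \<in> ?G r"
        by eventually_elim (auto simp: Z_gr False intro: less_le_trans)
      then have "emeasure (Q \<Otimes>\<^sub>M \<Lambda>) ?A \<le> emeasure (Q \<Otimes>\<^sub>M \<Lambda>) (?G r)"
        by (rule emeasure_mono_AE) measurable
      then show "emeasure (Q \<Otimes>\<^sub>M \<Lambda>) ?A \<le> ennreal (\<beta> D (H r))"
        by (simp add: under_graph that)
    next
      obtain \<rho> where \<rho>: "sets \<rho> = sets borel" "\<And>E. E \<in> sets borel \<Longrightarrow> emeasure \<rho> E = ennreal (\<beta> D E)"
        using measure2[OF \<open>D \<in> sets Q\<close>] by blast
      have low: "ennreal (\<beta> D (H q)) \<le> emeasure (Q \<Otimes>\<^sub>M \<Lambda>) ?A" if "q \<in> I" "r < q" for q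
      proof -
        have "emeasure (Q \<Otimes>\<^sub>M \<Lambda>) (?G q) \<le> emeasure (Q \<Otimes>\<^sub>M \<Lambda>) ?A"
          by (rule emeasure_mono[OF _ A_meas]) (use A_iff that in blast)
        then show ?thesis by (simp add: under_graph \<open>D \<in> sets Q\<close>)
      qed
      \<comment> \<open>Lower bound: the densities are not known to be right continuous in the
        level, so continuity is taken from the measure \<open>\<rho>\<close>. The set
        \<open>H r\<close> is the increasing union of the \<open>G n\<close>, and a rational level
        fits between \<open>r\<close> and \<open>r + 1 / Suc n\<close>.\<close>
      define G where "G n = H (r + 1 / Suc n)" for n
      have HG: "H r = (\<Union>n. G n)"
      proof (intro equalityI subsetI)
        fix x assume "x \<in> H r"
        then obtain n where "inverse (real (Suc n)) < \<phi> x - r"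
          using reals_Archimedean[of "\<phi> x - r"] by (auto simp: H_def)
        then have "x \<in> G n" by (simp add: G_def H_def inverse_eq_divide)
        then show "x \<in> (\<Union>n. G n)" by blast
      qed (auto simp: G_def H_def intro: le_less_trans[rotated])
      have G_low: "emeasure \<rho> (G n) \<le> emeasure (Q \<Otimes>\<^sub>M \<Lambda>) ?A" for n
      proof (cases "G n = {}")
        case False
        \<comment> \<open>A nonempty \<open>G n\<close> keeps the rational level inside
          \<open>I\<close>.\<close>
        then have "r + 1 / Suc n < 2" using \<phi>01(2) by (force simp: G_def H_def intro: less_trans)
        moreover obtain q where "q \<in> \<rat>" "r < q" "q < r + 1 / Suc n"
          using Rats_dense_in_real[of r "r + 1 / Suc n"] by auto
        ultimately have q: "q \<in> I" "r < q" "q < r + 1 / Suc n"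
          using \<open>\<not> r < 0\<close> by (auto simp: I_def)
        have "\<beta> D (G n) \<le> \<beta> D (H q)"
          unfolding G_def using q by (intro mono2 H \<open>D \<in> sets Q\<close>) (auto simp: H_def)
        then have "emeasure \<rho> (G n) \<le> ennreal (\<beta> D (H q))"
          by (simp add: \<rho>(2) G_def ennreal_leI)
        then show ?thesis using low[OF q(1,2)] by (rule order_trans)
      qed simp
      have "emeasure \<rho> (\<Union>n. G n) = (SUP n. emeasure \<rho> (G n))"
      proof (rule SUP_emeasure_incseq[symmetric])
        show "range G \<subseteq> sets \<rho>" by (auto simp: G_def \<rho>(1))
        have "1 / real (Suc n) \<le> 1 / real (Suc m)" if "m \<le> n" for m n
          using that by (simp add: field_simps)
        then show "incseq G"
          unfolding incseq_def G_def H_def by (fastforce intro: le_less_trans)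
      qed
      also have "\<dots> \<le> emeasure (Q \<Otimes>\<^sub>M \<Lambda>) ?A"
        by (intro SUP_least G_low)
      finally have "emeasure \<rho> (H r) \<le> emeasure (Q \<Otimes>\<^sub>M \<Lambda>) ?A" by (simp only: HG)
      then show "ennreal (\<beta> D (H r)) \<le> emeasure (Q \<Otimes>\<^sub>M \<Lambda>) ?A" by (simp add: \<rho>(2))
    qed
  qed

  show thesis
  proof (rule that[OF Z])
    fix D and E :: "'s set" assume D[measurable]: "D \<in> sets Q" and E[measurable]: "E \<in> sets borel"
    obtain \<rho> where \<rho>: "sets \<rho> = sets borel" "\<And>E. E \<in> sets borel \<Longrightarrow> emeasure \<rho> E = ennreal (\<beta> D E)"
      using measure2[OF D] by blast
    note \<rho>(1)[measurable_cong]
    have Zm[measurable]: "Z \<in> borel_measurable (Q \<Otimes>\<^sub>M \<Lambda>)"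
      using Z by (simp cong: measurable_cong_sets sets_pair_measure_cong)
    \<comment> \<open>Both are measures on the line: the law of \<open>Z\<close> restricted to
      \<open>D\<close> and the image of \<open>\<beta> D\<close> under \<open>\<phi>\<close>. By
      \<open>level\<close> they agree on all rays, hence everywhere.\<close>
    define \<tau>1 where "\<tau>1 = distr (density (Q \<Otimes>\<^sub>M \<Lambda>) (\<lambda>z. indicator D (fst z))) borel Z"
    define \<tau>2 where "\<tau>2 = distr \<rho> borel \<phi>"
    have \<tau>1: "emeasure \<tau>1 B = emeasure (Q \<Otimes>\<^sub>M \<Lambda>) {z \<in> space (Q \<Otimes>\<^sub>M \<Lambda>). fst z \<in> D \<and> Z z \<in> B}"
      if [measurable]: "B \<in> sets borel" for B
    proof -
      have "emeasure \<tau>1 B = (\<integral>\<^sup>+z. indicator D (fst z) * indicator (Z -` B \<inter> space (Q \<Otimes>\<^sub>M \<Lambda>)) z \<partial>(Q \<Otimes>\<^sub>M \<Lambda>))"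
        unfolding \<tau>1_def by (simp add: emeasure_distr emeasure_density)
      also have "\<dots> = (\<integral>\<^sup>+z. indicator {z \<in> space (Q \<Otimes>\<^sub>M \<Lambda>). fst z \<in> D \<and> Z z \<in> B} z \<partial>(Q \<Otimes>\<^sub>M \<Lambda>))"
        by (intro nn_integral_cong) (auto simp: indicator_def)
      finally show ?thesis by simp
    qed
    have \<tau>2: "emeasure \<tau>2 B = ennreal (\<beta> D (\<phi> -` B))" if [measurable]: "B \<in> sets borel" for B
    proof -
      have "\<phi> -` B \<in> sets borel" using measurable_sets_borel[OF \<phi> that] .
      then show ?thesis
        unfolding \<tau>2_def using \<rho> sets_eq_imp_space_eq[OF \<rho>(1)] by (subst emeasure_distr) auto
    qed
    have "\<tau>1 = \<tau>2"
    proof (rule measure_eqI_lessThan)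
      fix r :: real
      show "emeasure \<tau>1 {r<..} = emeasure \<tau>2 {r<..}"
        using level[OF D, of r] by (simp add: \<tau>1 \<tau>2 H_def vimage_def)
      show "emeasure \<tau>1 {r<..} < \<infinity>"
        using level[OF D, of r] by (simp add: \<tau>1)
    qed (auto simp: \<tau>1_def \<tau>2_def)
    then have eq: "emeasure \<tau>1 (\<psi> -` E) = emeasure \<tau>2 (\<psi> -` E)" by simp
    have \<psi>E[measurable]: "\<psi> -` E \<in> sets borel" "\<phi> -` \<psi> -` E \<in> sets borel"
      using measurable_sets_borel[OF \<psi> E] measurable_sets_borel[OF \<phi>] by auto
    \<comment> \<open>Decoding after coding is the identity only on \<open>S0\<close>. The
      complement of \<open>S0\<close> carries no mass of \<open>\<beta> D\<close>, so replacing
      \<open>E\<close> by its preimage under coding followed by decoding costs nothing.\<close>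
    have split: "\<beta> D G = \<beta> D (G \<inter> S0)" if [measurable]: "G \<in> sets borel" for G
    proof -
      have "\<beta> D ((G \<inter> S0) \<union> (G - S0)) = \<beta> D (G \<inter> S0) + \<beta> D (G - S0)"
        by (intro add2) auto
      moreover have "\<beta> D (G - S0) \<le> \<beta> D (- S0)" by (intro mono2) auto
      moreover have "\<beta> D (- S0) \<le> 0" using marg2[OF D, of "- S0"] null by simp
      moreover have "0 \<le> \<beta> D (G - S0)" by (intro nn) auto
      moreover have "(G \<inter> S0) \<union> (G - S0) = G" by auto
      ultimately show ?thesis by simp
    qed
    have "\<phi> -` \<psi> -` E \<inter> S0 = E \<inter> S0" using inv by auto
    then have "\<beta> D (\<phi> -` \<psi> -` E) = \<beta> D E" using split[of "\<phi> -` \<psi> -` E"] split[of E] by simp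
    moreover have "space (Q \<Otimes>\<^sub>M \<Lambda>) = space (Q \<Otimes>\<^sub>M (borel :: real measure))"
      by (simp add: space_pair_measure)
    ultimately show "emeasure (Q \<Otimes>\<^sub>M uniform_measure lborel {0..1})
        {z \<in> space (Q \<Otimes>\<^sub>M borel). fst z \<in> D \<and> \<psi> (Z z) \<in> E} = \<beta> D E"
      using eq by (simp add: \<tau>1 \<tau>2 \<Lambda>_def)
  qed
qed

section \<open>Coding a Radon space by real numbers\<close>

text \<open>Complete regularity does not include a separation axiom. A two-point set is compact, so
  metrizability of its subspace topology yields T1, and a regular T1 space is Hausdorff.\<close>

lemma Hausdorff_if_compacts_metrizable:
  assumes "completely_regular_space (euclidean :: 's::topological_space topology)"
    and metr: "\<And>K :: 's set. compact K \<Longrightarrow> metrizable_space (top_of_set K)"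
  shows "Hausdorff_space (euclidean :: 's topology)"
proof -
  have "\<exists>U. openin euclidean U \<and> x \<in> U \<and> y \<notin> U" if "x \<noteq> y" for x y :: 's
  proof -
    have "Hausdorff_space (top_of_set {x, y})"
      by (intro metrizable_imp_Hausdorff_space metr) auto
    then have "\<exists>V W. openin (top_of_set {x, y}) V \<and> openin (top_of_set {x, y}) W \<and> x \<in> V \<and> y \<in> W \<and> disjnt V W"
      using that unfolding Hausdorff_space_def by simp
    then obtain V where V: "openin (top_of_set {x, y}) V" "x \<in> V" "y \<notin> V"
      by (auto simp: disjnt_iff)
    then obtain U where "open U" "V = {x, y} \<inter> U"
      by (auto simp: openin_open)
    then show ?thesis using V by auto
  qed
  then have "t1_space (euclidean :: 's topology)"
    unfolding t1_space_def by auto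
  then show ?thesis
    using assms(1) by (intro regular_t1_imp_Hausdorff_space completely_regular_imp_regular_space)
qed

lemma compact_imp_closed_Hausdorff:
  assumes "Hausdorff_space (euclidean :: 's::topological_space topology)" "compact (K :: 's set)"
  shows "closed K"
  using compactin_imp_closedin[OF assms(1), of K] assms(2) by simp

text \<open>Compactness turns the balls of radius \<open>1 / Suc n\<close> into finite covers, which
  together form a countable family. Two points further apart than \<open>2 / Suc n\<close> lie in no
  common ball of that radius.\<close>

lemma metrizable_compact_separating_family:
  fixes K :: "'s::topological_space set"
  assumes K: "compact K" and metr: "metrizable_space (top_of_set K)"
  obtains G :: "nat \<Rightarrow> 's set" where
    "\<And>n. \<exists>U. open U \<and> G n = K \<inter> U"
    "\<And>x y. x \<in> K \<Longrightarrow> y \<in> K \<Longrightarrow> x \<noteq> y \<Longrightarrow> \<exists>n. x \<in> G n \<and> y \<notin> G n"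
proof -
  obtain M d where md: "Metric_space M d" and top: "top_of_set K = Metric_space.mtopology M d"
    using metr unfolding metrizable_space_def by blast
  interpret Metric_space M d by (fact md)
  have MK: "M = K"
    using arg_cong[OF top, of topspace] by simp
  have comp: "compactin mtopology K"
    using compact_space_subtopology[of euclidean K] K unfolding top[symmetric] compact_space_def by simp
  have "\<exists>\<F>. finite \<F> \<and> \<F> \<subseteq> (\<lambda>a. mball a (1 / Suc n)) ` K \<and> K \<subseteq> \<Union>\<F>" for n
  proof (rule compactinD[OF comp])
    show "K \<subseteq> \<Union> ((\<lambda>a. mball a (1 / Suc n)) ` K)"
    proof
      fix x assume "x \<in> K"
      then have "x \<in> mball x (1 / Suc n)" using MK by (intro centre_in_mball_iff[THEN iffD2]) auto
      then show "x \<in> \<Union> ((\<lambda>a. mball a (1 / Suc n)) ` K)" using \<open>x \<in> K\<close> by blast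
    qed
  qed auto
  then obtain \<F> where \<F>: "\<And>n. finite (\<F> n)" "\<And>n. \<F> n \<subseteq> (\<lambda>a. mball a (1 / Suc n)) ` K"
    "\<And>n. K \<subseteq> \<Union>(\<F> n)" by metis
  \<comment> \<open>The empty set keeps the family nonempty when \<open>K\<close> is empty, as
    \<open>from_nat_into\<close> requires.\<close>
  define \<G> where "\<G> = insert {} (\<Union>n. \<F> n)"
  have cnt: "countable \<G>"
    unfolding \<G>_def using \<F>(1) by (auto intro: countable_finite)
  have "\<G> \<noteq> {}" by (simp add: \<G>_def)
  show thesis
  proof (rule that[of "from_nat_into \<G>"])
    fix n
    have "from_nat_into \<G> n \<in> \<G>"
      using \<open>\<G> \<noteq> {}\<close> by (rule from_nat_into)
    then have "openin mtopology (from_nat_into \<G> n)"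
      using \<F>(2) by (auto simp: \<G>_def) (metis (no_types, lifting) imageE openin_mball subsetD)
    then show "\<exists>U. open U \<and> from_nat_into \<G> n = K \<inter> U"
      by (simp add: top[symmetric] openin_open)
  next
    fix x y assume xy: "x \<in> K" "y \<in> K" "x \<noteq> y"
    then have "0 < d x y" by (simp add: MK)
    then obtain n where n: "inverse (real (Suc n)) < d x y / 2"
      using reals_Archimedean[of "d x y / 2"] by auto
    obtain V where V: "V \<in> \<F> n" "x \<in> V" using \<F>(3) xy by blast
    then obtain a where a: "a \<in> K" "V = mball a (1 / Suc n)" using \<F>(2) by blast
    have "y \<notin> V"
    proof
      assume "y \<in> V"
      then have "a \<in> M" "x \<in> M" "y \<in> M" and lt: "d a x < 1 / Suc n" "d a y < 1 / Suc n"
        using V a in_mball by blast+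
      then have "d x y \<le> d a x + d a y"
        using triangle[of x a y] by (simp add: commute)
      with lt show False using n by (simp add: inverse_eq_divide)
    qed
    moreover have "V \<in> \<G>" using V by (auto simp: \<G>_def)
    then obtain i where "from_nat_into \<G> i = V"
      using from_nat_into_surj[OF cnt] by blast
    ultimately show "\<exists>n. x \<in> from_nat_into \<G> n \<and> y \<notin> from_nat_into \<G> n"
      using V by blast
  qed
qed

lemma summable_ternary:
  fixes b :: "nat \<Rightarrow> bool"
  shows "summable (\<lambda>n. of_bool (b n) * (1/3) ^ n :: real)"
  by (rule summable_comparison_test'[OF summable_geometric[of "1/3::real"], of 0]) auto

text \<open>With digits 0 and 1 in base 3, everything after position \<open>n\<close> adds at most
  half of \<open>(1/3) ^ n\<close>, so the first difference decides the order. In base 2 the tail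
  could match it and the code would not be injective.\<close>

lemma ternary_tail_less:
  fixes a b :: "nat \<Rightarrow> bool"
  assumes eq: "\<And>m. m < n \<Longrightarrow> a m = b m" and "a n" "\<not> b n"
  shows "(\<Sum>m. of_bool (b m) * (1/3) ^ m) < (\<Sum>m. of_bool (a m) * (1/3) ^ m :: real)"
proof -
  define S where "S = (\<Sum>m<n. of_bool (a m) * (1/3) ^ m :: real)"
  have S: "(\<Sum>m<n. of_bool (b m) * (1/3) ^ m :: real) = S"
    unfolding S_def by (rule sum.cong) (auto simp: eq)
  have "(\<Sum>m. of_bool (b m) * (1/3) ^ m :: real) =
      (\<Sum>m. of_bool (b (m + Suc n)) * (1/3) ^ (m + Suc n)) + S"
    using suminf_split_initial_segment[OF summable_ternary[of b], of "Suc n"] S \<open>\<not> b n\<close>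
    by simp
  also have "(\<Sum>m. of_bool (b (m + Suc n)) * (1/3) ^ (m + Suc n) :: real) \<le> (\<Sum>m. (1/3) ^ Suc n * (1/3) ^ m)"
  proof (rule suminf_le)
    show "summable (\<lambda>m. of_bool (b (m + Suc n)) * (1/3) ^ (m + Suc n) :: real)"
      using summable_ignore_initial_segment[OF summable_ternary[of b], of "Suc n"] by simp
    show "summable (\<lambda>m. (1/3) ^ Suc n * (1/3) ^ m :: real)"
      by (intro summable_mult summable_geometric) auto
  qed (auto simp: power_add)
  also have "\<dots> = (1/3) ^ Suc n * (3 / 2 :: real)"
    by (subst suminf_mult) (auto simp: suminf_geometric)
  also have "\<dots> + S < (1/3) ^ n + S" by simp
  also have "\<dots> = (\<Sum>m<Suc n. of_bool (a m) * (1/3) ^ m :: real)"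
    using \<open>a n\<close> by (simp add: S_def)
  also have "\<dots> \<le> (\<Sum>m. of_bool (a m) * (1/3) ^ m)"
    by (intro sum_le_suminf summable_ternary) auto
  finally show ?thesis by simp
qed

lemma inj_ternary: "inj (\<lambda>b :: nat \<Rightarrow> bool. \<Sum>m. of_bool (b m) * (1/3) ^ m :: real)"
proof (rule injI, rule ccontr)
  fix a b :: "nat \<Rightarrow> bool"
  assume eq: "(\<Sum>m. of_bool (a m) * (1/3) ^ m :: real) = (\<Sum>m. of_bool (b m) * (1/3) ^ m)" and "a \<noteq> b"
  define n where "n = (LEAST n. a n \<noteq> b n)"
  have "\<exists>n. a n \<noteq> b n" using \<open>a \<noteq> b\<close> by auto
  then have "a n \<noteq> b n" unfolding n_def by (rule LeastI_ex)
  moreover have "a m = b m" if "m < n" for m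
    using not_less_Least[of m "\<lambda>n. a n \<noteq> b n"] that by (auto simp: n_def)
  ultimately show False
    using ternary_tail_less[of n a b] ternary_tail_less[of n b a] eq by fastforce
qed

text \<open>The value \<open>3/2\<close> of the full geometric series is the origin of the bound 2
  on codes, which later keeps the levels in \<open>{0..2}\<close> and the grids finite.\<close>

lemma ternary_bounds:
  fixes b :: "nat \<Rightarrow> bool"
  shows "0 \<le> (\<Sum>m. of_bool (b m) * (1/3) ^ m :: real)" "(\<Sum>m. of_bool (b m) * (1/3) ^ m :: real) \<le> 3/2"
proof -
  show "0 \<le> (\<Sum>m. of_bool (b m) * (1/3) ^ m :: real)"
    by (rule suminf_nonneg[OF summable_ternary]) auto
  have "(\<Sum>m. of_bool (b m) * (1/3) ^ m :: real) \<le> (\<Sum>m. (1/3) ^ m)"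
    by (intro suminf_le summable_ternary summable_geometric) auto
  then show "(\<Sum>m. of_bool (b m) * (1/3) ^ m :: real) \<le> 3/2"
    by (simp add: suminf_geometric)
qed

lemma radon_inner_approx:
  fixes \<mu> :: "'s::topological_space measure"
  assumes "radon_space TYPE('s)" "finite_measure \<mu>" and [measurable_cong]: "sets \<mu> = sets borel"
    and H: "Hausdorff_space (euclidean :: 's topology)"
    and [measurable]: "B \<in> sets borel" and "0 < e"
  obtains K where "compact K" "K \<subseteq> B" "measure \<mu> (B - K) < e"
proof -
  interpret finite_measure \<mu> by fact
  have SUP: "emeasure \<mu> B = (SUP K\<in>{K. K \<subseteq> B \<and> compact K}. emeasure \<mu> K)"
    using assms unfolding radon_space_def by blast
  show thesis
  proof (cases "measure \<mu> B < e")
    case True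
    then show thesis by (intro that[of "{}"]) auto
  next
    case False
    \<comment> \<open>Here \<open>measure \<mu> B - e\<close> is nonnegative, so
      \<open>ennreal\<close> does not truncate it; the other case is served by the empty compact
      set.\<close>
    then have "ennreal (measure \<mu> B - e) < emeasure \<mu> B"
      using \<open>0 < e\<close> by (simp add: emeasure_eq_measure ennreal_less_iff)
    then obtain K where K: "K \<subseteq> B" "compact K" "ennreal (measure \<mu> B - e) < emeasure \<mu> K"
      unfolding SUP less_SUP_iff by blast
    have [measurable]: "K \<in> sets borel"
      using compact_imp_closed_Hausdorff[OF H K(2)] by simp
    have "measure \<mu> B - e < measure \<mu> K"
      using K(3) False by (simp add: emeasure_eq_measure ennreal_less_iff)
    moreover have "measure \<mu> (B - K) = measure \<mu> B - measure \<mu> K"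
      using K by (intro finite_measure_Diff) auto
    ultimately show thesis using K by (intro that[of K]) auto
  qed
qed

text \<open>The union of two compact subsets of \<open>B\<close> serves both measures at once, so
  that one code works for the laws of \<open>X\<close> and of \<open>Y\<close>.\<close>

lemma radon_inner_approx2:
  fixes \<mu> \<nu> :: "'s::topological_space measure"
  assumes rad: "radon_space TYPE('s)" and H: "Hausdorff_space (euclidean :: 's topology)"
    and \<mu>: "finite_measure \<mu>" "sets \<mu> = sets borel"
    and \<nu>: "finite_measure \<nu>" "sets \<nu> = sets borel"
    and [measurable]: "B \<in> sets borel" and "0 < e"
  shows "\<exists>K. compact K \<and> K \<subseteq> B \<and> measure \<mu> (B - K) < e \<and> measure \<nu> (B - K) < e"
proof -
  obtain K where K: "compact K" "K \<subseteq> B" "measure \<mu> (B - K) < e"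
    using radon_inner_approx[OF rad \<mu> H assms(7,8)] .
  obtain K' where K': "compact K'" "K' \<subseteq> B" "measure \<nu> (B - K') < e"
    using radon_inner_approx[OF rad \<nu> H assms(7,8)] .
  have [measurable]: "K \<in> sets borel" "K' \<in> sets borel"
    using compact_imp_closed_Hausdorff[OF H] K K' by auto
  have "measure \<mu> (B - (K \<union> K')) \<le> measure \<mu> (B - K)"
    by (intro finite_measure.finite_measure_mono[OF \<mu>(1)]) (auto simp: \<mu>)
  moreover have "measure \<nu> (B - (K \<union> K')) \<le> measure \<nu> (B - K')"
    by (intro finite_measure.finite_measure_mono[OF \<nu>(1)]) (auto simp: \<nu>)
  ultimately show ?thesis using K K' by (intro exI[of _ "K \<union> K'"]) auto
qed

text \<open>Lusin's theorem applied to a countable family of Borel sets that separates points: on each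
  \<open>C n\<close> all indicator functions of the family are continuous, and so is the code \<open>\<phi>\<close> built from them.\<close>
lemma radon_coding:
  fixes \<mu> \<nu> :: "'s::topological_space measure" and x0 :: 's
  assumes rad: "radon_space TYPE('s)" and H: "Hausdorff_space (euclidean :: 's topology)"
    and metr: "\<And>K :: 's set. compact K \<Longrightarrow> metrizable_space (top_of_set K)"
    and \<mu>: "finite_measure \<mu>" "sets \<mu> = sets borel"
    and \<nu>: "finite_measure \<nu>" "sets \<nu> = sets borel"
  obtains C :: "nat \<Rightarrow> 's set" and \<phi> :: "'s \<Rightarrow> real" where
    "\<And>n. compact (C n)" "incseq C" "x0 \<in> (\<Union>n. C n)"
    "measure \<mu> (- (\<Union>n. C n)) = 0" "measure \<nu> (- (\<Union>n. C n)) = 0"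
    "\<phi> \<in> borel_measurable borel" "\<And>n. continuous_on (C n) \<phi>" "inj_on \<phi> (\<Union>n. C n)"
    "\<And>x. 0 \<le> \<phi> x" "\<And>x. \<phi> x < 2"
proof -
  note closed = compact_imp_closed_Hausdorff[OF H]
  interpret \<mu>: finite_measure \<mu> by fact
  interpret \<nu>: finite_measure \<nu> by fact
  note \<mu>(2)[measurable_cong] \<nu>(2)[measurable_cong]
  have "\<exists>K. compact K \<and> K \<subseteq> UNIV \<and> measure \<mu> (UNIV - K) < 1 / Suc n \<and> measure \<nu> (UNIV - K) < 1 / Suc n" for n
    by (rule radon_inner_approx2[OF rad H \<mu> \<nu>]) auto
  then obtain K0 :: "nat \<Rightarrow> 's set" where K0: "\<And>n. compact (K0 n)"
    "\<And>n. measure \<mu> (- K0 n) < 1 / Suc n" "\<And>n. measure \<nu> (- K0 n) < 1 / Suc n"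
    unfolding Compl_eq_Diff_UNIV by metis
  \<comment> \<open>The point \<open>x0\<close> is made part of the coded set, where it will serve
    as reference point and default value.\<close>
  define K where "K n = (case n of 0 \<Rightarrow> {x0} | Suc m \<Rightarrow> K0 m)" for n
  have K: "compact (K n)" for n
    by (auto simp: K_def K0 split: nat.split)
  have "\<exists>G :: nat \<Rightarrow> 's set. (\<forall>m. \<exists>U. open U \<and> G m = K n \<inter> U) \<and>
      (\<forall>x\<in>K n. \<forall>y\<in>K n. x \<noteq> y \<longrightarrow> (\<exists>m. x \<in> G m \<and> y \<notin> G m))" for n
    by (rule metrizable_compact_separating_family[OF K metr[OF K], of n]) blast
  then obtain G :: "nat \<Rightarrow> nat \<Rightarrow> 's set" where G: "\<And>n m. \<exists>U. open U \<and> G n m = K n \<inter> U"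
    "\<And>n x y. x \<in> K n \<Longrightarrow> y \<in> K n \<Longrightarrow> x \<noteq> y \<Longrightarrow> \<exists>m. x \<in> G n m \<and> y \<notin> G n m"
    by metis
  \<comment> \<open>\<open>K n\<close> belongs to the family as well: it separates its points from
    those outside, while the \<open>G n m\<close> separate points within \<open>K n\<close>.\<close>
  define B where "B p = (case prod_decode p of (n, 0) \<Rightarrow> K n | (n, Suc m) \<Rightarrow> G n m)" for p
  have K_borel: "K n \<in> sets borel" for n
    using closed[OF K] by simp
  have "G n m \<in> sets borel" for n m
    using G(1)[of n m] K_borel[of n] by auto
  then have B[measurable]: "B p \<in> sets borel" for p
    using K_borel by (auto simp: B_def split: prod.split nat.split)
  have sep: "\<exists>p. (x \<in> B p) \<noteq> (y \<in> B p)" if xy: "x \<in> (\<Union>n. K n)" "y \<in> (\<Union>n. K n)" "x \<noteq> y" for x y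
  proof -
    obtain n where n: "x \<in> K n" using xy by blast
    show ?thesis
    proof (cases "y \<in> K n")
      case True
      then obtain m where "x \<in> G n m" "y \<notin> G n m" using G(2) n xy by blast
      then show ?thesis by (intro exI[of _ "prod_encode (n, Suc m)"]) (simp add: B_def)
    next
      case False
      with n show ?thesis by (intro exI[of _ "prod_encode (n, 0)"]) (simp add: B_def)
    qed
  qed
  define \<phi> where "\<phi> x = (\<Sum>p. of_bool (x \<in> B p) * (1/3) ^ p :: real)" for x
  have inj: "inj_on \<phi> (\<Union>n. K n)"
  proof (rule inj_onI, rule ccontr)
    fix x y assume "x \<in> (\<Union>n. K n)" "y \<in> (\<Union>n. K n)" "\<phi> x = \<phi> y" "x \<noteq> y"
    then show False
      using sep[of x y] injD[OF inj_ternary, of "\<lambda>p. x \<in> B p" "\<lambda>p. y \<in> B p"]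
      by (auto simp: \<phi>_def fun_eq_iff)
  qed
  have \<phi>_meas: "\<phi> \<in> borel_measurable borel"
    unfolding \<phi>_def by measurable

  \<comment> \<open>The factor \<open>(1/2) ^ p\<close> makes the losses summable over the family,
    and \<open>1 / Suc k\<close> makes their total tend to 0.\<close>
  have "\<forall>E\<in>sets borel. \<forall>k p. \<exists>H. compact H \<and> H \<subseteq> E \<and>
      measure \<mu> (E - H) < (1/2) ^ p / Suc k \<and> measure \<nu> (E - H) < (1/2) ^ p / Suc k"
    by (intro ballI allI radon_inner_approx2[OF rad H \<mu> \<nu>]) auto
  then obtain A where A: "\<forall>E\<in>sets borel. \<forall>k p. compact (A E k p) \<and> A E k p \<subseteq> E \<and>
      measure \<mu> (E - A E k p) < (1/2) ^ p / Suc k \<and> measure \<nu> (E - A E k p) < (1/2) ^ p / Suc k"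
    unfolding bchoice_iff choice_iff by blast
  define H1 H2 where "H1 k p = A (B p) k p" and "H2 k p = A (- B p) k p" for k p
  have H1: "compact (H1 k p)" "H1 k p \<subseteq> B p"
    "measure \<mu> (B p - H1 k p) < (1/2) ^ p / Suc k" "measure \<nu> (B p - H1 k p) < (1/2) ^ p / Suc k" for k p
    using A B by (auto simp: H1_def)
  have H2: "compact (H2 k p)" "H2 k p \<subseteq> - B p"
    "measure \<mu> (- B p - H2 k p) < (1/2) ^ p / Suc k" "measure \<nu> (- B p - H2 k p) < (1/2) ^ p / Suc k" for k p
    using A borel_comp[OF B] unfolding H2_def by blast+
  have closed_H: "closed (H1 k p)" "closed (H2 k p)" for k p
    using closed H1(1) H2(1) by auto
  have [measurable]: "H1 k p \<in> sets borel" "H2 k p \<in> sets borel" for k p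
    using closed_H by auto
  have [measurable]: "K0 k \<in> sets borel" for k
    using closed[OF K0(1)] by simp
  \<comment> \<open>On \<open>C' k\<close> each \<open>B p\<close> is relatively open and closed,
    being cut out by the disjoint closed sets \<open>H1 k p\<close> and
    \<open>H2 k p\<close>.\<close>
  define C' where "C' k = K0 k \<inter> (\<Inter>p. H1 k p \<union> H2 k p)" for k
  have C'_compact: "compact (C' k)" for k
    unfolding C'_def using closed_H by (intro compact_Int_closed K0 closed_INT) auto
  \<comment> \<open>The 5 is 1 from \<open>K0 k\<close> plus 4 from the series of
    \<open>2 * (1/2) ^ p\<close>, the factor 2 accounting for \<open>B p\<close> and its
    complement.\<close>
  have small: "measure m (- C' k) \<le> 5 / Suc k"
    if m: "finite_measure m" "sets m = sets borel" and
      a: "\<And>n. measure m (- K0 n) < 1 / Suc n" and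
      b: "\<And>k p. measure m (B p - H1 k p) < (1/2) ^ p / Suc k" and
      c: "\<And>k p. measure m (- B p - H2 k p) < (1/2) ^ p / Suc k" for m k
  proof -
    interpret m: finite_measure m by fact
    note m(2)[measurable_cong]
    have sp[simp]: "space m = UNIV" using sets_eq_imp_space_eq[OF m(2)] by simp
    define E where "E p = (B p - H1 k p) \<union> (- B p - H2 k p)" for p
    have [measurable]: "E p \<in> sets m" for p
      unfolding E_def by measurable
    have E: "measure m (E p) \<le> 2 / Suc k * (1/2) ^ p" for p
    proof -
      have "measure m (E p) \<le> measure m (B p - H1 k p) + measure m (- B p - H2 k p)"
        unfolding E_def by (intro measure_Un_le) measurable
      also have "\<dots> \<le> (1/2) ^ p / Suc k + (1/2) ^ p / Suc k"
        using b[of p k] c[of p k] by simp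
      finally show ?thesis by (simp add: field_simps)
    qed
    have summ: "summable (\<lambda>p. 2 / Suc k * (1/2) ^ p :: real)"
      by (intro summable_mult summable_geometric) auto
    have summE: "summable (\<lambda>p. measure m (E p))"
      by (rule summable_comparison_test'[OF summ, of 0]) (use E in auto)
    have "measure m (- C' k) \<le> measure m (- K0 k \<union> (\<Union>p. E p))"
      by (intro m.finite_measure_mono) (auto simp: C'_def E_def)
    also have "\<dots> \<le> measure m (- K0 k) + measure m (\<Union>p. E p)"
      by (intro measure_Un_le) auto
    also have "measure m (\<Union>p. E p) \<le> (\<Sum>p. measure m (E p))"
      using summE by (intro m.finite_measure_subadditive_countably) auto
    also have "\<dots> \<le> (\<Sum>p. 2 / Suc k * (1/2) ^ p)"
      by (intro suminf_le E summE summ)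
    also have "\<dots> = 4 / Suc k"
      by (subst suminf_mult) (auto simp: suminf_geometric)
    finally show ?thesis
      using a[of k] by (simp add: field_simps)
  qed
  have small: "measure \<mu> (- C' k) \<le> 5 / Suc k" "measure \<nu> (- C' k) \<le> 5 / Suc k" for k
    using small[OF \<mu> K0(2) H1(3) H2(3)] small[OF \<nu> K0(3) H1(4) H2(4)] by auto
  have cont': "continuous_on (C' k) \<phi>" for k
  proof -
    have "continuous_on (C' k) (\<lambda>x. of_bool (x \<in> B p) :: real)" for p
    proof (rule continuous_on_subset)
      show "continuous_on (H1 k p \<union> H2 k p) (\<lambda>x. of_bool (x \<in> B p) :: real)"
      proof (intro continuous_on_closed_Un closed_H)
        show "continuous_on (H1 k p) (\<lambda>x. of_bool (x \<in> B p) :: real)"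
          using H1(2)[of k p] by (intro continuous_on_eq[OF continuous_on_const[of _ 1]]) auto
        show "continuous_on (H2 k p) (\<lambda>x. of_bool (x \<in> B p) :: real)"
          using H2(2)[of k p] by (intro continuous_on_eq[OF continuous_on_const[of _ 0]]) auto
      qed
      show "C' k \<subseteq> H1 k p \<union> H2 k p" by (auto simp: C'_def)
    qed
    then have c: "continuous_on (C' k) (\<lambda>x. \<Sum>p<n. of_bool (x \<in> B p) * (1/3) ^ p :: real)" for n
      by (intro continuous_intros)
    have "uniform_limit (C' k) (\<lambda>n x. \<Sum>p<n. of_bool (x \<in> B p) * (1/3) ^ p :: real) \<phi> sequentially"
      unfolding \<phi>_def
      by (rule Weierstrass_m_test[where M = "\<lambda>p. (1/3) ^ p"]) (auto intro!: summable_geometric)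
    then show ?thesis
      by (rule uniform_limit_theorem[rotated]) (use c in auto)
  qed
  \<comment> \<open>The \<open>C' k\<close> need not be nested. Finite unions restore monotonicity,
    and since finitely many closed sets are joined, \<open>\<phi>\<close> stays continuous.\<close>
  define C where "C n = insert x0 (\<Union>k<n. C' k)" for n
  have C_compact: "compact (C n)" for n
    unfolding C_def by (intro compact_insert compact_UN C'_compact) auto
  have UC: "(\<Union>n. C n) = insert x0 (\<Union>k. C' k)"
    by (auto simp: C_def)
  have null: "measure m (- (\<Union>n. C n)) = 0"
    if m: "finite_measure m" "sets m = sets borel" and s: "\<And>k. measure m (- C' k) \<le> 5 / Suc k" for m
  proof -
    have [measurable]: "C n \<in> sets borel" "C' n \<in> sets borel" for n
      using closed C_compact C'_compact by auto
    have "measure m (- (\<Union>n. C n)) \<le> 5 / Suc k" for k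
    proof -
      have "measure m (- (\<Union>n. C n)) \<le> measure m (- C' k)"
        by (rule finite_measure.finite_measure_mono[OF m(1)]) (auto simp: m(2) UC)
      then show ?thesis using s[of k] by linarith
    qed
    moreover have "(\<lambda>k. 5 / Suc k) \<longlonglongrightarrow> (0::real)"
      by real_asymp
    ultimately have "measure m (- (\<Union>n. C n)) \<le> 0"
      by (metis LIMSEQ_le_const)
    then show ?thesis by (simp add: measure_le_0_iff)
  qed
  show thesis
  proof (rule that)
    show "compact (C n)" for n by fact
    show "incseq C" unfolding C_def incseq_def by auto
    show "x0 \<in> (\<Union>n. C n)" by (auto simp: UC)
    show "measure \<mu> (- (\<Union>n. C n)) = 0" by (rule null[OF \<mu> small(1)])
    show "measure \<nu> (- (\<Union>n. C n)) = 0" by (rule null[OF \<nu> small(2)])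
    show "continuous_on (C n) \<phi>" for n
    proof -
      have "closed (\<Union>k<n. C' k)"
        using closed C'_compact by (intro closed_UN) auto
      moreover have "continuous_on (\<Union>k<n. C' k) \<phi>"
        using closed C'_compact cont' by (intro continuous_on_closed_Union) auto
      ultimately have "continuous_on ({x0} \<union> (\<Union>k<n. C' k)) \<phi>"
        using closed[of "{x0}"] by (intro continuous_on_closed_Un) auto
      then show ?thesis by (simp add: C_def)
    qed
    have "(\<Union>n. C n) \<subseteq> (\<Union>n. K n)"
    proof
      fix x assume "x \<in> (\<Union>n. C n)"
      then consider "x = x0" | k where "x \<in> K0 k" unfolding UC C'_def by blast
      then show "x \<in> (\<Union>n. K n)"
      proof cases
        case 1
        then have "x \<in> K 0" by (simp add: K_def)
        then show ?thesis by blast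
      next
        case 2
        then have "x \<in> K (Suc k)" by (simp add: K_def)
        then show ?thesis by blast
      qed
    qed
    then show "inj_on \<phi> (\<Union>n. C n)" by (rule inj_on_subset[OF inj])
    show "0 \<le> \<phi> x" for x unfolding \<phi>_def by (rule ternary_bounds)
    show "\<phi> x < 2" for x
      using ternary_bounds(2)[of "\<lambda>p. x \<in> B p"] unfolding \<phi>_def by simp
  qed fact
qed

text \<open>\<open>\<phi>\<close> sends closed subsets of the compact \<open>C n\<close> to compact
  sets of reals. Hence the preimage of a closed set under the inverse is a countable union of
  compacts, possibly together with the complement of the image of the whole union, and measurability
  follows without continuity of \<open>\<psi>\<close>.\<close>

lemma coding_inverse:
  fixes C :: "nat \<Rightarrow> 's::topological_space set" and \<phi> :: "'s \<Rightarrow> real"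
  assumes H: "Hausdorff_space (euclidean :: 's topology)"
    and C: "\<And>n. compact (C n)" and x0: "x0 \<in> (\<Union>n. C n)"
    and cont: "\<And>n. continuous_on (C n) \<phi>" and inj: "inj_on \<phi> (\<Union>n. C n)"
  obtains \<psi> :: "real \<Rightarrow> 's" where "\<psi> \<in> borel \<rightarrow>\<^sub>M borel" "range \<psi> \<subseteq> (\<Union>n. C n)"
    "\<And>x. x \<in> (\<Union>n. C n) \<Longrightarrow> \<psi> (\<phi> x) = x"
proof
  let ?S = "\<Union>n. C n"
  define \<psi> where "\<psi> z = (if z \<in> \<phi> ` ?S then inv_into ?S \<phi> z else x0)" for z
  show inv: "\<psi> (\<phi> x) = x" if "x \<in> ?S" for x
    using that inv_into_f_f[OF inj that] by (auto simp: \<psi>_def)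
  show "range \<psi> \<subseteq> ?S"
    using x0 inv_into_into[of _ \<phi> ?S] by (auto simp: \<psi>_def)
  have img: "closed (\<phi> ` (C n \<inter> F))" if "closed F" for n F
    using that C by (intro compact_imp_closed compact_continuous_image[OF continuous_on_subset[OF cont]]
        compact_Int_closed) auto
  show "\<psi> \<in> borel \<rightarrow>\<^sub>M borel"
    unfolding borel_eq_closed
  proof (rule measurable_measure_of)
    fix F :: "'s set" assume "F \<in> Collect closed"
    then have F: "closed F" by simp
    have "\<psi> -` F = (\<Union>n. \<phi> ` (C n \<inter> F)) \<union> (if x0 \<in> F then - (\<Union>n. \<phi> ` (C n \<inter> UNIV)) else {})"
    proof (intro equalityI subsetI)
      fix z assume z: "z \<in> \<psi> -` F"
      show "z \<in> (\<Union>n. \<phi> ` (C n \<inter> F)) \<union> (if x0 \<in> F then - (\<Union>n. \<phi> ` (C n \<inter> UNIV)) else {})"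
      proof (cases "z \<in> \<phi> ` ?S")
        case True
        then obtain x where "x \<in> ?S" "z = \<phi> x" by blast
        then show ?thesis using z inv by auto
      next
        case False
        then show ?thesis using z by (auto simp: \<psi>_def)
      qed
    next
      fix z assume z: "z \<in> (\<Union>n. \<phi> ` (C n \<inter> F)) \<union> (if x0 \<in> F then - (\<Union>n. \<phi> ` (C n \<inter> UNIV)) else {})"
      show "z \<in> \<psi> -` F"
      proof (cases "z \<in> (\<Union>n. \<phi> ` (C n \<inter> F))")
        case True
        then obtain x n where "x \<in> C n" "x \<in> F" "z = \<phi> x" by blast
        moreover have "\<psi> (\<phi> x) = x" using \<open>x \<in> C n\<close> by (intro inv) blast
        ultimately show ?thesis by simp
      next
        case False
        then have "x0 \<in> F" "z \<notin> \<phi> ` ?S" using z by (auto split: if_splits)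
        then show ?thesis by (auto simp: \<psi>_def)
      qed
    qed
    also have "\<dots> \<in> sets borel"
    proof -
      have "(\<Union>n. \<phi> ` (C n \<inter> F)) \<in> sets borel" if "closed F" for F
        using img[OF that] by (intro sets.countable_UN) auto
      from this[OF F] this[of UNIV] show ?thesis
        by (intro sets.Un) (auto intro!: borel_comp simp del: Compl_UN)
    qed
    finally show "\<psi> -` F \<inter> space (sigma UNIV (Collect closed)) \<in> sets (sigma UNIV (Collect closed))"
      by (simp add: borel_eq_closed)
  qed auto
qed

text \<open>This is separability in the uniform norm on each \<open>C n\<close>. The code makes
  \<open>C n\<close> a compact subset of the line, where \<open>f\<close> is uniformly continuous
  and close to a step function of the code with rational values. There are countably many such step
  functions, and for each one a nearby member of \<open>F\<close> is kept, so that the approximants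
  stay in \<open>F\<close>.\<close>

lemma continuous_family_separable:
  fixes C :: "nat \<Rightarrow> 's::topological_space set" and \<phi> :: "'s \<Rightarrow> real" and F :: "('s \<Rightarrow> real) set"
  assumes C: "\<And>n. compact (C n)" and cont: "\<And>n. continuous_on (C n) \<phi>"
    and inj: "\<And>n. inj_on \<phi> (C n)" and \<phi>: "\<And>x. 0 \<le> \<phi> x" "\<And>x. \<phi> x < 2"
    and F: "F \<noteq> {}" "\<And>f. f \<in> F \<Longrightarrow> continuous_on UNIV f"
  obtains g :: "nat \<Rightarrow> 's \<Rightarrow> real" where "range g \<subseteq> F"
    "\<And>f n e. f \<in> F \<Longrightarrow> 0 < e \<Longrightarrow> \<exists>i. \<forall>x\<in>C n. \<bar>g i x - f x\<bar> < e"
proof -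
  \<comment> \<open>A template \<open>(n, m, l, rs)\<close> prescribes on \<open>C n\<close> the
    values \<open>rs\<close> on code intervals of length \<open>1 / m\<close>, with tolerance
    \<open>1 / Suc l\<close>.\<close>
  define P :: "nat \<times> nat \<times> nat \<times> rat list \<Rightarrow> ('s \<Rightarrow> real) \<Rightarrow> bool" where
    "P = (\<lambda>(n, m, l, rs) f. \<forall>x\<in>C n. \<bar>f x - of_rat (rs ! nat \<lfloor>real m * \<phi> x\<rfloor>)\<bar> < 1 / Suc l)"
  define pick where "pick t = (if \<exists>f\<in>F. P t f then SOME f. f \<in> F \<and> P t f else SOME f. f \<in> F)" for t
  have pick_F: "pick t \<in> F" for t
  proof (cases "\<exists>f\<in>F. P t f")
    case True
    then have "\<exists>f. f \<in> F \<and> P t f" by blast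
    from someI_ex[OF this] True show ?thesis by (simp add: pick_def)
  next
    case False
    then show ?thesis using someI_ex[of "\<lambda>f. f \<in> F"] F by (auto simp: pick_def)
  qed
  have pick_P: "P t (pick t)" if "f \<in> F" "P t f" for t f
  proof -
    have "\<exists>f. f \<in> F \<and> P t f" using that by blast
    from someI_ex[OF this] show ?thesis using that by (auto simp: pick_def)
  qed
  show thesis
  proof (rule that[of "\<lambda>i. pick (from_nat i)"])
    show "range (\<lambda>i. pick (from_nat i)) \<subseteq> F" using pick_F by blast
    fix f n and e :: real assume f: "f \<in> F" and "0 < e"
    then obtain l where l: "inverse (real (Suc l)) < e / 2"
      using reals_Archimedean[of "e / 2"] by auto
    \<comment> \<open>Half of the tolerance \<open>1 / Suc l\<close>: one half is for the
      oscillation on a code interval, the other for rounding to a rational.\<close>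
    define e' where "e' = 1 / (2 * real (Suc l))"
    have "0 < e'" by (simp add: e'_def)
    define f' where "f' z = f (inv_into (C n) \<phi> z)" for z
    have f': "f' (\<phi> x) = f x" if "x \<in> C n" for x
      by (simp add: f'_def inv_into_f_f[OF inj that])
    have "continuous_on (\<phi> ` C n) (inv_into (C n) \<phi>)"
      by (rule continuous_on_inv[OF cont C]) (simp add: inv_into_f_f[OF inj])
    moreover have "continuous_on UNIV f" using F f by blast
    ultimately have "continuous_on (\<phi> ` C n) f'"
      unfolding f'_def by (intro continuous_on_compose2[of UNIV f _ "inv_into (C n) \<phi>"]) auto
    then have "uniformly_continuous_on (\<phi> ` C n) f'"
      by (intro compact_uniformly_continuous compact_continuous_image cont C)
    then obtain d where "0 < d" and d: "\<And>z z'. z \<in> \<phi> ` C n \<Longrightarrow> z' \<in> \<phi> ` C n \<Longrightarrow> dist z' z < d \<Longrightarrow> dist (f' z') (f' z) < e'"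
      using \<open>0 < e'\<close> unfolding uniformly_continuous_on_def by metis
    then obtain m where "0 < m" and m: "inverse (real m) < d"
      using ex_inverse_of_nat_less by blast
    have osc: "\<bar>f x - f y\<bar> < e'"
      if "x \<in> C n" "y \<in> C n" "nat \<lfloor>real m * \<phi> x\<rfloor> = nat \<lfloor>real m * \<phi> y\<rfloor>" for x y
    proof -
      have "\<lfloor>real m * \<phi> x\<rfloor> = \<lfloor>real m * \<phi> y\<rfloor>"
        using that(3) \<phi>(1) by (subst (asm) eq_nat_nat_iff) auto
      then have "\<bar>real m * \<phi> x - real m * \<phi> y\<bar> < 1" by linarith
      then have "real m * \<bar>\<phi> x - \<phi> y\<bar> < 1"
        by (simp add: abs_mult flip: right_diff_distrib)
      then have "\<bar>\<phi> x - \<phi> y\<bar> < inverse (real m)"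
        using \<open>0 < m\<close> by (simp add: field_simps)
      then have "dist (f' (\<phi> x)) (f' (\<phi> y)) < e'"
        using m that by (intro d) (auto simp: dist_real_def)
      then show ?thesis using f' that by (simp add: dist_real_def)
    qed
    have "\<exists>r :: rat. \<forall>x\<in>C n. nat \<lfloor>real m * \<phi> x\<rfloor> = j \<longrightarrow> \<bar>f x - of_rat r\<bar> < 1 / Suc l" for j
    proof (cases "\<exists>x\<in>C n. nat \<lfloor>real m * \<phi> x\<rfloor> = j")
      case True
      then obtain x where x: "x \<in> C n" "nat \<lfloor>real m * \<phi> x\<rfloor> = j" by blast
      obtain r :: rat where r: "f x < of_rat r" "of_rat r < f x + e'"
        using of_rat_dense[of "f x" "f x + e'"] \<open>0 < e'\<close> by auto
      have "\<bar>f y - of_rat r\<bar> < 1 / Suc l" if "y \<in> C n" "nat \<lfloor>real m * \<phi> y\<rfloor> = j" for y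
      proof -
        have "\<bar>f y - of_rat r\<bar> < e' + e'"
          using r osc[of y x] x that by linarith
        also have "\<dots> = 1 / Suc l" by (simp add: e'_def field_simps)
        finally show ?thesis .
      qed
      then show ?thesis by blast
    qed auto
    then obtain r :: "nat \<Rightarrow> rat" where
      r: "\<And>j x. x \<in> C n \<Longrightarrow> nat \<lfloor>real m * \<phi> x\<rfloor> = j \<Longrightarrow> \<bar>f x - of_rat (r j)\<bar> < 1 / Suc l"
      by metis
    \<comment> \<open>Codes are below 2, so the intervals of length \<open>1 / m\<close> have
      indices below \<open>2 * m\<close>.\<close>
    define t where "t = (n, m, l, map r [0..<2 * m])"
    have idx: "nat \<lfloor>real m * \<phi> x\<rfloor> < 2 * m" for x
    proof -
      have "real m * \<phi> x < real m * 2"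
        using \<phi>(2)[of x] \<open>0 < m\<close> by (intro mult_strict_left_mono) auto
      then show ?thesis using \<phi>(1)[of x] by (simp add: nat_less_iff floor_less_iff mult.commute)
    qed
    have nth: "map r [0..<2 * m] ! nat \<lfloor>real m * \<phi> x\<rfloor> = r (nat \<lfloor>real m * \<phi> x\<rfloor>)" for x
      using idx[of x] by (subst nth_map) (auto simp del: upt_Suc)
    have "P t f"
      using r by (auto simp: P_def t_def nth)
    then have Pt: "P t (pick t)" using pick_P f by blast
    have "\<bar>pick t x - f x\<bar> < e" if "x \<in> C n" for x
    proof -
      have "\<bar>pick t x - of_rat (r (nat \<lfloor>real m * \<phi> x\<rfloor>))\<bar> < 1 / Suc l"
        using Pt that by (auto simp: P_def t_def nth)
      moreover have "\<bar>f x - of_rat (r (nat \<lfloor>real m * \<phi> x\<rfloor>))\<bar> < 1 / Suc l"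
        using r that by blast
      ultimately show ?thesis using l by (simp add: inverse_eq_divide)
    qed
    then show "\<exists>i. \<forall>x\<in>C n. \<bar>pick (from_nat i) x - f x\<bar> < e"
      by (intro exI[of _ "to_nat t"]) simp
  qed
qed

section \<open>Regular conditional distributions\<close>

text \<open>Indicators of open sets are lower semicontinuous, so the narrow topology already makes
  the measure of an open set under \<open>\<kappa> \<omega>\<close> measurable in
  \<open>\<omega>\<close>, and the open sets form an intersection-stable generator of the Borel
  sets.\<close>

lemma narrow_measurable_imp_prob_algebra:
  fixes \<kappa> :: "'w \<Rightarrow> 's::topological_space measure"
  assumes \<kappa>: "\<kappa> \<in> M \<rightarrow>\<^sub>M narrow_borel"
  shows "\<kappa> \<in> M \<rightarrow>\<^sub>M prob_algebra borel"
proof -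
  have space: "space (narrow_borel :: 's measure measure) = topspace narrow_topology"
    unfolding narrow_borel_def by (simp add: space_measure_of_conv)
  have sets: "{U. openin narrow_topology U} \<subseteq> sets (narrow_borel :: 's measure measure)"
    unfolding narrow_borel_def
    by (subst sets_measure_of) (auto dest: openin_subset)
  have prob: "prob_space (\<kappa> \<omega>)" "sets (\<kappa> \<omega>) = sets borel" if "\<omega> \<in> space M" for \<omega>
  proof -
    have "\<kappa> \<omega> \<in> topspace narrow_topology"
      using measurable_space[OF \<kappa> that] space by simp
    then show "prob_space (\<kappa> \<omega>)" "sets (\<kappa> \<omega>) = sets borel"
      unfolding narrow_topology_def by auto
  qed
  have open_meas: "(\<lambda>\<omega>. emeasure (\<kappa> \<omega>) G) \<in> borel_measurable M" if "open G" for G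
  proof -
    have [measurable]: "G \<in> sets borel" using that by simp
    have "(\<lambda>\<omega>. measure (\<kappa> \<omega>) G) \<in> borel_measurable M"
    proof (rule borel_measurableI_greater)
      fix t :: real
      let ?U = "{\<mu> :: 's measure. prob_space \<mu> \<and> sets \<mu> = sets borel \<and> t < (\<integral>x. indicator G x \<partial>\<mu>)}"
      have "lower_semicontinuous (indicator G)"
        unfolding lower_semicontinuous_def
      proof
        fix s :: real
        have "{x. s < indicator G x} = (if s < 0 then UNIV else if s < 1 then G else {})"
          by (auto simp: indicator_def)
        then show "open {x. s < indicator G x}" using that by simp
      qed
      then have "openin narrow_topology ?U"
        unfolding narrow_topology_def
        by (intro topology_generated_by_Basis, intro CollectI, rule_tac x = "indicator G" in exI,
            rule_tac x = t in exI, intro conjI refl) (auto simp: indicator_def)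
      then have "?U \<in> sets narrow_borel" using sets by auto
      then have "\<kappa> -` ?U \<inter> space M \<in> sets M"
        using \<kappa> by (rule measurable_sets[rotated])
      also have "\<kappa> -` ?U \<inter> space M = {\<omega> \<in> space M. t < measure (\<kappa> \<omega>) G}"
        using prob by auto
      finally show "{\<omega> \<in> space M. t < measure (\<kappa> \<omega>) G} \<in> sets M" .
    qed
    then have "(\<lambda>\<omega>. ennreal (measure (\<kappa> \<omega>) G)) \<in> borel_measurable M" by measurable
    then show ?thesis
      by (subst measurable_cong[where g = "\<lambda>\<omega>. ennreal (measure (\<kappa> \<omega>) G)"])
        (auto simp: finite_measure.emeasure_eq_measure prob_space.finite_measure prob)
  qed
  show ?thesis
  proof (rule measurable_prob_algebraI[OF prob(1)])
    show "\<kappa> \<in> M \<rightarrow>\<^sub>M subprob_algebra borel"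
    proof (rule measurable_subprob_algebra_generated[where \<Omega> = UNIV and G = "Collect open"])
      show "sets (borel :: 's measure) = sigma_sets UNIV (Collect open)"
        by (simp add: borel_def)
    qed (auto simp: Int_stable_def prob prob_space_imp_subprob_space intro: open_meas)
  qed
qed

text \<open>Brings the sigma-compact carrier of a mixture down to almost every single kernel
  measure.\<close>

lemma AE_AE_kernel:
  assumes M: "subalgebra P M" and \<kappa>: "\<kappa> \<in> M \<rightarrow>\<^sub>M prob_algebra borel" and S[measurable]: "S \<in> sets borel"
    and null: "(\<integral>\<^sup>+\<omega>. (\<integral>\<^sup>+x. indicator (- S) x \<partial>\<kappa> \<omega>) \<partial>P) = 0"
  shows "AE \<omega> in P. AE x in \<kappa> \<omega>. x \<in> S"
proof -
  have "(\<lambda>\<omega>. \<integral>\<^sup>+x. indicator (- S) x \<partial>\<kappa> \<omega>) \<in> borel_measurable M"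
    by (rule measurable_compose[OF measurable_prob_algebraD[OF \<kappa>] nn_integral_measurable_subprob_algebra]) measurable
  then have "AE \<omega> in P. (\<integral>\<^sup>+x. indicator (- S) x \<partial>\<kappa> \<omega>) = 0"
    using null nn_integral_0_iff_AE[OF measurable_from_subalg[OF M]] by blast
  moreover have "AE \<omega> in P. \<omega> \<in> space P" by simp
  ultimately show ?thesis
  proof eventually_elim
    case (elim \<omega>)
    have "sets (\<kappa> \<omega>) = sets borel"
      using measurable_space[OF \<kappa>] elim(2) M by (auto simp: space_prob_algebra subalgebra_def)
    note this[measurable_cong]
    from elim(1) show ?case
      by (subst (asm) nn_integral_0_iff_AE) (auto elim!: eventually_mono simp: indicator_def split: if_splits)
  qed
qed

lemma regular_cond_distr_emeasure:
  assumes "prob_space P" and M: "subalgebra P M" and X[measurable]: "X \<in> P \<rightarrow>\<^sub>M borel"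
    and \<kappa>: "regular_cond_distr P M X \<kappa>" and A: "A \<in> sets M" and B[measurable]: "B \<in> sets borel"
  shows "emeasure P {\<omega> \<in> A. X \<omega> \<in> B} = (\<integral>\<^sup>+\<omega>\<in>A. emeasure (\<kappa> \<omega>) B \<partial>P)"
proof -
  interpret prob_space P by fact
  interpret finite_measure_subalgebra P M by unfold_locales (rule M)
  have AP[measurable]: "A \<in> sets P" using A M by (auto simp: subalgebra_def)
  have ind[measurable]: "indicator (X -` B) \<in> borel_measurable P"
  proof -
    have "(\<lambda>\<omega>. indicator B (X \<omega>) :: ennreal) \<in> borel_measurable P" by measurable
    then show ?thesis by (simp add: indicator_def vimage_def)
  qed
  have "(\<integral>\<^sup>+\<omega>\<in>A. emeasure (\<kappa> \<omega>) B \<partial>P) = (\<integral>\<^sup>+\<omega>. indicator A \<omega> * nn_cond_exp P M (indicator (X -` B)) \<omega> \<partial>P)"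
  proof (rule nn_integral_cong_AE)
    have "AE \<omega> in P. emeasure (\<kappa> \<omega>) B = nn_cond_exp P M (indicator (X -` B)) \<omega>"
      using \<kappa> B unfolding regular_cond_distr_def by blast
    then show "AE \<omega> in P. emeasure (\<kappa> \<omega>) B * indicator A \<omega> = indicator A \<omega> * nn_cond_exp P M (indicator (X -` B)) \<omega>"
      by eventually_elim (simp add: mult.commute)
  qed
  also have "\<dots> = (\<integral>\<^sup>+\<omega>. indicator A \<omega> * indicator (X -` B) \<omega> \<partial>P)"
    using A by (intro nn_cond_exp_intg) auto
  also have "\<dots> = (\<integral>\<^sup>+\<omega>. indicator {\<omega> \<in> A. X \<omega> \<in> B} \<omega> \<partial>P)"
    by (intro nn_integral_cong) (auto simp: indicator_def)
  also have "\<dots> = emeasure P {\<omega> \<in> A. X \<omega> \<in> B}"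
  proof (rule nn_integral_indicator)
    have "{\<omega> \<in> space P. \<omega> \<in> A \<and> X \<omega> \<in> B} \<in> sets P" by measurable
    moreover have "{\<omega> \<in> space P. \<omega> \<in> A \<and> X \<omega> \<in> B} = {\<omega> \<in> A. X \<omega> \<in> B}"
      using sets.sets_into_space[OF AP] by auto
    ultimately show "{\<omega> \<in> A. X \<omega> \<in> B} \<in> sets P" by simp
  qed
  finally show ?thesis by simp
qed

text \<open>The definition gives the identity for rectangles \<open>A \<times> B\<close> only. Both
  sides are integrals against probability measures on the product, the law of
  \<open>(\<omega>, X \<omega>)\<close> and a mixture of kernels, and rectangles determine such
  measures.\<close>

lemma nn_integral_regular_cond_distr:
  assumes "prob_space P" and M: "subalgebra P M" and X[measurable]: "X \<in> P \<rightarrow>\<^sub>M borel"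
    and \<kappa>: "regular_cond_distr P M X \<kappa>" and f[measurable]: "f \<in> borel_measurable (M \<Otimes>\<^sub>M borel)"
  shows "(\<integral>\<^sup>+\<omega>. f (\<omega>, X \<omega>) \<partial>P) = (\<integral>\<^sup>+\<omega>. (\<integral>\<^sup>+x. f (\<omega>, x) \<partial>\<kappa> \<omega>) \<partial>P)"
proof -
  interpret prob_space P by fact
  define R where "R = restr_to_subalg P M"
  have R: "sets R = sets M" "space R = space P"
    unfolding R_def by (auto simp: sets_restr_to_subalg[OF M] space_restr_to_subalg)
  have spaceM: "space M = space P" using M by (simp add: subalgebra_def)
  have id[measurable]: "(\<lambda>\<omega>. \<omega>) \<in> P \<rightarrow>\<^sub>M M"
    by (rule measurable_from_subalg[OF M]) simp
  have \<kappa>M[measurable]: "\<kappa> \<in> M \<rightarrow>\<^sub>M prob_algebra borel"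
    using \<kappa> by (simp add: regular_cond_distr_def)
  have \<kappa>_sets: "sets (\<kappa> \<omega>) = sets borel" if "\<omega> \<in> space P" for \<omega>
    using measurable_space[OF \<kappa>M] that spaceM by (auto simp: space_prob_algebra)
  define N :: "('a \<times> 'b) measure" where "N = M \<Otimes>\<^sub>M borel"
  \<comment> \<open>\<open>k \<omega>\<close> is the product of the point mass at
    \<open>\<omega>\<close> with \<open>\<kappa> \<omega>\<close>, so that the mixture lives on the
    product space.\<close>
  define k where "k \<omega> = distr (\<kappa> \<omega>) N (Pair \<omega>)" for \<omega>
  have kM: "k \<in> M \<rightarrow>\<^sub>M prob_algebra N"
    unfolding k_def N_def by measurable
  then have kR: "k \<in> R \<rightarrow>\<^sub>M subprob_algebra N"
    using measurable_prob_algebraD measurable_cong_sets[OF R(1) refl] by blast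
  have k_meas: "Pair \<omega> \<in> \<kappa> \<omega> \<rightarrow>\<^sub>M N" if "\<omega> \<in> space P" for \<omega>
    using that spaceM unfolding N_def
    by (subst measurable_cong_sets[OF \<kappa>_sets[OF that] refl]) (auto intro: measurable_Pair1')
  have ne: "space R \<noteq> {}" using not_empty R by simp
  have X'[measurable]: "(\<lambda>\<omega>. (\<omega>, X \<omega>)) \<in> P \<rightarrow>\<^sub>M N"
    unfolding N_def by measurable
  have "distr P N (\<lambda>\<omega>. (\<omega>, X \<omega>)) = R \<bind> k"
  proof (rule measure_eqI_generator_eq)
    let ?E = "{a \<times> b |a b. a \<in> sets M \<and> b \<in> sets (borel :: 'b measure)}"
    show "Int_stable ?E" by (rule Int_stable_pair_measure_generator)
    show "?E \<subseteq> Pow (space M \<times> UNIV)"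
      using sets.sets_into_space by fastforce
    show "sets (distr P N (\<lambda>\<omega>. (\<omega>, X \<omega>))) = sigma_sets (space M \<times> UNIV) ?E"
      by (simp add: N_def sets_pair_measure)
    have "sets (R \<bind> k) = sets N"
      by (rule sets_bind[OF _ ne]) (use kR in \<open>auto dest: subprob_measurableD\<close>)
    then show "sets (R \<bind> k) = sigma_sets (space M \<times> UNIV) ?E"
      by (simp add: N_def sets_pair_measure)
    have "space M \<times> UNIV \<in> ?E"
      by (rule CollectI, rule_tac x = "space M" in exI, rule_tac x = UNIV in exI) simp
    then show "range (\<lambda>_. space M \<times> UNIV) \<subseteq> ?E" by auto
    show "emeasure (distr P N (\<lambda>\<omega>. (\<omega>, X \<omega>))) (space M \<times> UNIV) \<noteq> \<infinity>"
      unfolding infinity_ennreal_def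
      by (rule finite_measure.emeasure_finite[OF prob_space.finite_measure[OF prob_space_distr[OF X']]])
    fix Z assume "Z \<in> ?E"
    then obtain A B where Z: "Z = A \<times> B" and A[measurable]: "A \<in> sets M" and B[measurable]: "B \<in> sets borel"
      by blast
    have ZN: "Z \<in> sets N" unfolding Z N_def by measurable
    have "emeasure (R \<bind> k) Z = (\<integral>\<^sup>+\<omega>. emeasure (k \<omega>) Z \<partial>R)"
      by (rule emeasure_bind[OF ne kR ZN])
    also have "\<dots> = (\<integral>\<^sup>+\<omega>. emeasure (k \<omega>) Z \<partial>P)"
      unfolding R_def by (intro nn_integral_subalgebra2[OF M])
        (rule measurable_compose[OF measurable_prob_algebraD[OF kM] measurable_emeasure_subprob_algebra[OF ZN]])
    also have "\<dots> = (\<integral>\<^sup>+\<omega>\<in>A. emeasure (\<kappa> \<omega>) B \<partial>P)"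
    proof (rule nn_integral_cong)
      fix \<omega> assume \<omega>: "\<omega> \<in> space P"
      have "emeasure (k \<omega>) Z = emeasure (\<kappa> \<omega>) (Pair \<omega> -` Z \<inter> space (\<kappa> \<omega>))"
        unfolding k_def by (rule emeasure_distr[OF k_meas[OF \<omega>] ZN])
      also have "Pair \<omega> -` Z \<inter> space (\<kappa> \<omega>) = (if \<omega> \<in> A then B else {})"
        using sets_eq_imp_space_eq[OF \<kappa>_sets[OF \<omega>]] by (auto simp: Z)
      finally show "emeasure (k \<omega>) Z = emeasure (\<kappa> \<omega>) B * indicator A \<omega>" by simp
    qed
    also have "\<dots> = emeasure P {\<omega> \<in> A. X \<omega> \<in> B}"
      by (rule regular_cond_distr_emeasure[OF assms(1-4) A B, symmetric])
    also have "\<dots> = emeasure (distr P N (\<lambda>\<omega>. (\<omega>, X \<omega>))) Z"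
      using sets.sets_into_space[OF A] spaceM
      by (subst emeasure_distr[OF X' ZN]) (auto simp: Z intro!: arg_cong[where f = "emeasure P"])
    finally show "emeasure (distr P N (\<lambda>\<omega>. (\<omega>, X \<omega>))) Z = emeasure (R \<bind> k) Z" by simp
  qed auto
  note eq = this
  have fN: "f \<in> borel_measurable N" by (simp add: N_def f)
  have "(\<integral>\<^sup>+\<omega>. f (\<omega>, X \<omega>) \<partial>P) = (\<integral>\<^sup>+z. f z \<partial>(R \<bind> k))"
    using fN by (subst eq[symmetric]) (simp add: nn_integral_distr)
  also have "\<dots> = (\<integral>\<^sup>+\<omega>. (\<integral>\<^sup>+z. f z \<partial>k \<omega>) \<partial>R)"
    by (rule nn_integral_bind[OF fN kR])
  also have "\<dots> = (\<integral>\<^sup>+\<omega>. (\<integral>\<^sup>+z. f z \<partial>k \<omega>) \<partial>P)"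
    unfolding R_def by (intro nn_integral_subalgebra2[OF M])
      (rule measurable_compose[OF measurable_prob_algebraD[OF kM] nn_integral_measurable_subprob_algebra[OF fN]])
  also have "\<dots> = (\<integral>\<^sup>+\<omega>. (\<integral>\<^sup>+x. f (\<omega>, x) \<partial>\<kappa> \<omega>) \<partial>P)"
    using fN k_meas by (intro nn_integral_cong) (simp add: k_def nn_integral_distr)
  finally show ?thesis .
qed

text \<open>Adding the bound \<open>B\<close> makes \<open>a\<close> nonnegative, where
  \<open>nn\<close> applies; measurability of the inner integral is also read off from its shifted
  version in \<open>ennreal\<close>.\<close>

lemma bounded_kernel_integral:
  fixes a :: "'w \<times> 's::topological_space \<Rightarrow> real"
  assumes P: "prob_space P" and M: "subalgebra P M" and Q: "prob_space Q" "sets Q = sets (M \<Otimes>\<^sub>M borel)"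
    and \<kappa>: "\<kappa> \<in> M \<rightarrow>\<^sub>M prob_algebra borel"
    and nn: "\<And>f :: 'w \<times> 's \<Rightarrow> ennreal. f \<in> borel_measurable (M \<Otimes>\<^sub>M borel) \<Longrightarrow>
      (\<integral>\<^sup>+z. f z \<partial>Q) = (\<integral>\<^sup>+\<omega>. (\<integral>\<^sup>+x. f (\<omega>, x) \<partial>\<kappa> \<omega>) \<partial>P)"
    and a[measurable]: "a \<in> borel_measurable (M \<Otimes>\<^sub>M borel)" and bdd: "bounded (range a)"
  shows "integrable P (\<lambda>\<omega>. \<integral>x. a (\<omega>, x) \<partial>\<kappa> \<omega>)" "(\<integral>z. a z \<partial>Q) = (\<integral>\<omega>. (\<integral>x. a (\<omega>, x) \<partial>\<kappa> \<omega>) \<partial>P)"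
proof -
  interpret P: prob_space P by fact
  interpret Q: prob_space Q by fact
  note Q(2)[measurable_cong]
  have spaceM: "space M = space P" using M by (simp add: subalgebra_def)
  obtain B where B: "\<And>z. \<bar>a z\<bar> \<le> B" using bdd unfolding bounded_iff by auto
  have B0: "0 \<le> B" using B[of undefined] by linarith
  have ab: "0 \<le> a z + B" for z using B[of z] by linarith
  have \<kappa>_prob: "prob_space (\<kappa> \<omega>)" and \<kappa>_sets: "sets (\<kappa> \<omega>) = sets borel" if "\<omega> \<in> space P" for \<omega>
    using measurable_space[OF \<kappa>] that spaceM by (auto simp: space_prob_algebra)
  let ?I = "\<lambda>\<omega>. \<integral>x. a (\<omega>, x) \<partial>\<kappa> \<omega>"
  have int: "integrable (\<kappa> \<omega>) (\<lambda>x. a (\<omega>, x))" if "\<omega> \<in> space P" for \<omega>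
  proof -
    interpret prob_space "\<kappa> \<omega>" by (rule \<kappa>_prob[OF that])
    have "(\<lambda>x. a (\<omega>, x)) \<in> borel_measurable (\<kappa> \<omega>)"
      using that spaceM by (subst measurable_cong_sets[OF \<kappa>_sets[OF that] refl]) simp
    then show ?thesis by (rule integrable_const_bound[where B = B, rotated]) (use B in auto)
  qed
  have I_bound: "\<bar>?I \<omega>\<bar> \<le> B" if "\<omega> \<in> space P" for \<omega>
  proof -
    interpret prob_space "\<kappa> \<omega>" by (rule \<kappa>_prob[OF that])
    have "\<bar>?I \<omega>\<bar> \<le> (\<integral>x. \<bar>a (\<omega>, x)\<bar> \<partial>\<kappa> \<omega>)" by (rule integral_abs_bound)
    also have "\<dots> \<le> (\<integral>x. B \<partial>\<kappa> \<omega>)" using int[OF that] B by (intro integral_mono) auto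
    finally show ?thesis using prob_space by simp
  qed
  have inner: "(\<integral>\<^sup>+x. ennreal (a (\<omega>, x) + B) \<partial>\<kappa> \<omega>) = ennreal (?I \<omega> + B)" if "\<omega> \<in> space P" for \<omega>
  proof -
    interpret prob_space "\<kappa> \<omega>" by (rule \<kappa>_prob[OF that])
    have "(\<integral>\<^sup>+x. ennreal (a (\<omega>, x) + B) \<partial>\<kappa> \<omega>) = ennreal (\<integral>x. a (\<omega>, x) + B \<partial>\<kappa> \<omega>)"
      using int[OF that] ab by (intro nn_integral_eq_integral) auto
    then show ?thesis using int[OF that] prob_space by simp
  qed
  have "(\<lambda>\<omega>. enn2real (\<integral>\<^sup>+x. ennreal (a (\<omega>, x) + B) \<partial>\<kappa> \<omega>) - B) \<in> borel_measurable M"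
    using nn_integral_measurable_subprob_algebra2[OF _ measurable_prob_algebraD[OF \<kappa>],
        of "\<lambda>\<omega> x. ennreal (a (\<omega>, x) + B)"] by measurable
  then have "(\<lambda>\<omega>. enn2real (\<integral>\<^sup>+x. ennreal (a (\<omega>, x) + B) \<partial>\<kappa> \<omega>) - B) \<in> borel_measurable P"
    by (rule measurable_from_subalg[OF M])
  moreover have "enn2real (\<integral>\<^sup>+x. ennreal (a (\<omega>, x) + B) \<partial>\<kappa> \<omega>) - B = ?I \<omega>" if "\<omega> \<in> space P" for \<omega>
    using I_bound[OF that] by (simp add: inner[OF that])
  ultimately have I_meas: "?I \<in> borel_measurable P"
    by (simp cong: measurable_cong)
  show I_int: "integrable P ?I"
    by (rule P.integrable_const_bound[where B = B]) (use I_meas I_bound in auto)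
  have Q_int: "integrable Q a"
    by (rule Q.integrable_const_bound[where B = B]) (use B in auto)
  have "ennreal ((\<integral>z. a z \<partial>Q) + B) = ennreal (\<integral>z. a z + B \<partial>Q)"
    using Q_int Q.prob_space by simp
  also have "\<dots> = (\<integral>\<^sup>+z. ennreal (a z + B) \<partial>Q)"
    using Q_int ab by (intro nn_integral_eq_integral[symmetric]) auto
  also have "\<dots> = (\<integral>\<^sup>+\<omega>. (\<integral>\<^sup>+x. ennreal (a (\<omega>, x) + B) \<partial>\<kappa> \<omega>) \<partial>P)"
    by (rule nn) measurable
  also have "\<dots> = (\<integral>\<^sup>+\<omega>. ennreal (?I \<omega> + B) \<partial>P)"
    by (intro nn_integral_cong inner)
  also have "\<dots> = ennreal (\<integral>\<omega>. ?I \<omega> + B \<partial>P)"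
  proof (rule nn_integral_eq_integral)
    show "AE \<omega> in P. 0 \<le> ?I \<omega> + B" using I_bound by (intro AE_I2) force
  qed (use I_int in auto)
  also have "\<dots> = ennreal ((\<integral>\<omega>. ?I \<omega> \<partial>P) + B)"
    using I_int P.prob_space by simp
  finally have eq: "ennreal ((\<integral>z. a z \<partial>Q) + B) = ennreal ((\<integral>\<omega>. ?I \<omega> \<partial>P) + B)" .
  \<comment> \<open>\<open>ennreal\<close> identifies all negative numbers with 0, so equality of
    the shifted integrals can be cancelled only once both are known to be nonnegative.\<close>
  have "- B \<le> (\<integral>z. a z \<partial>Q)" "- B \<le> (\<integral>\<omega>. ?I \<omega> \<partial>P)"
  proof -
    have "(\<integral>z. - B \<partial>Q) \<le> (\<integral>z. a z \<partial>Q)"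
      using Q_int B by (intro integral_mono) (auto simp: abs_le_iff minus_le_iff)
    then show "- B \<le> (\<integral>z. a z \<partial>Q)" using Q.prob_space by simp
    have "(\<integral>\<omega>. - B \<partial>P) \<le> (\<integral>\<omega>. ?I \<omega> \<partial>P)"
      using I_int I_bound by (intro integral_mono) (auto simp: abs_le_iff minus_le_iff)
    then show "- B \<le> (\<integral>\<omega>. ?I \<omega> \<partial>P)" using P.prob_space by simp
  qed
  then show "(\<integral>z. a z \<partial>Q) = (\<integral>\<omega>. ?I \<omega> \<partial>P)" using eq by simp
qed

text \<open>The inf-convolution of \<open>b / l\<close> with \<open>d\<close> is \<open>d\<close>-Lipschitz and lies between \<open>- a / l\<close> and \<open>b / l\<close>.\<close>
lemma weak_duality:
  fixes \<mu> \<nu> :: "'s::topological_space measure" and a b :: "'s \<Rightarrow> real" and d :: "'s \<Rightarrow> 's \<Rightarrow> real"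
  assumes \<mu>: "prob_space \<mu>" "sets \<mu> = sets borel" and \<nu>: "prob_space \<nu>" "sets \<nu> = sets borel"
    and a[measurable]: "a \<in> borel_measurable borel" and b[measurable]: "b \<in> borel_measurable borel"
    and bdd: "bounded (range a)" "bounded (range b)" and "0 < l"
    and d: "\<And>x y. 0 \<le> d x y" "\<And>x. d x x = 0" "\<And>x y z. d x z \<le> d x y + d y z" "\<And>x y. d x y = d y x"
    and ge: "\<And>x y. 0 \<le> a x + b y + l * d x y"
    and Lip: "\<And>f. bounded (range f) \<Longrightarrow> (\<And>x y. \<bar>f x - f y\<bar> \<le> d x y) \<Longrightarrow>
      f \<in> borel_measurable borel \<and> (\<integral>x. f x \<partial>\<mu>) - (\<integral>x. f x \<partial>\<nu>) \<le> w"
  shows "0 \<le> (\<integral>x. a x \<partial>\<mu>) + (\<integral>x. b x \<partial>\<nu>) + l * w"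
proof -
  interpret \<mu>: prob_space \<mu> by fact
  interpret \<nu>: prob_space \<nu> by fact
  note \<mu>(2)[measurable_cong] \<nu>(2)[measurable_cong]
  obtain A where A: "\<And>x. \<bar>a x\<bar> \<le> A" using bdd unfolding bounded_iff by auto
  obtain B where B: "\<And>x. \<bar>b x\<bar> \<le> B" using bdd unfolding bounded_iff by auto
  define f where "f x = (INF y. b y / l + d x y)" for x
  have low: "- (a x) / l \<le> b y / l + d x y" for x y
    using ge[of x y] \<open>0 < l\<close> by (simp add: field_simps)
  have bddb: "bdd_below (range (\<lambda>y. b y / l + d x y))" for x
    using low by (auto intro!: bdd_belowI2)
  have f_le: "f x \<le> b y / l + d x y" for x y
    unfolding f_def by (rule cINF_lower[OF bddb]) simp
  have f_ge: "t \<le> f x" if "\<And>y. t \<le> b y / l + d x y" for t x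
    unfolding f_def by (rule cINF_greatest) (use that in auto)
  have f_lip1: "f x - d x y \<le> f y" for x y
  proof (rule f_ge)
    fix z
    show "f x - d x y \<le> b z / l + d y z"
      using f_le[of x z] d(3)[of x z y] by linarith
  qed
  have f_lip: "\<bar>f x - f y\<bar> \<le> d x y" for x y
    using f_lip1[of x y] f_lip1[of y x] d(4)[of x y] by linarith
  have f_b: "l * f x \<le> b x" for x
    using f_le[of x x] d(2)[of x] \<open>0 < l\<close> by (simp add: field_simps)
  have f_a: "- a x \<le> l * f x" for x
    using f_ge[OF low, of x] \<open>0 < l\<close> by (simp add: field_simps)
  have f_bound: "\<bar>f x\<bar> \<le> max A B / l" for x
  proof -
    have "\<bar>l * f x\<bar> \<le> max A B"
      using f_a[of x] f_b[of x] A[of x] B[of x] by linarith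
    then show ?thesis using \<open>0 < l\<close> by (simp add: abs_mult field_simps)
  qed
  then have "bounded (range f)" unfolding bounded_iff by auto
  from Lip[OF this f_lip] have f[measurable]: "f \<in> borel_measurable borel"
    and w: "(\<integral>x. f x \<partial>\<mu>) - (\<integral>x. f x \<partial>\<nu>) \<le> w" by auto
  have int: "integrable \<mu> f" "integrable \<nu> f"
    using f_bound by (auto intro!: \<mu>.integrable_const_bound[where B = "max A B / l"]
        \<nu>.integrable_const_bound[where B = "max A B / l"])
  \<comment> \<open>By the two bounds on \<open>f\<close>, the integral of \<open>a\<close> is at
    least \<open>- l\<close> times that of \<open>f\<close> under \<open>\<mu>\<close>, and the
    integral of \<open>b\<close> at least \<open>l\<close> times that of \<open>f\<close> under
    \<open>\<nu>\<close>; the sum is therefore at least \<open>- l * w\<close>.\<close>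
  have "(\<integral>x. - (l * f x) \<partial>\<mu>) \<le> (\<integral>x. a x \<partial>\<mu>)"
  proof (rule integral_mono)
    show "integrable \<mu> a" using A by (auto intro!: \<mu>.integrable_const_bound[where B = A])
    show "- (l * f x) \<le> a x" for x using f_a[of x] by linarith
  qed (use int in auto)
  moreover have "(\<integral>x. l * f x \<partial>\<nu>) \<le> (\<integral>x. b x \<partial>\<nu>)"
  proof (rule integral_mono)
    show "integrable \<nu> b" using B by (auto intro!: \<nu>.integrable_const_bound[where B = B])
  qed (use int f_b in auto)
  moreover have "l * ((\<integral>x. f x \<partial>\<mu>) - (\<integral>x. f x \<partial>\<nu>)) \<le> l * w"
    using w \<open>0 < l\<close> by (intro mult_left_mono) auto
  ultimately show ?thesis by (simp add: right_diff_distrib)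
qed

section \<open>Coupling by duality\<close>

definition max_dist :: "(nat \<Rightarrow> 's \<Rightarrow> real) \<Rightarrow> nat \<Rightarrow> 's \<Rightarrow> 's \<Rightarrow> real" where
  "max_dist g n x y = Max ((\<lambda>i. \<bar>g i x - g i y\<bar>) ` {..n})"

lemma max_dist_ge: "i \<le> n \<Longrightarrow> \<bar>g i x - g i y\<bar> \<le> max_dist g n x y"
  unfolding max_dist_def by (rule Max_ge) auto

lemma max_dist_le_iff: "max_dist g n x y \<le> t \<longleftrightarrow> (\<forall>i\<le>n. \<bar>g i x - g i y\<bar> \<le> t)"
  unfolding max_dist_def by (subst Max_le_iff) auto

lemma max_dist_nonneg: "0 \<le> max_dist g n x y"
  using max_dist_ge[of 0 n g x y] by linarith

lemma max_dist_self: "max_dist g n x x = 0"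
  by (rule antisym) (simp_all add: max_dist_le_iff max_dist_nonneg)

lemma max_dist_commute: "max_dist g n x y = max_dist g n y x"
  unfolding max_dist_def by (simp add: abs_minus_commute)

lemma max_dist_triangle: "max_dist g n x z \<le> max_dist g n x y + max_dist g n y z"
  unfolding max_dist_le_iff
proof (intro allI impI)
  fix i assume "i \<le> n"
  then show "\<bar>g i x - g i z\<bar> \<le> max_dist g n x y + max_dist g n y z"
    using max_dist_ge[of i n g x y] max_dist_ge[of i n g y z] by linarith
qed

lemma max_dist_mono: "m \<le> n \<Longrightarrow> max_dist g m x y \<le> max_dist g n x y"
  unfolding max_dist_le_iff[of g m] by (auto intro: max_dist_ge)

lemma bounded_max_dist:
  assumes "\<And>i. bounded (range (g i))"
  obtains B where "\<And>x y. max_dist g n x y \<le> B"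
proof -
  have "\<forall>i. \<exists>b. \<forall>x. \<bar>g i x\<bar> \<le> b" using assms unfolding bounded_iff by auto
  then obtain b where b: "\<And>i x. \<bar>g i x\<bar> \<le> b i" by metis
  show thesis
  proof (rule that[of "\<Sum>i\<le>n. 2 * b i"], unfold max_dist_le_iff, intro allI impI)
    fix x y i assume "i \<le> n"
    have "0 \<le> b i" for i using b[of i undefined] by linarith
    then have "2 * b i \<le> (\<Sum>i\<le>n. 2 * b i)"
      using \<open>i \<le> n\<close> member_le_sum[of i "{..n}" "\<lambda>i. 2 * b i"] by simp
    then show "\<bar>g i x - g i y\<bar> \<le> (\<Sum>i\<le>n. 2 * b i)"
      using b[of i x] b[of i y] by linarith
  qed
qed

lemma measurable_max_dist:
  assumes "\<And>i. g i \<in> borel_measurable N" "f \<in> K \<rightarrow>\<^sub>M N" "h \<in> K \<rightarrow>\<^sub>M N"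
  shows "(\<lambda>z. max_dist g n (f z) (h z)) \<in> borel_measurable K"
proof -
  have [measurable]: "(\<lambda>z. g i (f z)) \<in> borel_measurable K" "(\<lambda>z. g i (h z)) \<in> borel_measurable K" for i
    using assms by (auto intro: measurable_compose)
  show ?thesis
    unfolding max_dist_def by (intro borel_measurable_Max) auto
qed

text \<open>Near \<open>x\<close> the pseudometric is dominated by a finite sum of
  \<open>\<bar>g i y - g i x\<bar>\<close>, each tending to 0. This is what puts the inf-convolution
  of weak duality into \<open>Lip c\<close>.\<close>

lemma continuous_if_max_dist_Lipschitz:
  fixes f :: "'s::topological_space \<Rightarrow> real"
  assumes g: "\<And>i. continuous_on UNIV (g i)" and f: "\<And>x y. \<bar>f x - f y\<bar> \<le> max_dist g n x y"
  shows "continuous_on UNIV f"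
  unfolding continuous_on_def
proof
  fix x
  have "((\<lambda>y. g i y - g i x) \<longlongrightarrow> 0) (at x)" for i
    using g[of i] unfolding continuous_on_def by (auto simp: LIM_zero)
  then have lim: "((\<lambda>y. \<Sum>i\<le>n. \<bar>g i y - g i x\<bar>) \<longlongrightarrow> 0) (at x)"
    by (intro tendsto_null_sum tendsto_rabs_zero) auto
  have "\<bar>f y - f x\<bar> \<le> (\<Sum>i\<le>n. \<bar>g i y - g i x\<bar>)" for y
  proof -
    have "max_dist g n y x \<le> (\<Sum>i\<le>n. \<bar>g i y - g i x\<bar>)"
      unfolding max_dist_le_iff
      using member_le_sum[of _ "{..n}" "\<lambda>i. \<bar>g i y - g i x\<bar>"] by simp
    then show ?thesis using f[of y x] by linarith
  qed
  then have "((\<lambda>y. f y - f x) \<longlongrightarrow> 0) (at x)"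
    by (intro Lim_null_comparison[OF _ lim] always_eventually allI) simp
  then show "(f \<longlongrightarrow> f x) (at x within UNIV)"
    by (simp add: LIM_zero_iff)
qed

text \<open>Exactly one pair of values contributes. The point is the shape of the right side, a
  finite combination of products of indicators, on which \<open>L\<close> is known through its
  bimeasure.\<close>

lemma finite_valued_expand:
  fixes m :: "'i \<Rightarrow> 'i \<Rightarrow> real"
  assumes "finite R" "G x \<in> R" "G y \<in> R"
  shows "m (G x) (G y) =
    (\<Sum>j\<in>R \<times> R. m (fst j) (snd j) * (indicator (G -` {fst j}) x * indicator (G -` {snd j}) y))"
proof -
  have "(\<Sum>j\<in>R \<times> R. m (fst j) (snd j) * (indicator (G -` {fst j}) x * indicator (G -` {snd j}) y)) =
      (\<Sum>j\<in>R \<times> R. if j = (G x, G y) then m (G x) (G y) else 0)"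
    by (intro sum.cong) (auto simp: indicator_def)
  then show ?thesis using assms by simp
qed

text \<open>Rounding each \<open>g i\<close> down to a multiple of \<open>\<delta>\<close> leaves
  finitely many values, as \<open>g i\<close> is bounded, and the list of rounded values replaces
  the point. A difference of two values involves two roundings, whence
  \<open>\<delta> = e / 2\<close>.\<close>

lemma quantize_max_dist:
  fixes g :: "nat \<Rightarrow> 's \<Rightarrow> real"
  assumes bdd: "\<And>i. bounded (range (g i))" and meas: "\<And>i. g i \<in> borel_measurable N"
    and spN: "space N = UNIV" and "0 < e"
  obtains G :: "'s \<Rightarrow> int list" and m :: "int list \<Rightarrow> int list \<Rightarrow> real" where
    "finite (range G)" "\<And>\<alpha>. G -` {\<alpha>} \<in> sets N" "\<And>x y. \<bar>m (G x) (G y) - max_dist g n x y\<bar> \<le> e"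
proof -
  define \<delta> where "\<delta> = e / 2"
  have "0 < \<delta>" using \<open>0 < e\<close> by (simp add: \<delta>_def)
  define q where "q i x = \<lfloor>g i x / \<delta>\<rfloor>" for i x
  define G where "G x = map (\<lambda>i. q i x) [0..<Suc n]" for x
  define m where "m a b = Max ((\<lambda>i. \<bar>\<delta> * of_int (a ! i) - \<delta> * of_int (b ! i)\<bar>) ` {..n})" for a b :: "int list"
  have nth: "G x ! i = q i x" if "i \<le> n" for i x
    using that by (simp add: G_def less_Suc_eq_le del: upt_Suc)
  have q_err: "\<bar>\<delta> * of_int (q i x) - g i x\<bar> \<le> \<delta>" for i x
  proof -
    have "of_int (q i x) \<le> g i x / \<delta>" "g i x / \<delta> \<le> of_int (q i x) + 1"
      unfolding q_def by linarith+
    then have "\<delta> * of_int (q i x) \<le> g i x" "g i x \<le> \<delta> * of_int (q i x) + \<delta>"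
      using \<open>0 < \<delta>\<close> by (simp_all add: field_simps)
    then show ?thesis by linarith
  qed
  have fin_q: "finite (range (q i))" for i
  proof -
    obtain b where b: "\<And>x. \<bar>g i x\<bar> \<le> b" using bdd[of i] unfolding bounded_iff by auto
    have "range (q i) \<subseteq> {\<lfloor>- b / \<delta>\<rfloor>..\<lfloor>b / \<delta>\<rfloor>}"
    proof
      fix k assume "k \<in> range (q i)"
      then obtain x where k: "k = \<lfloor>g i x / \<delta>\<rfloor>" by (auto simp: q_def)
      have "- b \<le> g i x" "g i x \<le> b" using b[of x] by linarith+
      then show "k \<in> {\<lfloor>- b / \<delta>\<rfloor>..\<lfloor>b / \<delta>\<rfloor>}"
        using \<open>0 < \<delta>\<close> unfolding k atLeastAtMost_iff by (intro conjI floor_mono divide_right_mono) auto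
    qed
    then show ?thesis by (rule finite_subset) simp
  qed
  show thesis
  proof (rule that)
    have "range G \<subseteq> {xs. set xs \<subseteq> (\<Union>i\<le>n. range (q i)) \<and> length xs = Suc n}"
      by (fastforce simp: G_def less_Suc_eq_le simp del: upt_Suc)
    then show "finite (range G)"
      by (rule finite_subset) (intro finite_lists_length_eq, use fin_q in auto)
  next
    fix \<alpha> :: "int list"
    have "G -` {\<alpha>} = {x \<in> space N. length \<alpha> = Suc n \<and> (\<forall>i\<in>{..n}. q i x = \<alpha> ! i)}"
    proof (intro set_eqI iffI)
      fix x assume "x \<in> G -` {\<alpha>}"
      then have "\<alpha> = G x" by simp
      then show "x \<in> {x \<in> space N. length \<alpha> = Suc n \<and> (\<forall>i\<in>{..n}. q i x = \<alpha> ! i)}"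
        using nth[of _ x] spN by (simp add: G_def del: upt_Suc)
    next
      fix x assume "x \<in> {x \<in> space N. length \<alpha> = Suc n \<and> (\<forall>i\<in>{..n}. q i x = \<alpha> ! i)}"
      then have "G x = \<alpha>"
        by (intro nth_equalityI) (auto simp: nth[unfolded G_def] G_def less_Suc_eq_le simp del: upt_Suc)
      then show "x \<in> G -` {\<alpha>}" by simp
    qed
    also have "\<dots> \<in> sets N"
    proof -
      have "{x \<in> space N. q i x = k} \<in> sets N" for i k
      proof -
        have [measurable]: "g i \<in> borel_measurable N" by (rule meas)
        show ?thesis unfolding q_def by measurable
      qed
      then show ?thesis by (intro sets.sets_Collect sets.sets_Collect_finite_All') auto
    qed
    finally show "G -` {\<alpha>} \<in> sets N" .
  next
    fix x y
    have near: "\<bar>\<bar>\<delta> * of_int (G x ! i) - \<delta> * of_int (G y ! i)\<bar> - \<bar>g i x - g i y\<bar>\<bar> \<le> e" if "i \<le> n" for i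
      using q_err[of i x] q_err[of i y] unfolding nth[OF that] \<delta>_def by linarith
    have "m (G x) (G y) \<le> max_dist g n x y + e"
      unfolding m_def
    proof (subst Max_le_iff)
      show "\<forall>a\<in>(\<lambda>i. \<bar>\<delta> * of_int (G x ! i) - \<delta> * of_int (G y ! i)\<bar>) ` {..n}. a \<le> max_dist g n x y + e"
      proof
        fix a assume "a \<in> (\<lambda>i. \<bar>\<delta> * of_int (G x ! i) - \<delta> * of_int (G y ! i)\<bar>) ` {..n}"
        then obtain i where "i \<le> n" "a = \<bar>\<delta> * of_int (G x ! i) - \<delta> * of_int (G y ! i)\<bar>" by auto
        then show "a \<le> max_dist g n x y + e"
          using near[of i] max_dist_ge[of i n g x y] by linarith
      qed
    qed auto
    moreover have "max_dist g n x y \<le> m (G x) (G y) + e"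
      unfolding max_dist_le_iff
    proof (intro allI impI)
      fix i assume "i \<le> n"
      have "\<bar>\<delta> * of_int (G x ! i) - \<delta> * of_int (G y ! i)\<bar> \<le> m (G x) (G y)"
        unfolding m_def using \<open>i \<le> n\<close> by (intro Max_ge) auto
      then show "\<bar>g i x - g i y\<bar> \<le> m (G x) (G y) + e"
        using near[OF \<open>i \<le> n\<close>] by linarith
    qed
    ultimately show "\<bar>m (G x) (G y) - max_dist g n x y\<bar> \<le> e" by linarith
  qed
qed

text \<open>The functional and the realized coupling agree on rectangles, hence on quantized costs,
  which approximate \<open>max_dist g n\<close> uniformly; both are monotone, so the bound
  \<open>V\<close> passes from \<open>L\<close> to the coupling.\<close>

lemma coupling_realization:
  fixes M :: "'w measure" and Q1 Q2 :: "('w \<times> 's::topological_space) measure" and g :: "nat \<Rightarrow> 's \<Rightarrow> real"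
    and \<phi> :: "'s \<Rightarrow> real" and \<psi> :: "real \<Rightarrow> 's"
  assumes Q1: "prob_space Q1" "sets Q1 = sets (M \<Otimes>\<^sub>M borel)"
    and Q2: "prob_space Q2" "sets Q2 = sets (M \<Otimes>\<^sub>M borel)"
    and g: "\<And>i. g i \<in> borel_measurable borel" "\<And>i. bounded (range (g i))"
    and weak: "\<And>a b l n. a \<in> borel_measurable Q1 \<Longrightarrow> b \<in> borel_measurable Q2 \<Longrightarrow>
      bounded (range a) \<Longrightarrow> bounded (range b) \<Longrightarrow> 0 < l \<Longrightarrow>
      (\<And>\<omega> x y. \<omega> \<in> space M \<Longrightarrow> 0 \<le> a (\<omega>, x) + b (\<omega>, y) + l * max_dist g n x y) \<Longrightarrow>
      0 \<le> (\<integral>p. a p \<partial>Q1) + (\<integral>p. b p \<partial>Q2) + l * V"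
    and \<phi>: "\<phi> \<in> borel_measurable borel" "\<And>x. 0 \<le> \<phi> x" "\<And>x. \<phi> x < 2"
    and \<psi>: "\<psi> \<in> borel \<rightarrow>\<^sub>M borel"
    and S0: "S0 \<in> sets borel" and null: "measure Q2 (space M \<times> - S0) = 0"
    and inv: "\<And>x. x \<in> S0 \<Longrightarrow> \<psi> (\<phi> x) = x"
  obtains Z :: "('w \<times> 's) \<times> real \<Rightarrow> real" where "Z \<in> borel_measurable ((M \<Otimes>\<^sub>M borel) \<Otimes>\<^sub>M borel)"
    "\<And>A E. A \<in> sets M \<Longrightarrow> E \<in> sets borel \<Longrightarrow>
      emeasure (Q1 \<Otimes>\<^sub>M uniform_measure lborel {0..1})
        {z \<in> space ((M \<Otimes>\<^sub>M borel) \<Otimes>\<^sub>M borel). fst (fst z) \<in> A \<and> \<psi> (Z z) \<in> E} = emeasure Q2 (A \<times> E)"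
    "\<And>n. (\<integral>\<^sup>+z. ennreal (max_dist g n (snd (fst z)) (\<psi> (Z z))) \<partial>(Q1 \<Otimes>\<^sub>M uniform_measure lborel {0..1})) \<le> ennreal V"
proof -
  interpret Q1: prob_space Q1 by fact
  interpret Q2: prob_space Q2 by fact
  note Q1(2)[measurable_cong] Q2(2)[measurable_cong]
  note [measurable] = \<phi>(1) \<psi> S0 g(1)
  have sp: "space Q1 = space M \<times> UNIV" "space Q2 = space M \<times> UNIV"
    using sets_eq_imp_space_eq[OF Q1(2)] sets_eq_imp_space_eq[OF Q2(2)] by (auto simp: space_pair_measure)
  have mm: "bounded (range (\<lambda>(x, y). max_dist g n x y))" for n
  proof -
    obtain B where "\<And>x y. max_dist g n x y \<le> B" using bounded_max_dist[of g n, OF g(2)] by blast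
    then show ?thesis
      unfolding bounded_iff by (intro exI[of _ B]) (auto simp: max_dist_nonneg)
  qed
  obtain L :: "('w \<times> 's \<times> 's \<Rightarrow> real) \<Rightarrow> real" where
    L_add: "\<And>f g. bounded (range f) \<Longrightarrow> bounded (range g) \<Longrightarrow> L (\<lambda>z. f z + g z) = L f + L g" and
    L_scale: "\<And>f t. bounded (range f) \<Longrightarrow> L (\<lambda>z. t * f z) = t * L f" and
    L_le: "\<And>h a b. bounded (range h) \<Longrightarrow> a \<in> borel_measurable Q1 \<Longrightarrow> b \<in> borel_measurable Q2 \<Longrightarrow>
      bounded (range a) \<Longrightarrow> bounded (range b) \<Longrightarrow>
      (\<And>\<omega> x y. \<omega> \<in> space M \<Longrightarrow> h (\<omega>, x, y) \<le> a (\<omega>, x) + b (\<omega>, y)) \<Longrightarrow> L h \<le> (\<integral>p. a p \<partial>Q1) + (\<integral>p. b p \<partial>Q2)" and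
    L_cost: "\<And>n. L (\<lambda>(\<omega>, x, y). max_dist g n x y) \<le> V"
  proof (rule coupling_functional[where d = "max_dist g" and V = V, OF Q1(1) Q2(1) sp mm max_dist_nonneg max_dist_mono])
    fix a b :: "'w \<times> 's \<Rightarrow> real" and l n
    assume "a \<in> borel_measurable Q1" "b \<in> borel_measurable Q2" "bounded (range a)" "bounded (range b)" "0 < l"
      "\<And>\<omega> x y. \<omega> \<in> space M \<Longrightarrow> 0 \<le> a (\<omega>, x) + b (\<omega>, y) + l * max_dist g n x y"
    then show "0 \<le> (\<integral>p. a p \<partial>Q1) + (\<integral>p. b p \<partial>Q2) + l * V"
      by (rule weak)
  next
    fix L :: "('w \<times> 's \<times> 's \<Rightarrow> real) \<Rightarrow> real"
    assume L: "\<And>f g. bounded (range f) \<Longrightarrow> bounded (range g) \<Longrightarrow> L (\<lambda>z. f z + g z) = L f + L g"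
      "\<And>f t. bounded (range f) \<Longrightarrow> L (\<lambda>z. t * f z) = t * L f"
      "\<And>h a b. bounded (range h) \<Longrightarrow> a \<in> borel_measurable Q1 \<Longrightarrow> b \<in> borel_measurable Q2 \<Longrightarrow>
        bounded (range a) \<Longrightarrow> bounded (range b) \<Longrightarrow>
        (\<And>\<omega> x y. \<omega> \<in> space M \<Longrightarrow> h (\<omega>, x, y) \<le> a (\<omega>, x) + b (\<omega>, y)) \<Longrightarrow> L h \<le> (\<integral>p. a p \<partial>Q1) + (\<integral>p. b p \<partial>Q2)"
      "\<And>n. L (\<lambda>(\<omega>, x, y). max_dist g n x y) \<le> V"
    show thesis by (rule that[OF L])
  qed
  \<comment> \<open>The constant \<open>t\<close> integrates to itself under the probability measure
    \<open>Q1\<close>. This one comparison yields that values off \<open>space M\<close> do not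
    matter, positivity, and continuity under uniform approximation.\<close>
  have L_le_shift: "L h \<le> L h' + t"
    if "bounded (range h)" "bounded (range h')" and le: "\<And>\<omega> x y. \<omega> \<in> space M \<Longrightarrow> h (\<omega>, x, y) \<le> h' (\<omega>, x, y) + t" for h h' t
  proof -
    have b: "bounded (range (\<lambda>z. (-1) * h' z))" using that by (intro bounded_range_cmult)
    have "L (\<lambda>z. h z + (-1) * h' z) \<le> (\<integral>p. t \<partial>Q1) + (\<integral>p. 0 \<partial>Q2)"
    proof (rule L_le)
      show "bounded (range (\<lambda>z. h z + (-1) * h' z))" using that b by (intro bounded_range_add)
      show "h (\<omega>, x, y) + (-1) * h' (\<omega>, x, y) \<le> t + 0" if "\<omega> \<in> space M" for \<omega> x y
        using le[OF that, of x y] by simp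
    qed auto
    then show ?thesis
      using L_add[OF that(1) b] L_scale[OF that(2), of "-1"] Q1.prob_space by simp
  qed
  have L_cong: "L h = L h'" if "bounded (range h)" "bounded (range h')"
    "\<And>\<omega> x y. \<omega> \<in> space M \<Longrightarrow> h (\<omega>, x, y) = h' (\<omega>, x, y)" for h h'
    using L_le_shift[of h h' 0] L_le_shift[of h' h 0] that by simp
  have L_nonneg: "0 \<le> L h" if "bounded (range h)" "\<And>z. 0 \<le> h z" for h
  proof -
    have "L (\<lambda>z. 0 * h z) \<le> L h + 0"
      using that by (intro L_le_shift bounded_range_cmult) auto
    then show ?thesis using L_scale[OF that(1), of 0] by simp
  qed
  have L_eq: "L h = (\<integral>p. a p \<partial>Q1) + (\<integral>p. b p \<partial>Q2)"
    if h: "bounded (range h)" and a: "a \<in> borel_measurable Q1" "bounded (range a)"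
      and b: "b \<in> borel_measurable Q2" "bounded (range b)"
      and eq: "\<And>\<omega> x y. \<omega> \<in> space M \<Longrightarrow> h (\<omega>, x, y) = a (\<omega>, x) + b (\<omega>, y)" for h a b
  proof (rule antisym)
    show "L h \<le> (\<integral>p. a p \<partial>Q1) + (\<integral>p. b p \<partial>Q2)"
      using that by (intro L_le) auto
    have "L (\<lambda>z. (-1) * h z) \<le> (\<integral>p. (-1) * a p \<partial>Q1) + (\<integral>p. (-1) * b p \<partial>Q2)"
    proof (rule L_le)
      show "(-1) * h (\<omega>, x, y) \<le> (-1) * a (\<omega>, x) + (-1) * b (\<omega>, y)" if "\<omega> \<in> space M" for \<omega> x y
        using eq[OF that, of x y] by simp
    qed (use h a b in \<open>auto intro: bounded_range_cmult simp del: mult_minus1\<close>)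
    then show "(\<integral>p. a p \<partial>Q1) + (\<integral>p. b p \<partial>Q2) \<le> L h"
      using L_scale[OF h, of "-1"] by simp
  qed
  have bdd_sum: "bounded (range (\<lambda>z. \<Sum>i\<in>I. f i z))" if "finite I" "\<And>i. i \<in> I \<Longrightarrow> bounded (range (f i))"
    for I :: "'i set" and f :: "'i \<Rightarrow> 'w \<times> 's \<times> 's \<Rightarrow> real"
    using that by (induction I rule: finite_induct) (auto intro!: bounded_range_add)
  have L_sum: "L (\<lambda>z. \<Sum>i\<in>I. f i z) = (\<Sum>i\<in>I. L (f i))" if "finite I" "\<And>i. i \<in> I \<Longrightarrow> bounded (range (f i))"
    for I :: "'i set" and f :: "'i \<Rightarrow> 'w \<times> 's \<times> 's \<Rightarrow> real"
    using that
  proof (induction I rule: finite_induct)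
    case empty
    show ?case using L_scale[of "\<lambda>_. 0" 0] by simp
  next
    case (insert i I)
    have "L (\<lambda>z. f i z + (\<Sum>i\<in>I. f i z)) = L (f i) + L (\<lambda>z. \<Sum>i\<in>I. f i z)"
      using insert by (intro L_add bdd_sum) auto
    then show ?case using insert by simp
  qed

  \<comment> \<open>\<open>Q1\<close> governs \<open>(\<omega>, x)\<close> jointly, so
    \<open>\<omega>\<close> sits in the first argument of the bimeasure and the second carries
    \<open>y\<close> alone.\<close>
  define R where "R D E = (\<lambda>(\<omega>, x, y). indicator D (\<omega>, x) * indicator E y :: real)" for D :: "('w \<times> 's) set" and E :: "'s set"
  have R_bdd: "bounded (range (R D E))" for D E
    unfolding bounded_iff R_def by (intro exI[of _ 1]) (auto simp: indicator_def)
  define \<nu> where "\<nu> = distr Q2 borel snd"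
  have snd_m: "snd \<in> Q2 \<rightarrow>\<^sub>M (borel :: 's measure)" by measurable
  have \<nu>_measure: "measure \<nu> E = measure Q2 (space M \<times> E)" if "E \<in> sets borel" for E
    unfolding \<nu>_def using that
    by (subst measure_distr[OF snd_m]) (auto simp: sp intro!: arg_cong[where f = "measure Q2"])
  obtain Z :: "('w \<times> 's) \<times> real \<Rightarrow> real" where Z0: "Z \<in> borel_measurable (Q1 \<Otimes>\<^sub>M borel)" and
    Z: "\<And>D E. D \<in> sets Q1 \<Longrightarrow> E \<in> sets borel \<Longrightarrow>
      emeasure (Q1 \<Otimes>\<^sub>M uniform_measure lborel {0..1}) {z \<in> space (Q1 \<Otimes>\<^sub>M borel). fst z \<in> D \<and> \<psi> (Z z) \<in> E} = L (R D E)"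
  proof (rule bimeasure_realization[OF Q1(1), of "\<lambda>D E. L (R D E)" \<nu> \<phi> \<psi> S0])
    show "L (R (D \<union> D') E) = L (R D E) + L (R D' E)" if "D \<inter> D' = {}" for D D' E
    proof -
      have "R (D \<union> D') E = (\<lambda>z. R D E z + R D' E z)"
        using that by (auto simp: R_def indicator_def fun_eq_iff)
      then show ?thesis using L_add[OF R_bdd R_bdd] by simp
    qed
    show "L (R D (E \<union> E')) = L (R D E) + L (R D E')" if "E \<inter> E' = {}" for D E E'
    proof -
      have "R D (E \<union> E') = (\<lambda>z. R D E z + R D E' z)"
        using that by (auto simp: R_def indicator_def fun_eq_iff)
      then show ?thesis using L_add[OF R_bdd R_bdd] by simp
    qed
    show "0 \<le> L (R D E)" for D E
      by (rule L_nonneg[OF R_bdd]) (auto simp: R_def)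
    show "L (R D UNIV) = measure Q1 D" if "D \<in> sets Q1" for D
    proof -
      have "L (R D UNIV) = (\<integral>p. indicator D p \<partial>Q1) + (\<integral>p. 0 \<partial>Q2)"
        using that by (intro L_eq R_bdd bounded_range_indicator) (auto simp: R_def)
      then show ?thesis using that sets.sets_into_space[OF that] by (simp add: Int_absorb2)
    qed
    show "finite_measure \<nu>" "sets \<nu> = sets borel"
      unfolding \<nu>_def by (auto intro!: prob_space.finite_measure Q2.prob_space_distr)
    show "L (R D E) \<le> measure \<nu> E" if [measurable]: "E \<in> sets borel" for D E
    proof -
      have [measurable]: "space M \<times> E \<in> sets Q2" by measurable
      have "L (R D E) \<le> (\<integral>p. 0 \<partial>Q1) + (\<integral>p. indicator (space M \<times> E) p \<partial>Q2)"
        by (intro L_le R_bdd bounded_range_indicator) (auto simp: R_def indicator_def)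
      then show ?thesis
        using sets.sets_into_space[of "space M \<times> E" Q2] by (simp add: \<nu>_measure Int_absorb2)
    qed
    show "measure \<nu> (- S0) = 0" using null by (simp add: \<nu>_measure)
  next
    fix Z :: "('w \<times> 's) \<times> real \<Rightarrow> real"
    assume Z: "Z \<in> borel_measurable (Q1 \<Otimes>\<^sub>M borel)"
      "\<And>D E. D \<in> sets Q1 \<Longrightarrow> E \<in> sets borel \<Longrightarrow>
        emeasure (Q1 \<Otimes>\<^sub>M uniform_measure lborel {0..1}) {z \<in> space (Q1 \<Otimes>\<^sub>M borel). fst z \<in> D \<and> \<psi> (Z z) \<in> E} = L (R D E)"
    show thesis by (rule that[OF Z])
  qed (use \<phi> \<psi> S0 inv in auto)
  let ?T = "Q1 \<Otimes>\<^sub>M uniform_measure lborel {0..1::real}"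
  interpret T: prob_space ?T
    by (intro prob_space_pair Q1(1) prob_space_uniform_measure) auto
  have spT: "space (Q1 \<Otimes>\<^sub>M (borel :: real measure)) = space ((M \<Otimes>\<^sub>M borel) \<Otimes>\<^sub>M (borel :: real measure))"
    "space ?T = space ((M \<Otimes>\<^sub>M borel) \<Otimes>\<^sub>M (borel :: real measure))"
    by (auto simp: space_pair_measure sp)
  have setsT: "sets ?T = sets ((M \<Otimes>\<^sub>M borel) \<Otimes>\<^sub>M (borel :: real measure))"
    by (intro sets_pair_measure_cong) (auto simp: Q1(2))
  have Zm: "Z \<in> borel_measurable ((M \<Otimes>\<^sub>M borel) \<Otimes>\<^sub>M borel)"
    using Z0 by (simp cong: measurable_cong_sets sets_pair_measure_cong add: Q1(2))
  have ZT[measurable]: "Z \<in> borel_measurable ?T"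
    using Zm by (simp cong: measurable_cong_sets add: setsT)
  have T_sets: "{z \<in> space ((M \<Otimes>\<^sub>M borel) \<Otimes>\<^sub>M borel). fst z \<in> D \<and> \<psi> (Z z) \<in> E} \<in> sets ?T"
    if [measurable]: "D \<in> sets Q1" "E \<in> sets borel" for D E
  proof -
    have "{z \<in> space ?T. fst z \<in> D \<and> \<psi> (Z z) \<in> E} \<in> sets ?T" by measurable
    then show ?thesis by (simp add: spT)
  qed
  show thesis
  proof (rule that[OF Zm])
    fix A and E :: "'s set" assume A[measurable]: "A \<in> sets M" and E[measurable]: "E \<in> sets borel"
    \<comment> \<open>Taking \<open>A \<times> UNIV\<close> as first argument turns the rectangle
      into a function of \<open>(\<omega>, y)\<close>, whose value the second marginal fixes; thus
      the joint law of \<open>\<omega>\<close> and \<open>y\<close>, not merely the law of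
      \<open>y\<close>, is that of \<open>Q2\<close>.\<close>
    have D: "A \<times> UNIV \<in> sets Q1" by measurable
    have AE: "A \<times> E \<in> sets Q2" by measurable
    have "L (R (A \<times> UNIV) E) = (\<integral>p. 0 \<partial>Q1) + (\<integral>p. indicator (A \<times> E) p \<partial>Q2)"
      using AE by (intro L_eq R_bdd bounded_range_indicator) (auto simp: R_def indicator_def)
    then have "L (R (A \<times> UNIV) E) = measure Q2 (A \<times> E)"
      using sets.sets_into_space[OF AE] by (simp add: Int_absorb2)
    then show "emeasure ?T {z \<in> space ((M \<Otimes>\<^sub>M borel) \<Otimes>\<^sub>M borel). fst (fst z) \<in> A \<and> \<psi> (Z z) \<in> E} = emeasure Q2 (A \<times> E)"
      using Z[OF D E] by (simp add: spT mem_Times_iff Q2.emeasure_eq_measure)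
  next
    fix n
    have dm[measurable]: "(\<lambda>z. max_dist g n (snd (fst z)) (\<psi> (Z z))) \<in> borel_measurable ?T"
      by (rule measurable_max_dist[where N = borel]) (use g in measurable)
    obtain B where B: "\<And>x y. max_dist g n x y \<le> B" using bounded_max_dist[of g n, OF g(2)] by blast
    have d_int: "integrable ?T (\<lambda>z. max_dist g n (snd (fst z)) (\<psi> (Z z)))"
      using B by (intro T.integrable_const_bound[where B = B]) (auto simp: max_dist_nonneg)
    have d_bdd: "bounded (range (\<lambda>(\<omega> :: 'w, x, y). max_dist g n x y))"
      using B unfolding bounded_iff by (intro exI[of _ B]) (auto simp: max_dist_nonneg)
    have "(\<integral>z. max_dist g n (snd (fst z)) (\<psi> (Z z)) \<partial>?T) \<le> V + e" if "0 < e" for e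
    proof -
      \<comment> \<open>The tolerance is \<open>e / 2\<close> because quantization is used twice,
        under \<open>L\<close> and again under the coupling.\<close>
      obtain G :: "'s \<Rightarrow> int list" and m where fin: "finite (range G)"
        and G: "\<And>\<alpha>. G -` {\<alpha>} \<in> sets borel"
        and near: "\<And>x y. \<bar>m (G x) (G y) - max_dist g n x y\<bar> \<le> e / 2"
        by (rule quantize_max_dist[of g borel "e / 2" n, OF g(2,1)]) (use \<open>0 < e\<close> in auto)
      let ?S = "\<lambda>\<alpha> \<beta>. {z \<in> space ((M \<Otimes>\<^sub>M borel) \<Otimes>\<^sub>M borel). fst z \<in> space M \<times> G -` {\<alpha>} \<and> \<psi> (Z z) \<in> G -` {\<beta>}}"
      have D: "space M \<times> G -` {\<alpha>} \<in> sets Q1" for \<alpha>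
        using G by (simp add: Q1(2))
      have S_meas: "?S \<alpha> \<beta> \<in> sets ?T" for \<alpha> \<beta>
        by (rule T_sets[OF D G])
      have S: "measure ?T (?S \<alpha> \<beta>) = L (R (space M \<times> G -` {\<alpha>}) (G -` {\<beta>}))" for \<alpha> \<beta>
      proof -
        have "0 \<le> L (R (space M \<times> G -` {\<alpha>}) (G -` {\<beta>}))"
          by (rule L_nonneg[OF R_bdd]) (auto simp: R_def)
        then show ?thesis
          using Z[OF D[of \<alpha>] G[of \<beta>]] by (simp add: spT T.emeasure_eq_measure)
      qed
      define h where "h = (\<lambda>(\<omega> :: 'w, x, y). m (G x) (G y))"
      have h_bdd: "bounded (range h)"
      proof -
        have "\<bar>m (G x) (G y)\<bar> \<le> B + e / 2" for x y
          using near[of x y] B[of x y] max_dist_nonneg[of g n x y] by linarith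
        then show ?thesis unfolding bounded_iff h_def by auto
      qed
      let ?J = "range G \<times> range G"
      let ?I = "\<lambda>j z. m (fst j) (snd j) * indicator (?S (fst j) (snd j)) z :: real"
      let ?R = "\<lambda>j. R (space M \<times> G -` {fst j}) (G -` {snd j})"
      have finJ: "finite ?J" using fin by simp
      have I_int: "integrable ?T (?I j)" for j
      proof (rule integrable_mult_right, rule integrable_real_indicator[OF S_meas])
        show "emeasure ?T (?S (fst j) (snd j)) < \<infinity>"
          unfolding T.emeasure_eq_measure infinity_ennreal_def by (rule ennreal_less_top)
      qed
      have pt: "m (G (snd (fst z))) (G (\<psi> (Z z))) = (\<Sum>j\<in>?J. ?I j z)" if z: "z \<in> space ?T" for z
      proof -
        have "m (G (snd (fst z))) (G (\<psi> (Z z))) = (\<Sum>j\<in>?J. m (fst j) (snd j) *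
            (indicator (G -` {fst j}) (snd (fst z)) * indicator (G -` {snd j}) (\<psi> (Z z))))"
          by (rule finite_valued_expand[OF fin]) auto
        also have "\<dots> = (\<Sum>j\<in>?J. ?I j z)"
          using z unfolding spT by (intro sum.cong refl) (auto simp: indicator_def space_pair_measure)
        finally show ?thesis .
      qed
      have mG_int: "integrable ?T (\<lambda>z. m (G (snd (fst z))) (G (\<psi> (Z z))))"
        by (rule Bochner_Integration.integrable_cong[THEN iffD2, OF refl _ Bochner_Integration.integrable_sum[OF I_int]])
          (rule pt)
      have "(\<integral>z. m (G (snd (fst z))) (G (\<psi> (Z z))) \<partial>?T) = (\<integral>z. (\<Sum>j\<in>?J. ?I j z) \<partial>?T)"
        by (rule Bochner_Integration.integral_cong[OF refl]) (rule pt)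
      also have "\<dots> = (\<Sum>j\<in>?J. (\<integral>z. ?I j z \<partial>?T))"
        by (rule Bochner_Integration.integral_sum[OF I_int])
      also have "\<dots> = (\<Sum>j\<in>?J. L (\<lambda>z. m (fst j) (snd j) * ?R j z))"
      proof (rule sum.cong[OF refl])
        fix j
        have "(\<integral>z. ?I j z \<partial>?T) = m (fst j) (snd j) * measure ?T (?S (fst j) (snd j) \<inter> space ?T)"
          unfolding integral_mult_right_zero Bochner_Integration.integral_indicator ..
        also have "?S (fst j) (snd j) \<inter> space ?T = ?S (fst j) (snd j)"
          by (rule Int_absorb2[OF sets.sets_into_space[OF S_meas]])
        finally show "(\<integral>z. ?I j z \<partial>?T) = L (\<lambda>z. m (fst j) (snd j) * ?R j z)"
          by (simp only: S L_scale[OF R_bdd])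
      qed
      also have "\<dots> = L (\<lambda>z. \<Sum>j\<in>?J. m (fst j) (snd j) * ?R j z)"
        by (rule L_sum[symmetric, OF finJ bounded_range_cmult[OF R_bdd]])
      also have "\<dots> = L h"
      proof (rule L_cong)
        fix \<omega> x y assume \<omega>: "\<omega> \<in> space M"
        have "h (\<omega>, x, y) = (\<Sum>j\<in>?J. m (fst j) (snd j) *
            (indicator (G -` {fst j}) x * indicator (G -` {snd j}) y))"
          unfolding h_def prod.case by (rule finite_valued_expand[OF fin]) auto
        also have "\<dots> = (\<Sum>j\<in>?J. m (fst j) (snd j) * ?R j (\<omega>, x, y))"
          using \<omega> by (intro sum.cong refl) (auto simp: R_def indicator_def)
        finally show "(\<Sum>j\<in>?J. m (fst j) (snd j) * ?R j (\<omega>, x, y)) = h (\<omega>, x, y)" by simp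
      qed (intro bdd_sum finJ bounded_range_cmult R_bdd h_bdd)+
      also have "\<dots> \<le> L (\<lambda>(\<omega>, x, y). max_dist g n x y) + e / 2"
      proof (rule L_le_shift[OF h_bdd d_bdd])
        fix \<omega> x y
        show "h (\<omega>, x, y) \<le> (case (\<omega>, x, y) of (\<omega>, x, y) \<Rightarrow> max_dist g n x y) + e / 2"
          unfolding h_def prod.case using near[of x y] by linarith
      qed
      also have "\<dots> \<le> V + e / 2" using L_cost by simp
      finally have le: "(\<integral>z. m (G (snd (fst z))) (G (\<psi> (Z z))) \<partial>?T) \<le> V + e / 2" .
      have "(\<integral>z. max_dist g n (snd (fst z)) (\<psi> (Z z)) \<partial>?T) \<le>
          (\<integral>z. m (G (snd (fst z))) (G (\<psi> (Z z))) + e / 2 \<partial>?T)"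
      proof (rule integral_mono[OF d_int])
        show "max_dist g n (snd (fst z)) (\<psi> (Z z)) \<le> m (G (snd (fst z))) (G (\<psi> (Z z))) + e / 2" for z
          using near[of "snd (fst z)" "\<psi> (Z z)"] by linarith
      qed (use mG_int in auto)
      also have "\<dots> \<le> V + e" using mG_int le T.prob_space by simp
      finally show ?thesis .
    qed
    then have "(\<integral>z. max_dist g n (snd (fst z)) (\<psi> (Z z)) \<partial>?T) \<le> V"
      by (rule field_le_epsilon)
    then show "(\<integral>\<^sup>+z. ennreal (max_dist g n (snd (fst z)) (\<psi> (Z z))) \<partial>?T) \<le> ennreal V"
      using d_int by (subst nn_integral_eq_integral) (auto simp: max_dist_nonneg ennreal_leI)
  qed
qed

section \<open>The cost and its Lipschitz functions\<close>

text \<open>Turns the single inequality of total costs into an almost sure equality of conditional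
  costs.\<close>

lemma AE_eq_if_nn_integral_le:
  fixes f g :: "'a \<Rightarrow> ennreal"
  assumes [measurable]: "f \<in> borel_measurable N" "g \<in> borel_measurable N"
    and le: "AE x in N. f x \<le> g x" and fin: "(\<integral>\<^sup>+x. f x \<partial>N) < \<infinity>"
    and ge: "(\<integral>\<^sup>+x. g x \<partial>N) \<le> (\<integral>\<^sup>+x. f x \<partial>N)"
  shows "AE x in N. g x = f x"
proof -
  have "(\<integral>\<^sup>+x. g x - f x \<partial>N) = (\<integral>\<^sup>+x. g x \<partial>N) - (\<integral>\<^sup>+x. f x \<partial>N)"
    using le fin by (intro nn_integral_diff) auto
  also have "\<dots> = 0"
    using ge order_le_less_trans[OF ge fin] by (simp add: diff_eq_0_iff_ennreal)
  finally have "AE x in N. g x - f x = 0"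
    by (subst (asm) nn_integral_0_iff_AE) auto
  with le show ?thesis
    by eventually_elim (auto simp: diff_eq_0_iff_ennreal)
qed

lemma nn_cond_exp_regular_cond_distr:
  assumes P: "prob_space P" and M: "subalgebra P M" and X[measurable]: "X \<in> P \<rightarrow>\<^sub>M borel"
    and \<kappa>: "regular_cond_distr P M X \<kappa>" and h[measurable]: "h \<in> borel_measurable borel"
  shows "AE \<omega> in P. (\<integral>\<^sup>+x. h x \<partial>\<kappa> \<omega>) = nn_cond_exp P M (\<lambda>\<omega>. h (X \<omega>)) \<omega>"
proof -
  interpret prob_space P by fact
  interpret finite_measure_subalgebra P M by unfold_locales (rule M)
  have \<kappa>M: "\<kappa> \<in> M \<rightarrow>\<^sub>M prob_algebra borel"
    using \<kappa> by (simp add: regular_cond_distr_def)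
  show ?thesis
  proof (rule nn_cond_exp_charact)
    fix A assume A[measurable]: "A \<in> sets M"
    have "(\<integral>\<^sup>+\<omega>\<in>A. h (X \<omega>) \<partial>P) = (\<integral>\<^sup>+\<omega>. (\<lambda>z. h (snd z) * indicator A (fst z)) (\<omega>, X \<omega>) \<partial>P)"
      by simp
    also have "\<dots> = (\<integral>\<^sup>+\<omega>. (\<integral>\<^sup>+x. (\<lambda>z. h (snd z) * indicator A (fst z)) (\<omega>, x) \<partial>\<kappa> \<omega>) \<partial>P)"
      by (rule nn_integral_regular_cond_distr[OF P M X \<kappa>]) measurable
    also have "\<dots> = (\<integral>\<^sup>+\<omega>\<in>A. (\<integral>\<^sup>+x. h x \<partial>\<kappa> \<omega>) \<partial>P)"
      by (intro nn_integral_cong) (simp add: indicator_def)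
    finally show "(\<integral>\<^sup>+\<omega>\<in>A. h (X \<omega>) \<partial>P) = (\<integral>\<^sup>+\<omega>\<in>A. (\<integral>\<^sup>+x. h x \<partial>\<kappa> \<omega>) \<partial>P)" .
  next
    show "(\<lambda>\<omega>. \<integral>\<^sup>+x. h x \<partial>\<kappa> \<omega>) \<in> borel_measurable M"
      by (rule measurable_compose[OF measurable_prob_algebraD[OF \<kappa>M] nn_integral_measurable_subprob_algebra[OF h]])
  qed measurable
qed

lemma cond_exp_cost_ge:
  fixes g :: "'s::topological_space \<Rightarrow> real"
  assumes P: "prob_space P" and M: "subalgebra P M"
    and X[measurable]: "X \<in> P \<rightarrow>\<^sub>M borel" and Y[measurable]: "Y \<in> P \<rightarrow>\<^sub>M borel"
    and \<mu>: "regular_cond_distr P M X \<mu>" and \<nu>: "regular_cond_distr P M Y \<nu>"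
    and g[measurable]: "g \<in> borel_measurable borel" and bdd: "bounded (range g)"
    and [measurable]: "k \<in> borel_measurable P"
    and le: "\<And>\<omega>. \<omega> \<in> space P \<Longrightarrow> ennreal \<bar>g (X \<omega>) - g (Y \<omega>)\<bar> \<le> k \<omega>"
  shows "AE \<omega> in P. ennreal \<bar>(\<integral>x. g x \<partial>\<mu> \<omega>) - (\<integral>x. g x \<partial>\<nu> \<omega>)\<bar> \<le> nn_cond_exp P M k \<omega>"
proof -
  interpret prob_space P by fact
  interpret finite_measure_subalgebra P M by unfold_locales (rule M)
  obtain B where B: "\<And>x. \<bar>g x\<bar> \<le> B" using bdd unfolding bounded_iff by auto
  define h where "h x = ennreal (g x + B)" for x
  have h[measurable]: "h \<in> borel_measurable borel" unfolding h_def by measurable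
  have gB: "0 \<le> g x + B" for x using B[of x] by linarith
  have h_int: "(\<integral>\<^sup>+x. h x \<partial>\<kappa>) = ennreal ((\<integral>x. g x \<partial>\<kappa>) + B)" "0 \<le> (\<integral>x. g x \<partial>\<kappa>) + B"
    if "\<kappa> \<in> space (prob_algebra borel)" for \<kappa> :: "'s measure"
  proof -
    have \<kappa>: "prob_space \<kappa>" "sets \<kappa> = sets borel"
      using that by (auto simp: space_prob_algebra)
    interpret \<kappa>: prob_space \<kappa> by fact
    note \<kappa>(2)[measurable_cong]
    have int: "integrable \<kappa> g"
      by (rule \<kappa>.integrable_const_bound[where B = B]) (use B in auto)
    have "(\<integral>\<^sup>+x. h x \<partial>\<kappa>) = ennreal (\<integral>x. g x + B \<partial>\<kappa>)"
      unfolding h_def using int gB by (intro nn_integral_eq_integral) auto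
    then show "(\<integral>\<^sup>+x. h x \<partial>\<kappa>) = ennreal ((\<integral>x. g x \<partial>\<kappa>) + B)"
      using int \<kappa>.prob_space by simp
    have "0 \<le> (\<integral>x. g x + B \<partial>\<kappa>)" using gB by (intro integral_nonneg_AE) auto
    then show "0 \<le> (\<integral>x. g x \<partial>\<kappa>) + B" using int \<kappa>.prob_space by simp
  qed
  have sp: "\<mu> \<omega> \<in> space (prob_algebra borel)" "\<nu> \<omega> \<in> space (prob_algebra borel)" if "\<omega> \<in> space P" for \<omega>
    using that M \<mu> \<nu> unfolding regular_cond_distr_def subalgebra_def by (auto intro: measurable_space)
  have h_le: "h x \<le> h y + t" if "ennreal \<bar>g x - g y\<bar> \<le> t" for x y t
  proof -
    have "h x \<le> ennreal (g y + B + \<bar>g x - g y\<bar>)"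
      unfolding h_def by (intro ennreal_leI) linarith
    also have "\<dots> = h y + ennreal \<bar>g x - g y\<bar>"
      unfolding h_def using gB by (intro ennreal_plus) auto
    also have "\<dots> \<le> h y + t" using that by (intro add_left_mono)
    finally show ?thesis .
  qed
  have "AE \<omega> in P. nn_cond_exp P M (\<lambda>\<omega>. h (X \<omega>)) \<omega> \<le> nn_cond_exp P M (\<lambda>\<omega>. h (Y \<omega>) + k \<omega>) \<omega>"
    using le by (intro nn_cond_exp_mono AE_I2 h_le) auto
  moreover have "AE \<omega> in P. nn_cond_exp P M (\<lambda>\<omega>. h (Y \<omega>)) \<omega> \<le> nn_cond_exp P M (\<lambda>\<omega>. h (X \<omega>) + k \<omega>) \<omega>"
    using le by (intro nn_cond_exp_mono AE_I2 h_le) (auto simp: abs_minus_commute)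
  moreover have "AE \<omega> in P. nn_cond_exp P M (\<lambda>\<omega>. h (Y \<omega>)) \<omega> + nn_cond_exp P M k \<omega> = nn_cond_exp P M (\<lambda>\<omega>. h (Y \<omega>) + k \<omega>) \<omega>"
    by (rule nn_cond_exp_sum) measurable
  moreover have "AE \<omega> in P. nn_cond_exp P M (\<lambda>\<omega>. h (X \<omega>)) \<omega> + nn_cond_exp P M k \<omega> = nn_cond_exp P M (\<lambda>\<omega>. h (X \<omega>) + k \<omega>) \<omega>"
    by (rule nn_cond_exp_sum) measurable
  moreover note nn_cond_exp_regular_cond_distr[OF P M X \<mu> h] nn_cond_exp_regular_cond_distr[OF P M Y \<nu> h]
  moreover have "AE \<omega> in P. \<omega> \<in> space P" by simp
  ultimately show ?thesis
  proof eventually_elim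
    case (elim \<omega>)
    note \<omega> = elim(7)
    let ?m = "(\<integral>x. g x \<partial>\<mu> \<omega>) + B" and ?n = "(\<integral>x. g x \<partial>\<nu> \<omega>) + B" and ?k = "nn_cond_exp P M k \<omega>"
    have "ennreal ?m \<le> ennreal ?n + ?k" "ennreal ?n \<le> ennreal ?m + ?k" and nn: "0 \<le> ?m" "0 \<le> ?n"
      using elim h_int[OF sp(1)[OF \<omega>]] h_int[OF sp(2)[OF \<omega>]] by simp_all
    then show "ennreal \<bar>(\<integral>x. g x \<partial>\<mu> \<omega>) - (\<integral>x. g x \<partial>\<nu> \<omega>)\<bar> \<le> ?k"
    proof (cases ?k)
      case (real r)
      have "?m \<le> ?n + r" "?n \<le> ?m + r"
        using \<open>ennreal ?m \<le> ennreal ?n + ?k\<close> \<open>ennreal ?n \<le> ennreal ?m + ?k\<close> nn real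
        by (auto simp flip: ennreal_plus)
      then have "\<bar>(\<integral>x. g x \<partial>\<mu> \<omega>) - (\<integral>x. g x \<partial>\<nu> \<omega>)\<bar> \<le> r" by linarith
      then show ?thesis unfolding real(2) by (rule ennreal_leI)
    qed simp
  qed
qed

context
  fixes c :: "'s::topological_space \<Rightarrow> 's \<Rightarrow> ennreal"
  assumes c: "\<And>x y. c x y = (SUP u\<in>Lip c. ennreal \<bar>u x - u y\<bar>)"
begin

lemma cost_self: "c x x = 0"
  by (simp add: c[of x x] bot_ennreal[symmetric])

text \<open>The supremum may be uncountable, but it is one of continuous functions, so its
  superlevel sets are open. Only sections are treated, since an open set of pairs need not lie in
  the product sigma-algebra.\<close>

lemma borel_measurable_cost: "(\<lambda>x. c x y) \<in> borel_measurable borel"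
proof (rule borel_measurableI_greater)
  fix t
  have "{x. t < c x y} = (\<Union>u\<in>Lip c. {x. t < ennreal \<bar>u x - u y\<bar>})"
    by (subst c) (auto simp: less_SUP_iff)
  also have "open \<dots>"
  proof (intro open_UN ballI)
    fix u assume "u \<in> Lip c"
    then have "continuous_on UNIV (\<lambda>x. ennreal \<bar>u x - u y\<bar>)"
      unfolding Lip_def by (intro continuous_on_ennreal continuous_intros) auto
    then show "open {x. t < ennreal \<bar>u x - u y\<bar>}"
      by (rule open_Collect_less[OF continuous_on_const])
  qed
  finally show "{x \<in> space borel. t < c x y} \<in> sets borel" by simp
qed

lemma Lip_le: "u \<in> Lip c \<Longrightarrow> ennreal \<bar>u x - u y\<bar> \<le> c x y"
  by (simp add: Lip_def)

lemma max_dist_le_cost: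
  assumes "range g \<subseteq> Lip c"
  shows "ennreal (max_dist g n x y) \<le> c x y"
proof -
  have "max_dist g n x y \<in> (\<lambda>i. \<bar>g i x - g i y\<bar>) ` {..n}"
    unfolding max_dist_def by (rule Max_in) auto
  then obtain i where "max_dist g n x y = \<bar>g i x - g i y\<bar>" by auto
  then show ?thesis using Lip_le[of "g i" x y] assms by auto
qed

lemma Lip_measurable: "u \<in> Lip c \<Longrightarrow> u \<in> borel_measurable borel"
  unfolding Lip_def by (auto intro: borel_measurable_continuous_onI)

lemma Lip_integrable:
  assumes "prob_space \<mu>" "sets \<mu> = sets borel" "u \<in> Lip c"
  shows "integrable \<mu> u"
proof -
  interpret prob_space \<mu> by fact
  obtain B where "\<And>x. \<bar>u x\<bar> \<le> B" using assms(3) unfolding Lip_def bounded_iff by auto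
  moreover have "u \<in> borel_measurable \<mu>"
    using Lip_measurable[OF assms(3)] measurable_cong_sets[OF assms(2) refl] by blast
  ultimately show ?thesis by (intro integrable_const_bound[where B = B]) auto
qed

lemma Lip_integral_diff_le:
  assumes \<mu>: "prob_space \<mu>" "sets \<mu> = sets borel" and u: "u \<in> Lip c"
  shows "ennreal \<bar>(\<integral>x. u x \<partial>\<mu>) - u x0\<bar> \<le> (\<integral>\<^sup>+x. c x x0 \<partial>\<mu>)"
proof -
  interpret prob_space \<mu> by fact
  note int = Lip_integrable[OF \<mu> u]
  have "\<bar>(\<integral>x. u x \<partial>\<mu>) - u x0\<bar> = \<bar>\<integral>x. u x - u x0 \<partial>\<mu>\<bar>"
    using int prob_space by simp
  also have "\<dots> \<le> (\<integral>x. \<bar>u x - u x0\<bar> \<partial>\<mu>)" by (rule integral_abs_bound)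
  finally have "ennreal \<bar>(\<integral>x. u x \<partial>\<mu>) - u x0\<bar> \<le> ennreal (\<integral>x. \<bar>u x - u x0\<bar> \<partial>\<mu>)"
    by (rule ennreal_leI)
  also have "\<dots> = (\<integral>\<^sup>+x. ennreal \<bar>u x - u x0\<bar> \<partial>\<mu>)"
    using int by (intro nn_integral_eq_integral[symmetric]) auto
  also have "\<dots> \<le> (\<integral>\<^sup>+x. c x x0 \<partial>\<mu>)"
    by (intro nn_integral_mono Lip_le u)
  finally show ?thesis .
qed

lemma Lip_integral_diff_le2:
  assumes \<mu>: "prob_space \<mu>" "sets \<mu> = sets borel" and \<nu>: "prob_space \<nu>" "sets \<nu> = sets borel"
    and u: "u \<in> Lip c"
  shows "ennreal \<bar>(\<integral>x. u x \<partial>\<mu>) - (\<integral>x. u x \<partial>\<nu>)\<bar> \<le> (\<integral>\<^sup>+x. c x x0 \<partial>\<mu>) + (\<integral>\<^sup>+x. c x x0 \<partial>\<nu>)"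
proof -
  have "ennreal \<bar>(\<integral>x. u x \<partial>\<mu>) - (\<integral>x. u x \<partial>\<nu>)\<bar> \<le> ennreal (\<bar>(\<integral>x. u x \<partial>\<mu>) - u x0\<bar> + \<bar>(\<integral>x. u x \<partial>\<nu>) - u x0\<bar>)"
    by (intro ennreal_leI) linarith
  also have "\<dots> = ennreal \<bar>(\<integral>x. u x \<partial>\<mu>) - u x0\<bar> + ennreal \<bar>(\<integral>x. u x \<partial>\<nu>) - u x0\<bar>"
    by (rule ennreal_plus) auto
  also have "\<dots> \<le> (\<integral>\<^sup>+x. c x x0 \<partial>\<mu>) + (\<integral>\<^sup>+x. c x x0 \<partial>\<nu>)"
    by (intro add_mono Lip_integral_diff_le \<mu> \<nu> u)
  finally show ?thesis .
qed

text \<open>Members of \<open>Lip c\<close> have no common bound. Centring at \<open>x0\<close>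
  makes them dominated by \<open>c x x0\<close>, which \<open>fin\<close> makes integrable.\<close>

lemma Lip_dominated_convergence:
  assumes \<mu>: "prob_space \<mu>" "sets \<mu> = sets borel" and u: "\<And>k. u k \<in> Lip c" and f: "f \<in> Lip c"
    and fin: "(\<integral>\<^sup>+x. c x x0 \<partial>\<mu>) < \<infinity>"
    and lim: "\<And>x. x \<in> S0 \<Longrightarrow> (\<lambda>k. u k x) \<longlonglongrightarrow> f x" and x0: "x0 \<in> S0" and S0: "AE x in \<mu>. x \<in> S0"
  shows "(\<lambda>k. (\<integral>x. u k x \<partial>\<mu>) - u k x0) \<longlonglongrightarrow> (\<integral>x. f x \<partial>\<mu>) - f x0"
proof -
  interpret prob_space \<mu> by fact
  note \<mu>(2)[measurable_cong]
  note [measurable] = borel_measurable_cost Lip_measurable[OF u] Lip_measurable[OF f]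
  have cfin: "AE x in \<mu>. c x x0 \<noteq> \<infinity>"
    using fin by (intro nn_integral_PInf_AE) auto
  have "(\<lambda>k. \<integral>x. u k x - u k x0 \<partial>\<mu>) \<longlonglongrightarrow> (\<integral>x. f x - f x0 \<partial>\<mu>)"
  proof (rule integral_dominated_convergence[where w = "\<lambda>x. enn2real (c x x0)"])
    have "(\<integral>\<^sup>+x. ennreal (enn2real (c x x0)) \<partial>\<mu>) = (\<integral>\<^sup>+x. c x x0 \<partial>\<mu>)"
      using cfin by (intro nn_integral_cong_AE) (auto elim!: eventually_mono simp: less_top)
    then show "integrable \<mu> (\<lambda>x. enn2real (c x x0))"
      using fin by (intro integrableI_nonneg) auto
    show "AE x in \<mu>. (\<lambda>k. u k x - u k x0) \<longlonglongrightarrow> f x - f x0"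
      using S0 by eventually_elim (intro tendsto_diff lim x0)
    show "AE x in \<mu>. norm (u k x - u k x0) \<le> enn2real (c x x0)" for k
      using cfin
    proof eventually_elim
      fix x assume "c x x0 \<noteq> \<infinity>"
      then have "enn2real (ennreal \<bar>u k x - u k x0\<bar>) \<le> enn2real (c x x0)"
        using Lip_le[OF u] by (intro enn2real_mono) (auto simp: less_top)
      then show "norm (u k x - u k x0) \<le> enn2real (c x x0)" by simp
    qed
  qed auto
  moreover have "(\<integral>x. v x - v x0 \<partial>\<mu>) = (\<integral>x. v x \<partial>\<mu>) - v x0" if "v \<in> Lip c" for v
    using Lip_integrable[OF \<mu> that] prob_space by simp
  ultimately show ?thesis using u f by simp
qed

text \<open>Diagonal choice: \<open>g (i k)\<close> is within \<open>1 / Suc k\<close> of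
  \<open>f\<close> on \<open>C k\<close>, hence converges to \<open>f\<close> on the whole union
  because the \<open>C k\<close> increase. The centring values at \<open>x0\<close> cancel in the
  difference of the two integrals.\<close>

lemma Lip_integral_diff_le_SUP:
  fixes g :: "nat \<Rightarrow> 's \<Rightarrow> real"
  assumes \<mu>: "prob_space \<mu>" "sets \<mu> = sets borel" and \<nu>: "prob_space \<nu>" "sets \<nu> = sets borel"
    and fin: "(\<integral>\<^sup>+x. c x x0 \<partial>\<mu>) < \<infinity>" "(\<integral>\<^sup>+x. c x x0 \<partial>\<nu>) < \<infinity>"
    and C: "incseq C" and x0: "x0 \<in> (\<Union>n. C n)"
    and S0: "AE x in \<mu>. x \<in> (\<Union>n. C n)" "AE x in \<nu>. x \<in> (\<Union>n. C n)"
    and g: "range g \<subseteq> Lip c" and dense: "\<And>f n e. f \<in> Lip c \<Longrightarrow> 0 < e \<Longrightarrow> \<exists>i. \<forall>x\<in>C n. \<bar>g i x - f x\<bar> < e"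
    and f: "f \<in> Lip c"
  shows "ennreal \<bar>(\<integral>x. f x \<partial>\<mu>) - (\<integral>x. f x \<partial>\<nu>)\<bar> \<le> (SUP i. ennreal \<bar>(\<integral>x. g i x \<partial>\<mu>) - (\<integral>x. g i x \<partial>\<nu>)\<bar>)"
proof -
  have "\<forall>k. \<exists>i. \<forall>x\<in>C k. \<bar>g i x - f x\<bar> < 1 / Suc k"
    using dense[OF f] by simp
  then obtain i where i: "\<And>k x. x \<in> C k \<Longrightarrow> \<bar>g (i k) x - f x\<bar> < 1 / Suc k"
    by metis
  have u: "g (i k) \<in> Lip c" for k using g by auto
  have lim: "(\<lambda>k. g (i k) x) \<longlonglongrightarrow> f x" if xC: "x \<in> (\<Union>n. C n)" for x
  proof -
    obtain n where n: "x \<in> C n" using xC by blast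
    have "(\<lambda>k. 1 / real (Suc k)) \<longlonglongrightarrow> 0" by real_asymp
    moreover have "\<forall>\<^sub>F k in sequentially. norm (g (i k) x - f x) \<le> 1 / real (Suc k)"
      using eventually_ge_at_top[of n]
    proof eventually_elim
      fix k assume "n \<le> k"
      then have "x \<in> C k" using n C by (auto dest: incseqD)
      from i[OF this] show "norm (g (i k) x - f x) \<le> 1 / real (Suc k)" by simp
    qed
    ultimately have "(\<lambda>k. g (i k) x - f x) \<longlonglongrightarrow> 0" by (rule Lim_null_comparison[rotated])
    then show ?thesis by (simp add: LIM_zero_iff)
  qed
  let ?D = "\<lambda>v. (\<integral>x. v x \<partial>\<mu>) - (\<integral>x. v x \<partial>\<nu>) :: real"
  have "(\<lambda>k. ((\<integral>x. g (i k) x \<partial>\<mu>) - g (i k) x0) - ((\<integral>x. g (i k) x \<partial>\<nu>) - g (i k) x0)) \<longlonglongrightarrow>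
      ((\<integral>x. f x \<partial>\<mu>) - f x0) - ((\<integral>x. f x \<partial>\<nu>) - f x0)"
    by (rule tendsto_diff[OF Lip_dominated_convergence[OF \<mu> u f fin(1) lim x0 S0(1)]
          Lip_dominated_convergence[OF \<nu> u f fin(2) lim x0 S0(2)]])
  then have "(\<lambda>k. \<bar>?D (g (i k))\<bar>) \<longlonglongrightarrow> \<bar>?D f\<bar>"
    by (intro tendsto_rabs) simp
  then have "(\<lambda>k. ennreal \<bar>?D (g (i k))\<bar>) \<longlonglongrightarrow> ennreal \<bar>?D f\<bar>"
    by (rule tendsto_ennrealI)
  then show ?thesis
    by (rule LIMSEQ_le_const2) (auto intro!: SUP_upper)
qed

text \<open>By monotonicity \<open>x\<close> and \<open>y\<close> lie in a common member of
  \<open>C\<close>, where each \<open>u\<close> in \<open>Lip c\<close> is uniformly approximated by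
  some \<open>g i\<close>, and \<open>\<bar>g i x - g i y\<bar>\<close> is at most
  \<open>max_dist g i x y\<close>.\<close>

lemma cost_eq_SUP_max_dist:
  assumes C: "incseq C" and x: "x \<in> (\<Union>n. C n)" and y: "y \<in> (\<Union>n. C n)"
    and g: "range g \<subseteq> Lip c" and dense: "\<And>f n e. f \<in> Lip c \<Longrightarrow> 0 < e \<Longrightarrow> \<exists>i. \<forall>x\<in>C n. \<bar>g i x - f x\<bar> < e"
  shows "c x y = (SUP n. ennreal (max_dist g n x y))"
proof (rule antisym)
  obtain m n where "x \<in> C m" "y \<in> C n" using x y by blast
  then have xy: "x \<in> C (max m n)" "y \<in> C (max m n)"
    using C by (meson incseqD max.cobounded1 max.cobounded2 subsetD)+
  show "c x y \<le> (SUP n. ennreal (max_dist g n x y))"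
    unfolding c[of x y]
  proof (rule SUP_least, rule ennreal_le_epsilon)
    fix u and e :: real assume u: "u \<in> Lip c" and "0 < e"
    then obtain i where i: "\<forall>x\<in>C (max m n). \<bar>g i x - u x\<bar> < e / 2"
      using dense[of u "e / 2"] by auto
    have "\<bar>u x - u y\<bar> \<le> \<bar>g i x - g i y\<bar> + e"
      using i xy by (smt (verit) field_sum_of_halves)
    also have "\<dots> \<le> max_dist g i x y + e" using max_dist_ge[of i i g x y] by simp
    finally have "ennreal \<bar>u x - u y\<bar> \<le> ennreal (max_dist g i x y) + ennreal e"
      using \<open>0 < e\<close> by (simp add: max_dist_nonneg ennreal_leI flip: ennreal_plus)
    also have "\<dots> \<le> (SUP n. ennreal (max_dist g n x y)) + ennreal e"
      by (intro add_right_mono SUP_upper) simp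
    finally show "ennreal \<bar>u x - u y\<bar> \<le> (SUP n. ennreal (max_dist g n x y)) + ennreal e" .
  qed
qed (auto intro!: SUP_least max_dist_le_cost[OF g])

end

section \<open>The coupling with minimal conditional cost\<close>

lemma space_join_algebra: "space (join_algebra F G) = space F"
  unfolding join_algebra_def by (rule space_measure_of_conv)

lemma sets_join_algebra:
  assumes "space G = space F"
  shows "sets F \<subseteq> sets (join_algebra F G)" "sets G \<subseteq> sets (join_algebra F G)"
proof -
  have "sets F \<union> sets G \<subseteq> Pow (space F)"
    using sets.space_closed[of F] sets.space_closed[of G] assms by auto
  then show "sets F \<subseteq> sets (join_algebra F G)" "sets G \<subseteq> sets (join_algebra F G)"
    unfolding join_algebra_def by auto
qed

lemma measurable_join_algebra1:
  assumes "space G = space F" "f \<in> F \<rightarrow>\<^sub>M K"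
  shows "f \<in> join_algebra F G \<rightarrow>\<^sub>M K"
  using assms(2) sets_join_algebra(1)[OF assms(1)]
  by (auto simp: measurable_def space_join_algebra)

lemma measurable_join_algebra2:
  assumes "space G = space F" "f \<in> G \<rightarrow>\<^sub>M K"
  shows "f \<in> join_algebra F G \<rightarrow>\<^sub>M K"
  using assms sets_join_algebra(2)[OF assms(1)]
  by (auto simp: measurable_def space_join_algebra)

lemma measurable_generated_algebra: "f \<in> generated_algebra P f \<rightarrow>\<^sub>M borel"
  unfolding generated_algebra_def by (rule measurable_vimage_algebra1) auto

lemma space_generated_algebra: "space (generated_algebra P f) = space P"
  unfolding generated_algebra_def by simp

text \<open>Weak duality holds for almost every \<open>\<omega>\<close> with \<open>w\<close> the
  real value of \<open>W \<omega>\<close>, and is then integrated. A measurable majorant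
  \<open>W\<close> stands in for the supremum over \<open>Lip c\<close>, which is
  uncountable.\<close>

lemma integrated_weak_duality:
  fixes c :: "'s::topological_space \<Rightarrow> 's \<Rightarrow> ennreal" and M :: "'w measure"
  assumes c: "\<And>x y. c x y = (SUP u\<in>Lip c. ennreal \<bar>u x - u y\<bar>)"
    and P: "prob_space P" and M: "subalgebra P M"
    and Q1: "prob_space Q1" "sets Q1 = sets (M \<Otimes>\<^sub>M borel)" and Q2: "prob_space Q2" "sets Q2 = sets (M \<Otimes>\<^sub>M borel)"
    and \<mu>: "\<mu> \<in> M \<rightarrow>\<^sub>M prob_algebra borel" and \<nu>: "\<nu> \<in> M \<rightarrow>\<^sub>M prob_algebra borel"
    and nn1: "\<And>f :: 'w \<times> 's \<Rightarrow> ennreal. f \<in> borel_measurable (M \<Otimes>\<^sub>M borel) \<Longrightarrow>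
      (\<integral>\<^sup>+z. f z \<partial>Q1) = (\<integral>\<^sup>+\<omega>. (\<integral>\<^sup>+x. f (\<omega>, x) \<partial>\<mu> \<omega>) \<partial>P)"
    and nn2: "\<And>f :: 'w \<times> 's \<Rightarrow> ennreal. f \<in> borel_measurable (M \<Otimes>\<^sub>M borel) \<Longrightarrow>
      (\<integral>\<^sup>+z. f z \<partial>Q2) = (\<integral>\<^sup>+\<omega>. (\<integral>\<^sup>+x. f (\<omega>, x) \<partial>\<nu> \<omega>) \<partial>P)"
    and g: "range g \<subseteq> Lip c"
    and W[measurable]: "W \<in> borel_measurable P" and W_fin: "(\<integral>\<^sup>+\<omega>. W \<omega> \<partial>P) < \<infinity>"
    and W_ge: "AE \<omega> in P. \<forall>f\<in>Lip c. ennreal \<bar>(\<integral>x. f x \<partial>\<mu> \<omega>) - (\<integral>x. f x \<partial>\<nu> \<omega>)\<bar> \<le> W \<omega>"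
    and a: "a \<in> borel_measurable Q1" "bounded (range a)" and b: "b \<in> borel_measurable Q2" "bounded (range b)"
    and "0 < l" and ge: "\<And>\<omega> x y. \<omega> \<in> space M \<Longrightarrow> 0 \<le> a (\<omega>, x) + b (\<omega>, y) + l * max_dist g n x y"
  shows "0 \<le> (\<integral>p. a p \<partial>Q1) + (\<integral>p. b p \<partial>Q2) + l * enn2real (\<integral>\<^sup>+\<omega>. W \<omega> \<partial>P)"
proof -
  interpret P: prob_space P by fact
  have spM: "space M = space P" using M by (simp add: subalgebra_def)
  have a': "a \<in> borel_measurable (M \<Otimes>\<^sub>M borel)" and b': "b \<in> borel_measurable (M \<Otimes>\<^sub>M borel)"
    using a(1) b(1) measurable_cong_sets[OF Q1(2) refl] measurable_cong_sets[OF Q2(2) refl] by blast+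
  note A = bounded_kernel_integral[OF P M Q1 \<mu> nn1 a' a(2)]
  note B = bounded_kernel_integral[OF P M Q2 \<nu> nn2 b' b(2)]
  have W_AE: "AE \<omega> in P. W \<omega> \<noteq> \<infinity>"
    using W_fin by (intro nn_integral_PInf_AE) auto
  have W_nn: "(\<integral>\<^sup>+\<omega>. ennreal (enn2real (W \<omega>)) \<partial>P) = (\<integral>\<^sup>+\<omega>. W \<omega> \<partial>P)"
    using W_AE by (intro nn_integral_cong_AE) (auto elim!: eventually_mono simp: less_top)
  have W_int: "integrable P (\<lambda>\<omega>. enn2real (W \<omega>))"
    using W_fin W_nn by (intro integrableI_nonneg) auto
  have W_eq: "(\<integral>\<omega>. enn2real (W \<omega>) \<partial>P) = enn2real (\<integral>\<^sup>+\<omega>. W \<omega> \<partial>P)"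
    by (subst integral_eq_nn_integral) (auto simp: W_nn)
  have "0 \<le> (\<integral>\<omega>. (\<integral>x. a (\<omega>, x) \<partial>\<mu> \<omega>) + (\<integral>x. b (\<omega>, x) \<partial>\<nu> \<omega>) + l * enn2real (W \<omega>) \<partial>P)"
  proof (rule integral_nonneg_AE)
    have "AE \<omega> in P. \<omega> \<in> space P" by simp
    with W_ge W_AE show "AE \<omega> in P. 0 \<le> (\<integral>x. a (\<omega>, x) \<partial>\<mu> \<omega>) + (\<integral>x. b (\<omega>, x) \<partial>\<nu> \<omega>) + l * enn2real (W \<omega>)"
    proof eventually_elim
      fix \<omega> assume W\<omega>: "\<forall>f\<in>Lip c. ennreal \<bar>(\<integral>x. f x \<partial>\<mu> \<omega>) - (\<integral>x. f x \<partial>\<nu> \<omega>)\<bar> \<le> W \<omega>"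
        and fin: "W \<omega> \<noteq> \<infinity>" and \<omega>: "\<omega> \<in> space P"
      have prob: "prob_space (\<mu> \<omega>)" "sets (\<mu> \<omega>) = sets borel" "prob_space (\<nu> \<omega>)" "sets (\<nu> \<omega>) = sets borel"
        using measurable_space[OF \<mu>] measurable_space[OF \<nu>] \<omega> spM by (auto simp: space_prob_algebra)
      show "0 \<le> (\<integral>x. a (\<omega>, x) \<partial>\<mu> \<omega>) + (\<integral>x. b (\<omega>, x) \<partial>\<nu> \<omega>) + l * enn2real (W \<omega>)"
      proof (rule weak_duality[OF prob, where d = "max_dist g n"])
        show "(\<lambda>x. a (\<omega>, x)) \<in> borel_measurable borel" "(\<lambda>x. b (\<omega>, x)) \<in> borel_measurable borel"
          using \<omega> spM measurable_compose[OF measurable_Pair1' a'] measurable_compose[OF measurable_Pair1' b'] by auto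
        show "bounded (range (\<lambda>x. a (\<omega>, x)))" "bounded (range (\<lambda>x. b (\<omega>, x)))"
          using a(2) b(2) by (auto elim: bounded_subset)
        show "0 \<le> a (\<omega>, x) + b (\<omega>, y) + l * max_dist g n x y" for x y
          using ge \<omega> spM by auto
      next
        fix f :: "'s \<Rightarrow> real" assume f: "bounded (range f)" "\<And>x y. \<bar>f x - f y\<bar> \<le> max_dist g n x y"
        have "continuous_on UNIV f"
        proof (rule continuous_if_max_dist_Lipschitz[OF _ f(2)])
          show "continuous_on UNIV (g i)" for i using g unfolding Lip_def by auto
        qed
        moreover have "ennreal \<bar>f x - f y\<bar> \<le> c x y" for x y
          using ennreal_leI[OF f(2)[of x y]] max_dist_le_cost[OF c g, of n x y] by (rule order_trans)
        ultimately have fL: "f \<in> Lip c" using f(1) unfolding Lip_def by auto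
        have "enn2real (ennreal \<bar>(\<integral>x. f x \<partial>\<mu> \<omega>) - (\<integral>x. f x \<partial>\<nu> \<omega>)\<bar>) \<le> enn2real (W \<omega>)"
          using W\<omega> fL fin by (intro enn2real_mono) (auto simp: less_top)
        then show "f \<in> borel_measurable borel \<and> (\<integral>x. f x \<partial>\<mu> \<omega>) - (\<integral>x. f x \<partial>\<nu> \<omega>) \<le> enn2real (W \<omega>)"
          using Lip_measurable[OF c fL] by simp
      qed (use \<open>0 < l\<close> in \<open>auto simp: max_dist_nonneg max_dist_self max_dist_triangle max_dist_commute\<close>)
    qed
  qed
  also have "\<dots> = (\<integral>p. a p \<partial>Q1) + (\<integral>p. b p \<partial>Q2) + l * enn2real (\<integral>\<^sup>+\<omega>. W \<omega> \<partial>P)"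
    using A B W_int by (simp add: W_eq)
  finally show ?thesis .
qed

theorem theorem3p1:
  fixes P M :: "'w measure"
    and c :: "'s::topological_space \<Rightarrow> 's \<Rightarrow> ennreal"
    and x0 :: 's
    and X :: "'w \<Rightarrow> 's"
    and PXM :: "'w \<Rightarrow> 's measure"
    and U :: "'w \<Rightarrow> real"
    and Q :: "('w \<times> 's) measure"
    and Qd :: "'w \<Rightarrow> 's measure"
  assumes "prob_space P"
    and "subalgebra P M"
    and "completely_regular_space (euclidean :: 's topology)"
    and "radon_space TYPE('s)"
    and "\<And>K :: 's set. compact K \<Longrightarrow> metrizable_space (top_of_set K)"
    and "\<And>x y. c x y = (SUP u\<in>Lip c. ennreal \<bar>u x - u y\<bar>)"
    and "X \<in> P \<rightarrow>\<^sub>M borel"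
    and "(\<integral>\<^sup>+ x. c x x0 \<partial>distr P borel X) < \<infinity>"
    and "regular_cond_distr P M X PXM"
    and "U \<in> P \<rightarrow>\<^sub>M restrict_space borel {0..1}"
    and "distr P lborel U = uniform_measure lborel {0..1}"
    and "prob_space.indep_set P (sets (generated_algebra P U))
          (sets (join_algebra (generated_algebra P X) M))"
    and "Q \<in> young_measures_c1 P M c x0"
    and "is_disintegration P M Q Qd"
  shows "\<exists>Y. Y \<in> join_algebra (generated_algebra P U) (join_algebra (generated_algebra P X) M) \<rightarrow>\<^sub>M borel \<and>
    regular_cond_distr P M Y Qd \<and>
    (\<lambda>\<omega>. c (X \<omega>) (Y \<omega>)) \<in> borel_measurable P \<and>
    (AE \<omega> in P. nn_cond_exp P M (\<lambda>\<omega>. c (X \<omega>) (Y \<omega>)) \<omega> =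
      (SUP f\<in>Lip c. ennreal \<bar>(\<integral>x. f x \<partial>PXM \<omega>) - (\<integral>x. f x \<partial>Qd \<omega>)\<bar>))"
proof -
  note M = assms(2) and rad = assms(4) and metr = assms(5) and c = assms(6) and \<mu> = assms(9)
  note X[measurable] = assms(7)
  interpret P: prob_space P by fact
  interpret finite_measure_subalgebra P M by unfold_locales (rule M)
  have spM: "space M = space P" using M by (simp add: subalgebra_def)
  have id_M[measurable]: "(\<lambda>\<omega>. \<omega>) \<in> P \<rightarrow>\<^sub>M M"
    by (rule measurable_from_subalg[OF M]) simp
  have H: "Hausdorff_space (euclidean :: 's topology)"
    by (rule Hausdorff_if_compacts_metrizable[OF assms(3) metr])
  note c_meas[measurable] = borel_measurable_cost[OF c]

  \<comment> \<open>The two prescribed laws on the product as mixtures of kernels\<close>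
  define N where "N = M \<Otimes>\<^sub>M (borel :: 's measure)"
  have Q2: "prob_space Q" "sets Q = sets (M \<Otimes>\<^sub>M borel)"
    and Q_fin: "(\<integral>\<^sup>+ z. c (snd z) x0 \<partial>Q) < \<infinity>"
    using assms(13) by (auto simp: young_measures_c1_def young_measures_def)
  interpret Q: prob_space Q by (rule Q2(1))
  note Q2(2)[measurable_cong]
  have spQ: "space Q = space P \<times> UNIV"
    using sets_eq_imp_space_eq[OF Q2(2)] spM by (simp add: space_pair_measure)
  have \<mu>M: "PXM \<in> M \<rightarrow>\<^sub>M prob_algebra borel"
    using \<mu> by (simp add: regular_cond_distr_def)
  have \<nu>M: "Qd \<in> M \<rightarrow>\<^sub>M prob_algebra borel"
    using assms(14) by (auto simp: is_disintegration_def intro: narrow_measurable_imp_prob_algebra)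
  have nn2: "(\<integral>\<^sup>+z. f z \<partial>Q) = (\<integral>\<^sup>+\<omega>. (\<integral>\<^sup>+x. f (\<omega>, x) \<partial>Qd \<omega>) \<partial>P)"
    if "f \<in> borel_measurable (M \<Otimes>\<^sub>M borel)" for f
    using assms(14) that by (auto simp: is_disintegration_def)
  define p where "p \<omega> = (\<omega>, X \<omega>)" for \<omega>
  have p[measurable]: "p \<in> P \<rightarrow>\<^sub>M N"
    unfolding p_def N_def by measurable
  define Q1 where "Q1 = distr P N p"
  have Q1: "prob_space Q1" "sets Q1 = sets (M \<Otimes>\<^sub>M borel)"
    unfolding Q1_def using P.prob_space_distr[OF p] by (simp_all add: N_def)
  have nn1: "(\<integral>\<^sup>+z. f z \<partial>Q1) = (\<integral>\<^sup>+\<omega>. (\<integral>\<^sup>+x. f (\<omega>, x) \<partial>PXM \<omega>) \<partial>P)"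
    if f: "f \<in> borel_measurable (M \<Otimes>\<^sub>M borel)" for f
  proof -
    have "(\<integral>\<^sup>+z. f z \<partial>Q1) = (\<integral>\<^sup>+\<omega>. f (\<omega>, X \<omega>) \<partial>P)"
      unfolding Q1_def using f by (subst nn_integral_distr[OF p]) (auto simp: N_def p_def)
    then show ?thesis
      using nn_integral_regular_cond_distr[OF assms(1) M X \<mu> f] by simp
  qed
  have prob: "prob_space (PXM \<omega>)" "sets (PXM \<omega>) = sets borel" "prob_space (Qd \<omega>)" "sets (Qd \<omega>) = sets borel"
    if "\<omega> \<in> space P" for \<omega>
    using measurable_space[OF \<mu>M] measurable_space[OF \<nu>M] that spM by (auto simp: space_prob_algebra)

  \<comment> \<open>A sigma-compact carrier, its code, and a countable family in
    \<open>Lip c\<close>\<close>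
  define PX where "PX = distr P borel X"
  define QS where "QS = distr Q borel (snd :: 'w \<times> 's \<Rightarrow> 's)"
  have snd_Q: "snd \<in> Q \<rightarrow>\<^sub>M (borel :: 's measure)" by measurable
  have PX: "finite_measure PX" "sets PX = sets borel" and QS: "finite_measure QS" "sets QS = sets borel"
    unfolding PX_def QS_def
    by (auto intro!: prob_space.finite_measure P.prob_space_distr Q.prob_space_distr)
  obtain C :: "nat \<Rightarrow> 's set" and \<phi> :: "'s \<Rightarrow> real" where
    C: "\<And>n. compact (C n)" "incseq C" and x0: "x0 \<in> (\<Union>n. C n)" and
    null: "measure PX (- (\<Union>n. C n)) = 0" "measure QS (- (\<Union>n. C n)) = 0" and
    \<phi>: "\<phi> \<in> borel_measurable borel" "\<And>n. continuous_on (C n) \<phi>" "inj_on \<phi> (\<Union>n. C n)"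
    "\<And>x. 0 \<le> \<phi> x" "\<And>x. \<phi> x < 2"
    using radon_coding[OF rad H metr PX QS, of x0] by blast
  define S0 where "S0 = (\<Union>n. C n)"
  have S0[measurable]: "S0 \<in> sets borel"
    unfolding S0_def using compact_imp_closed_Hausdorff[OF H C(1)] by auto
  obtain \<psi> :: "real \<Rightarrow> 's" where \<psi>[measurable]: "\<psi> \<in> borel \<rightarrow>\<^sub>M borel" and \<psi>_range: "range \<psi> \<subseteq> S0"
    and \<psi>\<phi>: "\<And>x. x \<in> S0 \<Longrightarrow> \<psi> (\<phi> x) = x"
    using coding_inverse[OF H C(1) x0 \<phi>(2,3)] unfolding S0_def by blast
  have Lip_ne: "Lip c \<noteq> {}"
  proof -
    have "(\<lambda>_. 0) \<in> Lip c" unfolding Lip_def by auto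
    then show ?thesis by blast
  qed
  obtain g :: "nat \<Rightarrow> 's \<Rightarrow> real" where g: "range g \<subseteq> Lip c"
    and dense: "\<And>f n e. f \<in> Lip c \<Longrightarrow> 0 < e \<Longrightarrow> \<exists>i. \<forall>x\<in>C n. \<bar>g i x - f x\<bar> < e"
  proof (rule continuous_family_separable[of C \<phi>, OF C(1) \<phi>(2) _ \<phi>(4,5) Lip_ne])
    show "inj_on \<phi> (C n)" for n using \<phi>(3) by (rule inj_on_subset) auto
    show "continuous_on UNIV f" if "f \<in> Lip c" for f using that by (simp add: Lip_def)
    fix g :: "nat \<Rightarrow> 's \<Rightarrow> real"
    assume g: "range g \<subseteq> Lip c" "\<And>f n e. f \<in> Lip c \<Longrightarrow> 0 < e \<Longrightarrow> \<exists>i. \<forall>x\<in>C n. \<bar>g i x - f x\<bar> < e"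
    show thesis by (rule that[OF g])
  qed
  have gi: "g i \<in> Lip c" for i using g by auto
  have g_meas[measurable]: "g i \<in> borel_measurable borel" for i by (rule Lip_measurable[OF c gi])
  have g_bdd: "bounded (range (g i))" for i using gi by (simp add: Lip_def)
  have c_max: "c x y = (SUP n. ennreal (max_dist g n x y))" if "x \<in> S0" "y \<in> S0" for x y
    using cost_eq_SUP_max_dist[OF c C(2) _ _ g dense] that unfolding S0_def by blast

  \<comment> \<open>Null sets outside the carrier\<close>
  have X_S0: "AE \<omega> in P. X \<omega> \<in> S0"
  proof -
    have "measure P (X -` (- S0) \<inter> space P) = 0"
      using null(1) unfolding PX_def S0_def[symmetric] by (simp add: measure_distr)
    then have "X -` (- S0) \<inter> space P \<in> null_sets P"
      by (auto simp: null_sets_def P.emeasure_eq_measure)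
    then show ?thesis by (rule AE_I') auto
  qed
  have Q_null: "measure Q (space P \<times> - S0) = 0"
  proof -
    have "snd -` (- S0) \<inter> space Q = space P \<times> - S0" by (auto simp: spQ)
    then show ?thesis
      using null(2) unfolding QS_def S0_def[symmetric] by (simp add: measure_distr[OF snd_Q])
  qed
  have \<mu>_S0: "AE \<omega> in P. AE x in PXM \<omega>. x \<in> S0"
  proof -
    have "(\<integral>\<^sup>+\<omega>. (\<integral>\<^sup>+x. indicator (- S0) (snd (\<omega>, x)) \<partial>PXM \<omega>) \<partial>P) = (\<integral>\<^sup>+z. indicator (- S0) (snd z) \<partial>Q1)"
      by (rule nn1[symmetric]) measurable
    also have "\<dots> = (\<integral>\<^sup>+\<omega>. indicator (- S0) (X \<omega>) \<partial>P)"
      unfolding Q1_def by (subst nn_integral_distr[OF p]) (auto simp: N_def p_def)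
    also have "\<dots> = 0"
      using X_S0 by (subst nn_integral_0_iff_AE) (auto elim!: eventually_mono)
    finally show ?thesis
      by (intro AE_AE_kernel[OF M \<mu>M S0]) simp
  qed
  have \<nu>_S0: "AE \<omega> in P. AE x in Qd \<omega>. x \<in> S0"
  proof -
    have "(\<integral>\<^sup>+\<omega>. (\<integral>\<^sup>+x. indicator (- S0) (snd (\<omega>, x)) \<partial>Qd \<omega>) \<partial>P) = (\<integral>\<^sup>+z. indicator (- S0) (snd z) \<partial>Q)"
      by (rule nn2[symmetric]) measurable
    also have "\<dots> = (\<integral>\<^sup>+z. indicator (space P \<times> - S0) z \<partial>Q)"
      by (intro nn_integral_cong) (auto simp: spQ indicator_def)
    also have "\<dots> = 0"
    proof -
      have "space P \<times> - S0 \<in> sets Q" unfolding spM[symmetric] by measurable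
      then show ?thesis using Q_null by (simp add: Q.emeasure_eq_measure)
    qed
    finally show ?thesis
      by (intro AE_AE_kernel[OF M \<nu>M S0]) simp
  qed

  \<comment> \<open>Integrability and measurability of the dual value\<close>
  have cost_meas: "(\<lambda>\<omega>. \<integral>\<^sup>+x. c x x0 \<partial>\<kappa> \<omega>) \<in> borel_measurable P"
    if "\<kappa> \<in> M \<rightarrow>\<^sub>M prob_algebra borel" for \<kappa>
    by (rule measurable_from_subalg[OF M], rule measurable_compose[OF measurable_prob_algebraD[OF that]
        nn_integral_measurable_subprob_algebra[OF c_meas]])
  have c1_fin: "(\<integral>\<^sup>+\<omega>. (\<integral>\<^sup>+x. c x x0 \<partial>PXM \<omega>) \<partial>P) < \<infinity>"
  proof -
    have "(\<integral>\<^sup>+\<omega>. (\<integral>\<^sup>+x. c (snd (\<omega>, x)) x0 \<partial>PXM \<omega>) \<partial>P) = (\<integral>\<^sup>+z. c (snd z) x0 \<partial>Q1)"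
      by (rule nn1[symmetric]) measurable
    also have "\<dots> = (\<integral>\<^sup>+\<omega>. c (X \<omega>) x0 \<partial>P)"
      unfolding Q1_def by (subst nn_integral_distr[OF p]) (auto simp: N_def p_def)
    also have "\<dots> = (\<integral>\<^sup>+ x. c x x0 \<partial>distr P borel X)"
      by (subst nn_integral_distr) auto
    finally show ?thesis using assms(8) by simp
  qed
  have c2_fin: "(\<integral>\<^sup>+\<omega>. (\<integral>\<^sup>+x. c x x0 \<partial>Qd \<omega>) \<partial>P) < \<infinity>"
  proof -
    have "(\<integral>\<^sup>+\<omega>. (\<integral>\<^sup>+x. c (snd (\<omega>, x)) x0 \<partial>Qd \<omega>) \<partial>P) = (\<integral>\<^sup>+z. c (snd z) x0 \<partial>Q)"
      by (rule nn2[symmetric]) measurable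
    then show ?thesis using Q_fin by simp
  qed

  let ?d = "\<lambda>f \<omega>. ennreal \<bar>(\<integral>x. f x \<partial>PXM \<omega>) - (\<integral>x. f x \<partial>Qd \<omega>)\<bar>"
  \<comment> \<open>A countable supremum, hence measurable; by \<open>W_ge\<close> it almost surely
    dominates the whole family \<open>Lip c\<close>.\<close>
  define W where "W \<omega> = (SUP i. ?d (g i) \<omega>)" for \<omega>
  have W_meas[measurable]: "W \<in> borel_measurable P"
  proof -
    have [measurable]: "(\<lambda>\<omega>. \<integral>x. g i x \<partial>\<kappa> \<omega>) \<in> borel_measurable P" if "\<kappa> \<in> M \<rightarrow>\<^sub>M prob_algebra borel" for \<kappa> i
      by (rule measurable_from_subalg[OF M], rule measurable_compose[OF measurable_prob_algebraD[OF that]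
          integral_measurable_subprob_algebra[OF g_meas]])
    note this[OF \<mu>M, measurable] this[OF \<nu>M, measurable]
    show ?thesis unfolding W_def by measurable
  qed
  have W_fin: "(\<integral>\<^sup>+\<omega>. W \<omega> \<partial>P) < \<infinity>"
  proof -
    have "(\<integral>\<^sup>+\<omega>. W \<omega> \<partial>P) \<le> (\<integral>\<^sup>+\<omega>. (\<integral>\<^sup>+x. c x x0 \<partial>PXM \<omega>) + (\<integral>\<^sup>+x. c x x0 \<partial>Qd \<omega>) \<partial>P)"
      unfolding W_def by (intro nn_integral_mono SUP_least Lip_integral_diff_le2[OF c] prob gi)
    also have "\<dots> = (\<integral>\<^sup>+\<omega>. (\<integral>\<^sup>+x. c x x0 \<partial>PXM \<omega>) \<partial>P) + (\<integral>\<^sup>+\<omega>. (\<integral>\<^sup>+x. c x x0 \<partial>Qd \<omega>) \<partial>P)"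
      by (intro nn_integral_add cost_meas \<mu>M \<nu>M)
    also have "\<dots> < \<infinity>" using c1_fin c2_fin by (simp add: less_top)
    finally show ?thesis .
  qed
  have W_ge: "AE \<omega> in P. \<forall>f\<in>Lip c. ?d f \<omega> \<le> W \<omega>"
  proof -
    have "AE \<omega> in P. (\<integral>\<^sup>+x. c x x0 \<partial>PXM \<omega>) \<noteq> \<infinity>"
      by (rule nn_integral_PInf_AE[OF cost_meas[OF \<mu>M]]) (use c1_fin in simp)
    moreover have "AE \<omega> in P. (\<integral>\<^sup>+x. c x x0 \<partial>Qd \<omega>) \<noteq> \<infinity>"
      by (rule nn_integral_PInf_AE[OF cost_meas[OF \<nu>M]]) (use c2_fin in simp)
    moreover note \<mu>_S0 \<nu>_S0
    moreover have "AE \<omega> in P. \<omega> \<in> space P" by simp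
    ultimately show ?thesis
    proof eventually_elim
      case (elim \<omega>)
      show ?case
        unfolding W_def
        by (intro ballI Lip_integral_diff_le_SUP[OF c prob[OF elim(5)] _ _ C(2) x0 _ _ g dense])
          (use elim in \<open>auto simp: S0_def less_top\<close>)
    qed
  qed

  \<comment> \<open>The coupling on the auxiliary product space\<close>
  define V where "V = enn2real (\<integral>\<^sup>+\<omega>. W \<omega> \<partial>P)"
  define \<Lambda> :: "real measure" where "\<Lambda> = uniform_measure lborel {0..1}"
  obtain Z :: "('w \<times> 's) \<times> real \<Rightarrow> real" where
    Z[measurable]: "Z \<in> borel_measurable ((M \<Otimes>\<^sub>M borel) \<Otimes>\<^sub>M borel)" and
    Z_law: "\<And>A E. A \<in> sets M \<Longrightarrow> E \<in> sets borel \<Longrightarrow> emeasure (Q1 \<Otimes>\<^sub>M \<Lambda>)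
        {z \<in> space ((M \<Otimes>\<^sub>M borel) \<Otimes>\<^sub>M borel). fst (fst z) \<in> A \<and> \<psi> (Z z) \<in> E} = emeasure Q (A \<times> E)" and
    Z_cost: "\<And>n. (\<integral>\<^sup>+z. ennreal (max_dist g n (snd (fst z)) (\<psi> (Z z))) \<partial>(Q1 \<Otimes>\<^sub>M \<Lambda>)) \<le> ennreal V"
  proof (rule coupling_realization[OF Q1 Q2 g_meas g_bdd _ \<phi>(1,4,5) \<psi> S0 _ \<psi>\<phi>, where V = V])
    fix a b :: "'w \<times> 's \<Rightarrow> real" and l n
    assume "a \<in> borel_measurable Q1" "b \<in> borel_measurable Q" "bounded (range a)" "bounded (range b)" "0 < l"
      "\<And>\<omega> x y. \<omega> \<in> space M \<Longrightarrow> 0 \<le> a (\<omega>, x) + b (\<omega>, y) + l * max_dist g n x y"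
    then show "0 \<le> (\<integral>p. a p \<partial>Q1) + (\<integral>p. b p \<partial>Q) + l * V"
      unfolding V_def by (intro integrated_weak_duality[OF c assms(1) M Q1 Q2 \<mu>M \<nu>M nn1 nn2 g W_meas W_fin W_ge])
  next
    show "measure Q (space M \<times> - S0) = 0" using Q_null spM by simp
  next
    fix Z :: "('w \<times> 's) \<times> real \<Rightarrow> real"
    assume Z: "Z \<in> borel_measurable ((M \<Otimes>\<^sub>M borel) \<Otimes>\<^sub>M borel)"
      "\<And>A E. A \<in> sets M \<Longrightarrow> E \<in> sets borel \<Longrightarrow> emeasure (Q1 \<Otimes>\<^sub>M uniform_measure lborel {0..1})
        {z \<in> space ((M \<Otimes>\<^sub>M borel) \<Otimes>\<^sub>M borel). fst (fst z) \<in> A \<and> \<psi> (Z z) \<in> E} = emeasure Q (A \<times> E)"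
      "\<And>n. (\<integral>\<^sup>+z. ennreal (max_dist g n (snd (fst z)) (\<psi> (Z z))) \<partial>(Q1 \<Otimes>\<^sub>M uniform_measure lborel {0..1})) \<le> ennreal V"
    show thesis by (rule that) (use Z in \<open>simp_all add: \<Lambda>_def\<close>)
  qed

  \<comment> \<open>Transfer to the given probability space through \<open>U\<close>\<close>
  define N1 where "N1 = join_algebra (generated_algebra P X) M"
  define N2 where "N2 = join_algebra (generated_algebra P U) N1"
  have sp1: "space N1 = space P" "space N2 = space P"
    by (simp_all add: N1_def N2_def space_join_algebra space_generated_algebra)
  have X_N1: "X \<in> N1 \<rightarrow>\<^sub>M borel"
    unfolding N1_def
    by (rule measurable_join_algebra1[OF _ measurable_generated_algebra]) (simp add: space_generated_algebra spM)
  have id_N1: "(\<lambda>\<omega>. \<omega>) \<in> N1 \<rightarrow>\<^sub>M M"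
    unfolding N1_def by (rule measurable_join_algebra2) (simp_all add: space_generated_algebra spM)
  have p_N1: "p \<in> N1 \<rightarrow>\<^sub>M N"
    unfolding p_def N_def using X_N1 id_N1 by measurable
  have N2_N1: "f \<in> N2 \<rightarrow>\<^sub>M K" if "f \<in> N1 \<rightarrow>\<^sub>M K" for f and K :: "'k measure"
    unfolding N2_def using that by (intro measurable_join_algebra2) (simp_all add: space_generated_algebra sp1)
  have U_N2: "U \<in> N2 \<rightarrow>\<^sub>M borel"
    unfolding N2_def
    by (intro measurable_join_algebra1 measurable_generated_algebra) (simp add: space_generated_algebra sp1)
  have U[measurable]: "U \<in> borel_measurable P"
    using assms(10) by (simp add: measurable_restrict_space2_iff)
  have pU[measurable]: "(\<lambda>\<omega>. (p \<omega>, U \<omega>)) \<in> P \<rightarrow>\<^sub>M N \<Otimes>\<^sub>M borel" by measurable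
  have \<Lambda>: "distr P borel U = \<Lambda>"
    unfolding \<Lambda>_def assms(11)[symmetric] by (rule distr_cong) auto
  \<comment> \<open>\<open>p\<close> is measurable for \<open>N1\<close>, the join of the algebra of
    \<open>X\<close> with \<open>M\<close>, so independence of \<open>U\<close> from
    \<open>N1\<close> gives the product law.\<close>
  have joint: "distr P (N \<Otimes>\<^sub>M borel) (\<lambda>\<omega>. (p \<omega>, U \<omega>)) = Q1 \<Otimes>\<^sub>M \<Lambda>"
  proof (rule pair_measure_eqI[symmetric])
    show "sigma_finite_measure Q1"
      by (intro finite_measure.sigma_finite_measure prob_space.finite_measure Q1(1))
    show "sigma_finite_measure \<Lambda>"
      unfolding \<Lambda>[symmetric] by (intro finite_measure.sigma_finite_measure prob_space.finite_measure P.prob_space_distr U)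
    show "sets (Q1 \<Otimes>\<^sub>M \<Lambda>) = sets (distr P (N \<Otimes>\<^sub>M borel) (\<lambda>\<omega>. (p \<omega>, U \<omega>)))"
      unfolding sets_distr by (intro sets_pair_measure_cong) (simp_all add: Q1_def \<Lambda>_def)
    fix A B assume "A \<in> sets Q1" "B \<in> sets \<Lambda>"
    then have A: "A \<in> sets N" and B: "B \<in> sets borel"
      by (simp_all add: Q1_def \<Lambda>_def)
    have "P.prob ((U -` B \<inter> space P) \<inter> (p -` A \<inter> space P)) = P.prob (U -` B \<inter> space P) * P.prob (p -` A \<inter> space P)"
      using measurable_sets[OF p_N1 A] measurable_sets[OF measurable_generated_algebra[of U P] B]
      by (intro P.indep_setD[OF assms(12)[folded N1_def]]) (simp_all add: sp1 space_generated_algebra)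
    moreover have "(U -` B \<inter> space P) \<inter> (p -` A \<inter> space P) = (\<lambda>\<omega>. (p \<omega>, U \<omega>)) -` (A \<times> B) \<inter> space P"
      by auto
    moreover have "emeasure Q1 A = P.prob (p -` A \<inter> space P)"
      unfolding Q1_def by (simp add: emeasure_distr[OF p A] P.emeasure_eq_measure)
    moreover have "emeasure \<Lambda> B = P.prob (U -` B \<inter> space P)"
      unfolding \<Lambda>[symmetric] by (simp add: emeasure_distr[OF U B] P.emeasure_eq_measure)
    moreover have "emeasure (distr P (N \<Otimes>\<^sub>M borel) (\<lambda>\<omega>. (p \<omega>, U \<omega>))) (A \<times> B) =
        P.prob ((\<lambda>\<omega>. (p \<omega>, U \<omega>)) -` (A \<times> B) \<inter> space P)"
      using A B by (simp add: emeasure_distr[OF pU] P.emeasure_eq_measure)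
    ultimately show "emeasure Q1 A * emeasure \<Lambda> B = emeasure (distr P (N \<Otimes>\<^sub>M borel) (\<lambda>\<omega>. (p \<omega>, U \<omega>))) (A \<times> B)"
      by (simp add: ennreal_mult' mult.commute)
  qed

  \<comment> \<open>The variable \<open>Y\<close> and its conditional law\<close>
  define Y0 where "Y0 \<omega> = \<psi> (Z (p \<omega>, U \<omega>))" for \<omega>
  \<comment> \<open>Off the carrier \<open>Y\<close> is set equal to \<open>X\<close>. There
    \<open>c\<close> and every \<open>max_dist\<close> vanish, so \<open>cost_eq\<close> holds at
    every \<open>\<omega>\<close>, and the cost is measurable even though \<open>P\<close> need not
    be complete.\<close>
  define Y where "Y \<omega> = (if X \<omega> \<in> S0 then Y0 \<omega> else X \<omega>)" for \<omega>
  have Y0_S0: "Y0 \<omega> \<in> S0" for \<omega> using \<psi>_range by (auto simp: Y0_def)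
  have Z_N[measurable]: "Z \<in> borel_measurable (N \<Otimes>\<^sub>M borel)" using Z by (simp add: N_def)
  have Y_N2: "Y \<in> N2 \<rightarrow>\<^sub>M borel"
  proof -
    note [measurable] = N2_N1[OF X_N1] N2_N1[OF p_N1] U_N2
    show ?thesis unfolding Y_def Y0_def by measurable
  qed
  have Y0[measurable]: "Y0 \<in> P \<rightarrow>\<^sub>M borel" unfolding Y0_def by measurable
  have Y[measurable]: "Y \<in> P \<rightarrow>\<^sub>M borel" unfolding Y_def by measurable
  have Y_Y0: "AE \<omega> in P. Y \<omega> = Y0 \<omega>"
    using X_S0 by eventually_elim (simp add: Y_def)

  have Y_law: "emeasure P {\<omega> \<in> A. Y \<omega> \<in> E} = emeasure Q (A \<times> E)" if A[measurable]: "A \<in> sets M" and E[measurable]: "E \<in> sets borel" for A E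
  proof -
    have AP: "A \<in> sets P" using A M by (auto simp: subalgebra_def)
    note [measurable] = AP
    let ?B = "{z \<in> space ((M \<Otimes>\<^sub>M borel) \<Otimes>\<^sub>M borel). fst (fst z) \<in> A \<and> \<psi> (Z z) \<in> E}"
    have B: "?B \<in> sets (N \<Otimes>\<^sub>M borel)" unfolding N_def by measurable
    have eqA: "{\<omega> \<in> A. f \<omega> \<in> E} = {\<omega> \<in> space P. \<omega> \<in> A \<and> f \<omega> \<in> E}" for f
      using sets.sets_into_space[OF AP] by auto
    have "emeasure P {\<omega> \<in> A. Y \<omega> \<in> E} = emeasure P {\<omega> \<in> A. Y0 \<omega> \<in> E}"
      unfolding eqA by (rule emeasure_eq_AE) (use Y_Y0 in \<open>auto elim!: eventually_mono\<close>)
    also have "{\<omega> \<in> A. Y0 \<omega> \<in> E} = (\<lambda>\<omega>. (p \<omega>, U \<omega>)) -` ?B \<inter> space P"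
      using measurable_space[OF pU] sets.sets_into_space[OF AP]
      by (auto simp: Y0_def N_def p_def)
    also have "emeasure P \<dots> = emeasure (Q1 \<Otimes>\<^sub>M \<Lambda>) ?B"
      unfolding joint[symmetric] by (rule emeasure_distr[OF pU B, symmetric])
    also have "\<dots> = emeasure Q (A \<times> E)" by (rule Z_law[OF A E])
    finally show ?thesis .
  qed

  have Y_rcd: "regular_cond_distr P M Y Qd"
    unfolding regular_cond_distr_def
  proof (intro conjI \<nu>M ballI)
    fix B :: "'s set" assume B[measurable]: "B \<in> sets borel"
    show "AE \<omega> in P. emeasure (Qd \<omega>) B = nn_cond_exp P M (indicator (Y -` B)) \<omega>"
    proof (rule nn_cond_exp_charact)
      show "(\<lambda>\<omega>. emeasure (Qd \<omega>) B) \<in> borel_measurable M"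
        by (rule measurable_compose[OF measurable_prob_algebraD[OF \<nu>M] measurable_emeasure_subprob_algebra[OF B]])
      have "(\<lambda>\<omega>. indicator B (Y \<omega>) :: ennreal) \<in> borel_measurable P" by measurable
      then show "indicator (Y -` B) \<in> borel_measurable P" by (simp add: indicator_def vimage_def)
      fix A assume A[measurable]: "A \<in> sets M"
      have AP[measurable]: "A \<in> sets P" using A M by (auto simp: subalgebra_def)
      have AB: "A \<times> B \<in> sets (M \<Otimes>\<^sub>M borel)" by measurable
      have "{\<omega> \<in> space P. \<omega> \<in> A \<and> Y \<omega> \<in> B} \<in> sets P" by measurable
      also have "{\<omega> \<in> space P. \<omega> \<in> A \<and> Y \<omega> \<in> B} = {\<omega> \<in> A. Y \<omega> \<in> B}"
        using sets.sets_into_space[OF AP] by auto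
      finally have "(\<integral>\<^sup>+\<omega>. indicator {\<omega> \<in> A. Y \<omega> \<in> B} \<omega> \<partial>P) = emeasure P {\<omega> \<in> A. Y \<omega> \<in> B}"
        by (rule nn_integral_indicator)
      moreover have "(\<integral>\<^sup>+\<omega>\<in>A. indicator (Y -` B) \<omega> \<partial>P) = (\<integral>\<^sup>+\<omega>. indicator {\<omega> \<in> A. Y \<omega> \<in> B} \<omega> \<partial>P)"
        by (intro nn_integral_cong) (auto simp: indicator_def)
      moreover have "emeasure Q (A \<times> B) = (\<integral>\<^sup>+\<omega>\<in>A. emeasure (Qd \<omega>) B \<partial>P)"
      proof -
        have "emeasure Q (A \<times> B) = (\<integral>\<^sup>+z. indicator (A \<times> B) z \<partial>Q)"
          using AB Q2(2) by simp
        also have "\<dots> = (\<integral>\<^sup>+\<omega>. (\<integral>\<^sup>+x. indicator (A \<times> B) (\<omega>, x) \<partial>Qd \<omega>) \<partial>P)"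
          using AB by (intro nn2) auto
        also have "\<dots> = (\<integral>\<^sup>+\<omega>\<in>A. emeasure (Qd \<omega>) B \<partial>P)"
        proof (rule nn_integral_cong)
          fix \<omega> assume \<omega>: "\<omega> \<in> space P"
          have "(\<integral>\<^sup>+x. indicator (A \<times> B) (\<omega>, x) \<partial>Qd \<omega>) = (\<integral>\<^sup>+x. indicator A \<omega> * indicator B x \<partial>Qd \<omega>)"
            by (intro nn_integral_cong) (auto simp: indicator_def)
          also have "\<dots> = indicator A \<omega> * emeasure (Qd \<omega>) B"
            using prob(4)[OF \<omega>] by (subst nn_integral_cmult_indicator) auto
          finally show "(\<integral>\<^sup>+x. indicator (A \<times> B) (\<omega>, x) \<partial>Qd \<omega>) = emeasure (Qd \<omega>) B * indicator A \<omega>"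
            by (simp add: mult.commute)
        qed
        finally show ?thesis .
      qed
      ultimately show "(\<integral>\<^sup>+\<omega>\<in>A. indicator (Y -` B) \<omega> \<partial>P) = (\<integral>\<^sup>+\<omega>\<in>A. emeasure (Qd \<omega>) B \<partial>P)"
        using Y_law[OF A B] by simp
    qed
  qed

  \<comment> \<open>The total cost of the coupling\<close>
  have cost_eq: "c (X \<omega>) (Y \<omega>) = (SUP n. ennreal (max_dist g n (X \<omega>) (Y \<omega>)))" for \<omega>
  proof (cases "X \<omega> \<in> S0")
    case True
    then show ?thesis using Y0_S0 by (intro c_max) (auto simp: Y_def)
  next
    case False
    then show ?thesis by (simp add: Y_def cost_self[OF c] max_dist_self)
  qed
  have dm[measurable]: "(\<lambda>\<omega>. max_dist g n (X \<omega>) (Y \<omega>)) \<in> borel_measurable P" for n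
    by (rule measurable_max_dist[OF g_meas X Y])
  have cost_meas_P: "(\<lambda>\<omega>. c (X \<omega>) (Y \<omega>)) \<in> borel_measurable P"
    unfolding cost_eq by measurable
  have total: "(\<integral>\<^sup>+\<omega>. c (X \<omega>) (Y \<omega>) \<partial>P) \<le> (\<integral>\<^sup>+\<omega>. W \<omega> \<partial>P)"
  proof -
    have "(\<integral>\<^sup>+\<omega>. c (X \<omega>) (Y \<omega>) \<partial>P) = (SUP n. \<integral>\<^sup>+\<omega>. ennreal (max_dist g n (X \<omega>) (Y \<omega>)) \<partial>P)"
      unfolding cost_eq
      by (rule nn_integral_monotone_convergence_SUP) (auto simp: incseq_def le_fun_def intro!: ennreal_leI max_dist_mono)
    also have "\<dots> \<le> ennreal V"
    proof (rule SUP_least)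
      fix n
      have "(\<integral>\<^sup>+\<omega>. ennreal (max_dist g n (X \<omega>) (Y \<omega>)) \<partial>P) =
          (\<integral>\<^sup>+\<omega>. ennreal (max_dist g n (snd (fst (p \<omega>, U \<omega>))) (\<psi> (Z (p \<omega>, U \<omega>)))) \<partial>P)"
        using Y_Y0 by (intro nn_integral_cong_AE) (auto elim!: eventually_mono simp: p_def Y0_def)
      also have "\<dots> = (\<integral>\<^sup>+z. ennreal (max_dist g n (snd (fst z)) (\<psi> (Z z))) \<partial>(Q1 \<Otimes>\<^sub>M \<Lambda>))"
      proof -
        have [measurable]: "(\<lambda>z. max_dist g n (snd (fst z)) (\<psi> (Z z))) \<in> borel_measurable (N \<Otimes>\<^sub>M borel)"
          by (rule measurable_max_dist[OF g_meas]) (unfold N_def, measurable)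
        show ?thesis
          unfolding joint[symmetric] by (rule nn_integral_distr[OF pU, symmetric]) measurable
      qed
      also have "\<dots> \<le> ennreal V" by (rule Z_cost)
      finally show "(\<integral>\<^sup>+\<omega>. ennreal (max_dist g n (X \<omega>) (Y \<omega>)) \<partial>P) \<le> ennreal V" .
    qed
    also have "\<dots> = (\<integral>\<^sup>+\<omega>. W \<omega> \<partial>P)" using W_fin by (simp add: V_def less_top)
    finally show ?thesis .
  qed

  \<comment> \<open>From total cost to conditional cost\<close>
  let ?E = "nn_cond_exp P M (\<lambda>\<omega>. c (X \<omega>) (Y \<omega>))"
  have E_meas: "?E \<in> borel_measurable P"
    by (rule measurable_from_subalg[OF M]) simp
  have E_int: "(\<integral>\<^sup>+\<omega>. ?E \<omega> \<partial>P) = (\<integral>\<^sup>+\<omega>. c (X \<omega>) (Y \<omega>) \<partial>P)"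
    using nn_cond_exp_intg[of "\<lambda>_. 1" "\<lambda>\<omega>. c (X \<omega>) (Y \<omega>)"] cost_meas_P by simp
  \<comment> \<open>Only countably many test functions are compared, so their exceptional sets unite
    to one null set; \<open>W\<close> is the supremum of exactly these.\<close>
  have "AE \<omega> in P. \<forall>i. ?d (g i) \<omega> \<le> ?E \<omega>"
    unfolding AE_all_countable
    by (intro allI cond_exp_cost_ge[OF assms(1) M X Y \<mu> Y_rcd g_meas g_bdd cost_meas_P] Lip_le[OF c gi])
  then have "AE \<omega> in P. W \<omega> \<le> ?E \<omega>"
    by eventually_elim (auto simp: W_def intro: SUP_least)
  then have "AE \<omega> in P. ?E \<omega> = W \<omega>"
    using total E_int by (intro AE_eq_if_nn_integral_le W_meas E_meas W_fin) auto
  with W_ge have "AE \<omega> in P. ?E \<omega> = (SUP f\<in>Lip c. ?d f \<omega>)"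
  proof eventually_elim
    case (elim \<omega>)
    show ?case
    proof (rule antisym)
      show "?E \<omega> \<le> (SUP f\<in>Lip c. ?d f \<omega>)"
        unfolding elim(2) W_def by (intro SUP_least SUP_upper gi)
      show "(SUP f\<in>Lip c. ?d f \<omega>) \<le> ?E \<omega>"
        using elim by (intro SUP_least) auto
    qed
  qed
  then show ?thesis
    using Y_N2 Y_rcd cost_meas_P unfolding N2_def N1_def by blast
qed

end
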